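(* Let $m\ge1$, $n:=2m-1$, and let $\mathbf d=(d_1<d_2<\cdots<d_s)$ be positive integers with $d_s\le 2m$ whose set of entries is preserved by the map $d_i\mapsto 2m-d_i$. Let $\lambda=\omega_{2d_1-1}+\cdots+\omega_{2d_s-1}$ and $Q=P_\lambda^\iota$. There exists a $T^\iota$-equivariant isomorphism of projective varieties $$\zeta:\mathrm{Sp}\mathcal{F}^a_{\mathbf d}\xrightarrow{\ \simeq\ }X^\iota_{\sigma_{\mathbf d}}\subset Sp_{2n}/Q,$$ where, with the conventions $d_0:=0$ and $d_{s+1}:=n+1$, $\sigma_{\mathbf d}\in\mathrm{Sym}_{2n}$ is the permutation $$\sigma_{\mathbf d}(k)=\begin{cases}k-d_i&\text{if }k\in\{2d_i,\dots,d_i+d_{i+1}-1\},\\ n+1+k-d_{i+1}&\text{if }k\in\{d_i+d_{i+1},\dots,2d_{i+1}-1\}\end{cases}\qquad(1\le k\le 2n,\ 0\le i\le s).$$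
   Context: All varieties are over $\mathbb{C}$. (The stability of $\mathbf d$ under $d\mapsto 2m-d$ forces $d_s\le 2m-1=n$.) Partial degenerate symplectic flag variety. Let $V\simeq\mathbb{C}^{2m}=\mathbb{C}^{n+1}$ with ordered basis $f_1,\dots,f_{2m}$, $\mathrm{pr}_k(\sum_i a_if_i)=\sum_{i\ne k}a_if_i$, $\mathrm{pr}_{i,j}=\mathrm{pr}_{j-1}\circ\cdots\circ\mathrm{pr}_i$ for $1\le i<j\le n$, and $$\mathcal{F}l^a_{\mathbf d}=\Big\{(V_1,\dots,V_s)\in\prod_{l=1}^s\mathrm{Gr}_{d_l}(V)\ \Big|\ \mathrm{pr}_{d_l,d_{l+1}}(V_l)\subset V_{l+1}\ \text{for }l=1,\dots,s-1\Big\}.$$ Equip $V$ with the non-degenerate skew-symmetric form $b_V$ determined by $b_V[f_k,f_{2m-1-k}]=1$ for $1\le k\le m-1$, $b_V[f_{2m-1},f_{2m}]=1$, and $b_V[f_k,f_l]=0$ for all other pairs $k<l$. The involution $\iota:(V_1,\dots,V_s)\mapsto(V_s^\perp,\dots,V_1^\perp)$ of $\prod_l\mathrm{Gr}_{d_l}(V)$ preserves $\mathcal{F}l^a_{\mathbf d}$, and $\mathrm{Sp}\mathcal{F}^a_{\mathbf d}=(\mathcal{F}l^a_{\mathbf d})^\iota$ is the partial degenerate symplectic flag variety. Symplectic group and Schubert variety. Let $W\simeq\mathbb{C}^{2n}$ with ordered basis $e_1,\dots,e_{2n}$, with the form $b_W$ given by $E=\begin{pmatrix}0&J\\-J&0\end{pmatrix}$,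 where $J$ is the $n\times n$ anti-diagonal matrix with all anti-diagonal entries $1$. Define $\iota:SL_{2n}\to SL_{2n}$ by $\iota(A)=E({}^tA)^{-1}E^{-1}$; its fixed-point group is $Sp_{2n}$. Let $B\subset SL_{2n}$ be the upper triangular and $T\subset B$ the diagonal matrices; $B^\iota$ is a Borel subgroup of $Sp_{2n}$ and $T^\iota=T\cap Sp_{2n}$ its maximal torus. $P_\lambda\supseteq B$ is the parabolic subgroup that is the stabilizer of $\lambda$ ($\omega_i$ the fundamental weights of $SL_{2n}$); $SL_{2n}/P_\lambda$ is the variety of partial flags $W_1\subset\cdots\subset W_s$ in $W$ with $\dim W_i=2d_i-1$. $P_\lambda$ is $\iota$-stable and $Q=P_\lambda^\iota=P_\lambda\cap Sp_{2n}$ is parabolic in $Sp_{2n}$. The involution $\iota:(W_1,\dots,W_s)\mapsto(W_s^\perp,\dots,W_1^\perp)$ (orthogonals with respect to $b_W$) acts on $SL_{2n}/P_\lambda$, with $(SL_{2n}/P_\lambda)^\iota=Sp_{2n}/Q$. $X_{\sigma_{\mathbf d}}=\overline{B\sigma_{\mathbf d}P_\lambda/P_\lambda}$ is the closure of the $B$-orbit of the flag with $i$-th subspace $\langle e_{\sigma_{\mathbf d}(1)},\dots,e_{\sigma_{\mathbf d}(2d_i-1)}\rangle$; it is $\iota$-stable, and its fixed-point set $X_{\sigma_{\mathbf d}}^\iota$ is the Schubert variety $\overline{B^\iota\sigma_{\mathbf d}Q/Q}$ in $Sp_{2n}/Q$. Torus actions. $\underline\lambda=\mathrm{diag}(\lambda_1,\dots,\lambda_{2n})\in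 T$ acts on $W$ by $\underline\lambda e_k=\lambda_ke_k$ and on the factor $\mathrm{Gr}_{d_l}(V)$ through the linear action on $V$ given by $f_k\mapsto\lambda_kf_k$ if $d_l\le k\le n+1$ and $f_k\mapsto\lambda_{n+1+k}f_k$ if $1\le k\le d_l-1$. These induce actions of $T$ on $X_{\sigma_{\mathbf d}}$ and $\mathcal{F}l^a_{\mathbf d}$, and of $T^\iota$ on $X_{\sigma_{\mathbf d}}^\iota$ and $\mathrm{Sp}\mathcal{F}^a_{\mathbf d}$. *)

theory Defs
  imports
    "HOL-Analysis.Abstract_Topology"
    "HOL-Combinatorics.Permutations"
    "Jordan_Normal_Form.DL_Submatrix"
    "Jordan_Normal_Form.DL_Rank"
    "Jordan_Normal_Form.Gauss_Jordan_Elimination"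
begin

text \<open>
  Vectors are the zero-based complex vectors of \<^theory>\<open>Jordan_Normal_Form.Matrix\<close>: the
  \<open>k\<close>-th basis vector (\<open>k \<ge> 1\<close>) of \<open>V = \<complex>^(n+1)\<close> or \<open>W = \<complex>^(2n)\<close> is
  \<open>unit_vec _ (k - 1)\<close>.  A tuple of subspaces \<open>(U\<^sub>1, ..., U\<^sub>s)\<close> is an element of an extensional
  product over \<open>{1..s}\<close>.
\<close>

section \<open>Products of Grassmannians as varieties\<close>

type_synonym point = "nat \<Rightarrow> complex vec set"

text \<open>\<open>x l I\<close> is the coordinate with index set \<open>I\<close> in the \<open>l\<close>-th factor.\<close>

type_synonym coords = "nat \<Rightarrow> nat set \<Rightarrow> complex"

definition Gr :: "nat \<Rightarrow> nat \<Rightarrow> complex vec set set" where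
  "Gr N k = {U. VectorSpace.subspace class_ring U (module_vec TYPE(complex) N) \<and>
     vectorspace.dim class_ring ((module_vec TYPE(complex) N)\<lparr>carrier := U\<rparr>) = k}"

definition Gr_prod :: "nat \<Rightarrow> (nat \<Rightarrow> nat) \<Rightarrow> nat \<Rightarrow> point set" where
  "Gr_prod N d s = (\<Pi>\<^sub>E l\<in>{1..s}. Gr N (d l))"

text \<open>
  All systems of homogeneous coordinates of a point under the product of the Pluecker embeddings:
  the maximal minors of matrices whose columns form bases of the subspaces.  Different choices
  of bases rescale each factor by a nonzero scalar.
\<close>

definition pluecker :: "nat \<Rightarrow> (nat \<Rightarrow> nat) \<Rightarrow> nat \<Rightarrow> point \<Rightarrow> coords set" where
  "pluecker N d s U =
     {(\<lambda>l I. if l \<in> {1..s} \<and> I \<subseteq> {..<N} \<and> card I = d l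
             then det (submatrix (M l) I UNIV) else 0) | M.
       \<forall>l\<in>{1..s}. M l \<in> carrier_mat N (d l) \<and>
         vec_space.col_space N (M l) = U l}"

text \<open>
  \<open>multihom s e F\<close>: \<open>F\<close> is a polynomial (function) homogeneous of degree \<open>e l\<close> in the
  \<open>l\<close>-th group of variables, for \<open>l = 1, ..., s\<close>.
\<close>

inductive multihom :: "nat \<Rightarrow> (nat \<Rightarrow> nat) \<Rightarrow> (coords \<Rightarrow> complex) \<Rightarrow> bool" for s :: nat where
  const: "multihom s (\<lambda>_. 0) (\<lambda>_. c)"
| var: "l \<in> {1..s} \<Longrightarrow> multihom s (\<lambda>k. if k = l then 1 else 0) (\<lambda>x. x l I)"
| add: "multihom s e F \<Longrightarrow> multihom s e G \<Longrightarrow> multihom s e (\<lambda>x. F x + G x)"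
| mult: "multihom s e F \<Longrightarrow> multihom s e' G \<Longrightarrow>
    multihom s (\<lambda>k. e k + e' k) (\<lambda>x. F x * G x)"

text \<open>
  The non-vanishing loci are closed under finite intersection, so they form a base of the Zariski
  topology: the closed sets are the common zero loci of families of multihomogeneous polynomials.
\<close>

definition zariski :: "nat \<Rightarrow> (nat \<Rightarrow> nat) \<Rightarrow> nat \<Rightarrow> point topology" where
  "zariski N d s = topology_generated_by
     {{U \<in> Gr_prod N d s. \<forall>x\<in>pluecker N d s U. F x \<noteq> 0} | e F. multihom s e F}"

definition regular_on ::
  "nat \<Rightarrow> (nat \<Rightarrow> nat) \<Rightarrow> nat \<Rightarrow> point set \<Rightarrow> point set \<Rightarrow> (point \<Rightarrow> complex) \<Rightarrow> bool" where
  "regular_on N d s X \<Omega> g \<longleftrightarrow>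
     (\<forall>p\<in>\<Omega>. \<exists>\<Omega>'. openin (subtopology (zariski N d s) X) \<Omega>' \<and> p \<in> \<Omega>' \<and> \<Omega>' \<subseteq> \<Omega> \<and>
       (\<exists>e F G. multihom s e F \<and> multihom s e G \<and>
          (\<forall>q\<in>\<Omega>'. \<forall>x\<in>pluecker N d s q. G x \<noteq> 0 \<and> g q = F x / G x)))"

definition morphism ::
  "nat \<Rightarrow> (nat \<Rightarrow> nat) \<Rightarrow> nat \<Rightarrow> point set \<Rightarrow>
   nat \<Rightarrow> (nat \<Rightarrow> nat) \<Rightarrow> nat \<Rightarrow> point set \<Rightarrow> (point \<Rightarrow> point) \<Rightarrow> bool" where
  "morphism N d s X N' d' s' Y f \<longleftrightarrow>
     continuous_map (subtopology (zariski N d s) X) (subtopology (zariski N' d' s') Y) f \<and>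
     (\<forall>\<Omega> g. openin (subtopology (zariski N' d' s') Y) \<Omega> \<and> regular_on N' d' s' Y \<Omega> g
        \<longrightarrow> regular_on N d s X {p \<in> X. f p \<in> \<Omega>} (g \<circ> f))"

text \<open>
  Projective varieties are closed, not necessarily irreducible, subsets of products of
  Grassmannians, with the reduced structure.
\<close>

definition projective_variety :: "nat \<Rightarrow> (nat \<Rightarrow> nat) \<Rightarrow> nat \<Rightarrow> point set \<Rightarrow> bool" where
  "projective_variety N d s X \<longleftrightarrow> closedin (zariski N d s) X"

definition variety_iso ::
  "nat \<Rightarrow> (nat \<Rightarrow> nat) \<Rightarrow> nat \<Rightarrow> point set \<Rightarrow>
   nat \<Rightarrow> (nat \<Rightarrow> nat) \<Rightarrow> nat \<Rightarrow> point set \<Rightarrow> (point \<Rightarrow> point) \<Rightarrow> bool" where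
  "variety_iso N d s X N' d' s' Y f \<longleftrightarrow>
     projective_variety N d s X \<and> projective_variety N' d' s' Y \<and> bij_betw f X Y \<and>
     morphism N d s X N' d' s' Y f \<and> morphism N' d' s' Y N d s X (inv_into X f)"

section \<open>Orthogonals\<close>

text \<open>\<open>G\<close> is the Gram matrix of the form.\<close>

definition perp :: "complex mat \<Rightarrow> complex vec set \<Rightarrow> complex vec set" where
  "perp G U = {v \<in> carrier_vec (dim_row G). \<forall>u\<in>U. v \<bullet> (G *\<^sub>v u) = 0}"

definition perp_involution :: "complex mat \<Rightarrow> nat \<Rightarrow> point \<Rightarrow> point" where
  "perp_involution G s U = (\<lambda>l\<in>{1..s}. perp G (U (s + 1 - l)))"

section \<open>The partial degenerate symplectic flag variety\<close>

definition pr :: "nat \<Rightarrow> complex vec \<Rightarrow> complex vec" where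
  "pr k v = vec (dim_vec v) (\<lambda>i. if i + 1 = k then 0 else v $ i)"

definition pr_range :: "nat \<Rightarrow> nat \<Rightarrow> complex vec \<Rightarrow> complex vec" where
  "pr_range i j = fold pr [i..<j]"

definition Fl_deg :: "nat \<Rightarrow> (nat \<Rightarrow> nat) \<Rightarrow> nat \<Rightarrow> point set" where
  "Fl_deg n d s = {V \<in> Gr_prod (n + 1) d s.
     \<forall>l\<in>{1..<s}. pr_range (d l) (d (l + 1)) ` V l \<subseteq> V (l + 1)}"

text \<open>\<open>pos k l\<close> marks the pairs \<open>k < l\<close> with \<open>b\<^sub>V[f\<^sub>k, f\<^sub>l] = 1\<close>.\<close>

definition gram_V :: "nat \<Rightarrow> complex mat" where
  "gram_V m =
     (let pos = (\<lambda>k l. (1 \<le> k \<and> k \<le> m - 1 \<and> l = 2 * m - 1 - k) \<or> (k = 2 * m - 1 \<and> l = 2 * m))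
      in mat (2 * m) (2 * m) (\<lambda>(i, j).
           if pos (i + 1) (j + 1) then 1 else if pos (j + 1) (i + 1) then - 1 else 0))"

definition SpFl_deg :: "nat \<Rightarrow> (nat \<Rightarrow> nat) \<Rightarrow> nat \<Rightarrow> point set" where
  "SpFl_deg m d s = {V \<in> Fl_deg (2 * m - 1) d s. perp_involution (gram_V m) s V = V}"

section \<open>Groups\<close>

definition anti_diag :: "nat \<Rightarrow> complex mat" where
  "anti_diag n = mat n n (\<lambda>(i, j). if i + j + 1 = n then 1 else 0)"

definition gram_W :: "nat \<Rightarrow> complex mat" where
  "gram_W n = four_block_mat (0\<^sub>m n n) (anti_diag n) (- anti_diag n) (0\<^sub>m n n)"

definition SL :: "nat \<Rightarrow> complex mat set" where
  "SL N = {A \<in> carrier_mat N N. det A = 1}"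

definition SL_involution :: "nat \<Rightarrow> complex mat \<Rightarrow> complex mat" where
  "SL_involution n A =
     gram_W n * the (mat_inverse (transpose_mat A)) * the (mat_inverse (gram_W n))"

definition Sp :: "nat \<Rightarrow> complex mat set" where
  "Sp n = {A \<in> SL (2 * n). SL_involution n A = A}"

definition borel_SL :: "nat \<Rightarrow> complex mat set" where
  "borel_SL n = {A \<in> SL (2 * n). upper_triangular A}"

definition torus_SL :: "nat \<Rightarrow> complex mat set" where
  "torus_SL n = {A \<in> SL (2 * n). diagonal_mat A}"

definition torus_Sp :: "nat \<Rightarrow> complex mat set" where
  "torus_Sp n = torus_SL n \<inter> Sp n"

section \<open>Flag varieties and the Schubert variety\<close>

definition act_W :: "nat \<Rightarrow> complex mat \<Rightarrow> point \<Rightarrow> point" where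
  "act_W s A U = (\<lambda>l\<in>{1..s}. (\<lambda>v. A *\<^sub>v v) ` U l)"

text \<open>
  \<open>SL\<^sub>2\<^sub>n / P\<^sub>\<lambda>\<close> for \<open>\<lambda> = \<omega>\<^bsub>2d\<^sub>1-1\<^esub> + ... + \<omega>\<^bsub>2d\<^sub>s-1\<^esub>\<close>, as a variety of flags, and the fixed-point
  set \<open>Sp\<^sub>2\<^sub>n / Q\<close> in it.
\<close>

definition flags_SL :: "nat \<Rightarrow> (nat \<Rightarrow> nat) \<Rightarrow> nat \<Rightarrow> point set" where
  "flags_SL n d s = {U \<in> Gr_prod (2 * n) (\<lambda>l. 2 * d l - 1) s. \<forall>l\<in>{1..<s}. U l \<subseteq> U (l + 1)}"

definition flags_Sp :: "nat \<Rightarrow> (nat \<Rightarrow> nat) \<Rightarrow> nat \<Rightarrow> point set" where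
  "flags_Sp n d s = {U \<in> flags_SL n d s. perp_involution (gram_W n) s U = U}"

text \<open>The argument \<open>d\<close> is expected to satisfy \<open>d 0 = 0\<close> and \<open>d (s + 1) = n + 1\<close>.\<close>

definition sigma :: "nat \<Rightarrow> (nat \<Rightarrow> nat) \<Rightarrow> nat \<Rightarrow> nat \<Rightarrow> nat" where
  "sigma n d s k =
     (if k \<in> {1..2 * n}
      then THE j. \<exists>i\<le>s.
        (k \<in> {2 * d i..d i + d (i + 1) - 1} \<and> j = k - d i) \<or>
        (k \<in> {d i + d (i + 1)..2 * d (i + 1) - 1} \<and> j = n + 1 + k - d (i + 1))
      else k)"

definition coord_flag :: "nat \<Rightarrow> (nat \<Rightarrow> nat) \<Rightarrow> nat \<Rightarrow> (nat \<Rightarrow> nat) \<Rightarrow> point" where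
  "coord_flag n d s w = (\<lambda>l\<in>{1..s}.
     LinearCombinations.module.span class_ring (module_vec TYPE(complex) (2 * n))
       ((\<lambda>k. unit_vec (2 * n) (w k - 1)) ` {1..2 * d l - 1}))"

definition schubert :: "nat \<Rightarrow> (nat \<Rightarrow> nat) \<Rightarrow> nat \<Rightarrow> (nat \<Rightarrow> nat) \<Rightarrow> point set" where
  "schubert n d s w =
     subtopology (zariski (2 * n) (\<lambda>l. 2 * d l - 1) s) (flags_SL n d s)
       closure_of ((\<lambda>A. act_W s A (coord_flag n d s w)) ` borel_SL n)"

definition schubert_Sp :: "nat \<Rightarrow> (nat \<Rightarrow> nat) \<Rightarrow> nat \<Rightarrow> (nat \<Rightarrow> nat) \<Rightarrow> point set" where
  "schubert_Sp n d s w = schubert n d s w \<inter> flags_Sp n d s"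

section \<open>The torus action on the degenerate flag variety\<close>

definition torus_V :: "nat \<Rightarrow> nat \<Rightarrow> complex mat \<Rightarrow> complex mat" where
  "torus_V n k A = mat (n + 1) (n + 1) (\<lambda>(i, j).
     if i \<noteq> j then 0 else if k \<le> i + 1 then A $$ (i, i) else A $$ (n + 1 + i, n + 1 + i))"

definition act_V :: "nat \<Rightarrow> (nat \<Rightarrow> nat) \<Rightarrow> nat \<Rightarrow> complex mat \<Rightarrow> point \<Rightarrow> point" where
  "act_V n d s A U = (\<lambda>l\<in>{1..s}. (\<lambda>v. torus_V n (d l) A *\<^sub>v v) ` U l)"

end

theory Submission
  imports Defs
begin

text \<open>Let \<open>E\<^sub>j\<close> be the span of the first \<open>j\<close> basis vectors of \<open>W = \<complex>\<^sup>2\<^sup>n\<close>.  The subquotient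
  \<open>E\<^bsub>n+d\<^esub> / E\<^bsub>d-1\<^esub>\<close> has dimension \<open>n + 1\<close>, and the torus weights on it are those of \<open>V\<close> in the
  factor of \<open>d\<close>-dimensional subspaces: \<open>f\<^sub>k\<close> corresponds to \<open>e\<^sub>k\<close> for \<open>k \<ge> d\<close> and to \<open>e\<^bsub>n+1+k\<^esub>\<close> for \<open>k < d\<close>.  The
  isomorphism \<open>zeta\<close> replaces each \<open>V\<^sub>l\<close> by its preimage \<open>W\<^sub>l\<close> in \<open>E\<^bsub>n+d\<^sub>l\<^esub>\<close>; so \<open>W\<^sub>l\<close> lies between
  \<open>E\<^bsub>d\<^sub>l-1\<^esub>\<close> and \<open>E\<^bsub>n+d\<^sub>l\<^esub>\<close>.  On passing from \<open>l\<close> to \<open>l + 1\<close> the vectors \<open>e\<^sub>k\<close> with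
  \<open>d\<^sub>l \<le> k < d\<^bsub>l+1\<^esub>\<close> become zero in the quotient, which is what \<open>pr\<close> does; hence \<open>W\<^sub>l \<subseteq> W\<^bsub>l+1\<^esub>\<close>
  is the defining condition of the degenerate flag variety (lemma \<open>emb_subset_iff\<close>).  Since
  \<open>d\<^sub>l + d\<^bsub>s+1-l\<^esub> = n + 1\<close>, the spaces \<open>E\<^bsub>n+d\<^sub>l\<^esub>\<close> and \<open>E\<^bsub>d-1\<^esub>\<close> with \<open>d = d\<^bsub>s+1-l\<^esub>\<close> are orthogonal
  to each other, and the form of \<open>W\<close> induces a pairing of the two subquotients.  In the basis above
  it differs from the form of \<open>V\<close> by signs; inserting the signs \<open>eps\<close> into the identification removes
  the discrepancy (lemma \<open>form_compat\<close>), and the two involutions then correspond to each other.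
  Together this makes \<open>zeta\<close> a bijection onto the symplectic flags with \<open>W\<^sub>l \<subseteq> E\<^bsub>n+d\<^sub>l\<^esub>\<close>
  (lemma \<open>bij_betw_zeta\<close>); that \<open>W\<^sub>l\<close> contains \<open>E\<^bsub>d\<^sub>l-1\<^esub>\<close> follows by taking orthogonals.

  A basis of \<open>W\<^sub>l\<close> consists of that of \<open>E\<^bsub>d\<^sub>l-1\<^esub>\<close> and lifts of a basis of \<open>V\<^sub>l\<close>, so each maximal minor
  for \<open>W\<^sub>l\<close> is a constant multiple of one for \<open>V\<^sub>l\<close>, and every minor for \<open>V\<^sub>l\<close> occurs.  Both
  \<open>zeta\<close> and its inverse are therefore induced by reindexing and rescaling Pluecker coordinates,
  and such maps pull back multihomogeneous polynomials to multihomogeneous polynomials of the same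
  degree (lemma \<open>morphism_coord_subst\<close>).  They commute with the torus because the signs are
  a diagonal matrix.

  It remains to see that the Schubert variety is cut out by the conditions \<open>W\<^sub>l \<subseteq> E\<^bsub>n+d\<^sub>l\<^esub>\<close> among the
  symplectic flags (lemma \<open>schubert_Sp_eq\<close>).  These conditions are closed and hold on the orbit.
  Conversely, consider all flags with \<open>E\<^bsub>d\<^sub>l-1\<^esub> \<subseteq> W\<^sub>l \<subseteq> E\<^bsub>n+d\<^sub>l\<^esub>\<close>.  If every \<open>W\<^sub>l\<close> maps onto
  \<open>E\<^bsub>n+d\<^sub>l\<^esub> / E\<^sub>n\<close>, then lifts of the basis vectors are the columns of a unitriangular matrix that
  carries the coordinate flag to \<open>W\<close> (lemma \<open>generic_in_orbit\<close>).  If not, some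
  \<open>W\<^sub>q\<close> contains a superfluous vector \<open>x\<close> of \<open>E\<^sub>n\<close> and misses a vector \<open>y\<close>; replacing \<open>x\<close> by
  \<open>x + t y\<close> in all \<open>W\<^sub>l\<close> with \<open>l \<le> q\<close> is a curve through \<open>W\<close> whose other points have smaller
  intersections with \<open>E\<^sub>n\<close>.  Zariski closed sets contain the limits of such curves because polynomials
  are continuous (lemma \<open>limit_in_closed\<close>), so induction on these dimensions puts \<open>W\<close> into the
  closure of the orbit (lemma \<open>bounded_flags_subset_closed\<close>).

  Subspaces are handled through injective matrices (\<open>frame\<close>), which are at the same time the bases
  that enter the definition of the Pluecker coordinates.\<close>

section \<open>Subspaces of coordinate space\<close>

definition lin_sub :: "nat \<Rightarrow> 'a::field vec set \<Rightarrow> bool" where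
  "lin_sub N U \<longleftrightarrow> U \<subseteq> carrier_vec N \<and> 0\<^sub>v N \<in> U \<and> (\<forall>u\<in>U. \<forall>v\<in>U. u + v \<in> U) \<and> (\<forall>a. \<forall>u\<in>U. a \<cdot>\<^sub>v u \<in> U)"

definition colsp :: "'a::field mat \<Rightarrow> 'a vec set" where
  "colsp M = (\<lambda>v. M *\<^sub>v v) ` carrier_vec (dim_col M)"

text \<open>A left inverse is required instead of a trivial kernel: it turns identities between spans into
  identities between matrices by multiplication from the left.\<close>

definition frame :: "nat \<Rightarrow> nat \<Rightarrow> 'a::field mat \<Rightarrow> bool" where
  "frame N k M \<longleftrightarrow> M \<in> carrier_mat N k \<and> (\<exists>L\<in>carrier_mat k N. L * M = 1\<^sub>m k)"

lemma lin_subI: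
  assumes "U \<subseteq> carrier_vec N" "0\<^sub>v N \<in> U" "\<And>u v. u \<in> U \<Longrightarrow> v \<in> U \<Longrightarrow> u + v \<in> U"
    "\<And>a u. u \<in> U \<Longrightarrow> a \<cdot>\<^sub>v u \<in> U"
  shows "lin_sub N U"
  using assms unfolding lin_sub_def by blast

lemma lin_subD:
  assumes "lin_sub N U"
  shows "U \<subseteq> carrier_vec N" "0\<^sub>v N \<in> U" "\<And>u v. u \<in> U \<Longrightarrow> v \<in> U \<Longrightarrow> u + v \<in> U"
    "\<And>a u. u \<in> U \<Longrightarrow> a \<cdot>\<^sub>v u \<in> U" "\<And>u. u \<in> U \<Longrightarrow> u \<in> carrier_vec N"
  using assms unfolding lin_sub_def by auto

lemma lin_sub_diff:
  assumes "lin_sub N U" "u \<in> U" "v \<in> U"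
  shows "u - v \<in> U"
proof -
  have "u - v = u + (-1) \<cdot>\<^sub>v v"
    using lin_subD(5)[OF assms(1)] assms(2,3) by (intro eq_vecI) auto
  thus ?thesis using lin_subD[OF assms(1)] assms(2,3) by metis
qed

lemma lin_sub_Int: "lin_sub N U \<Longrightarrow> lin_sub N U' \<Longrightarrow> lin_sub N (U \<inter> U')"
  unfolding lin_sub_def by auto

lemma mult_mat_vec_zero: "A \<in> carrier_mat n k \<Longrightarrow> A *\<^sub>v 0\<^sub>v k = 0\<^sub>v n"
  by (intro eq_vecI) auto

lemma lin_sub_image:
  assumes "P \<in> carrier_mat N' N" "lin_sub N U"
  shows "lin_sub N' ((\<lambda>v. P *\<^sub>v v) ` U)"
proof (rule lin_subI)
  note U = lin_subD[OF assms(2)]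
  show "(\<lambda>v. P *\<^sub>v v) ` U \<subseteq> carrier_vec N'" using assms(1) U(1) by auto
  show "0\<^sub>v N' \<in> (\<lambda>v. P *\<^sub>v v) ` U" using mult_mat_vec_zero[OF assms(1)] U(2) by (metis imageI)
  fix u a assume "u \<in> (\<lambda>v. P *\<^sub>v v) ` U"
  then obtain x where x: "x \<in> U" "u = P *\<^sub>v x" by auto
  show "a \<cdot>\<^sub>v u \<in> (\<lambda>v. P *\<^sub>v v) ` U"
    using mult_mat_vec[OF assms(1), of x a] U(4)[OF x(1)] U(5)[OF x(1)] x(2) by (metis imageI)
  fix v assume "v \<in> (\<lambda>v. P *\<^sub>v v) ` U"
  then obtain y where y: "y \<in> U" "v = P *\<^sub>v y" by auto
  show "u + v \<in> (\<lambda>v. P *\<^sub>v v) ` U"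
    using mult_add_distrib_mat_vec[OF assms(1), of x y] U(3)[of x y] U(5) x y by (metis imageI)
qed

lemma lin_sub_carrier: "lin_sub N (carrier_vec N)"
  by (rule lin_subI) auto

lemma lin_sub_colsp: "M \<in> carrier_mat N k \<Longrightarrow> lin_sub N (colsp M)"
  unfolding colsp_def using lin_sub_image[of M N k "carrier_vec k"] lin_sub_carrier by auto

lemma mult_unit_vec: "(M :: 'a::field mat) \<in> carrier_mat N k \<Longrightarrow> j < k \<Longrightarrow> M *\<^sub>v unit_vec k j = col M j"
  by (intro eq_vecI) (auto simp: scalar_prod_right_unit[of _ k])

lemma col_in_colsp:
  assumes "M \<in> carrier_mat N k" "j < k"
  shows "col M j \<in> colsp M"
proof -
  have "col M j = M *\<^sub>v unit_vec k j" using mult_unit_vec[OF assms] by simp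
  thus ?thesis using assms unfolding colsp_def by (auto intro!: image_eqI[of _ _ "unit_vec k j"])
qed

lemma mult_mat_vec_single:
  fixes A :: "'a::comm_semiring_1 mat"
  assumes A: "A \<in> carrier_mat nr nc" and w: "w \<in> carrier_vec nc" and j: "j < nr" and i0: "i0 < nc"
    and row: "\<And>i. i < nc \<Longrightarrow> A $$ (j,i) = (if i = i0 then c else 0)"
  shows "(A *\<^sub>v w) $ j = c * w $ i0"
proof -
  have "(A *\<^sub>v w) $ j = (\<Sum>i\<in>{0..<nc}. A $$ (j,i) * w $ i)"
    using A w j by (simp add: scalar_prod_def)
  also have "\<dots> = (\<Sum>i\<in>{0..<nc}. if i = i0 then c * w $ i else 0)"
    by (intro sum.cong refl) (simp add: row)
  also have "\<dots> = c * w $ i0" using i0 by (subst sum.delta) auto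
  finally show ?thesis .
qed

lemma colsp_factor:
  assumes M: "M \<in> carrier_mat N k" and M': "M' \<in> carrier_mat N k'"
    and sub: "\<And>j. j < k' \<Longrightarrow> col M' j \<in> colsp M"
  obtains g where "g \<in> carrier_mat k k'" "M' = M * g"
proof -
  have "\<forall>j. \<exists>v. j < k' \<longrightarrow> v \<in> carrier_vec k \<and> col M' j = M *\<^sub>v v"
    using sub M unfolding colsp_def by auto
  then obtain f where f: "\<And>j. j < k' \<Longrightarrow> f j \<in> carrier_vec k \<and> col M' j = M *\<^sub>v f j"
    by metis
  define g where "g = mat k k' (\<lambda>(i,j). f j $ i)"
  have cg: "col g j = f j" if "j < k'" for j
    using f[OF that] that unfolding g_def by (intro eq_vecI) auto
  have "M' = M * g"
  proof (rule eq_matI)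
    show "dim_row M' = dim_row (M * g)" "dim_col M' = dim_col (M * g)"
      using M M' unfolding g_def by auto
    fix i j assume ij: "i < dim_row (M * g)" "j < dim_col (M * g)"
    hence j: "j < k'" and i: "i < N" using M unfolding g_def by auto
    have "M' $$ (i,j) = col M' j $ i" using M' i j by auto
    also have "\<dots> = (M *\<^sub>v col g j) $ i" using f[OF j] cg[OF j] by simp
    also have "\<dots> = (M * g) $$ (i,j)" using ij by auto
    finally show "M' $$ (i,j) = (M * g) $$ (i,j)" .
  qed
  moreover have "g \<in> carrier_mat k k'" unfolding g_def by simp
  ultimately show ?thesis using that by blast
qed

lemma frame_carrier: "frame N k M \<Longrightarrow> M \<in> carrier_mat N k"
  unfolding frame_def by auto

lemma frame_inj:
  assumes "frame N k M" "x \<in> carrier_vec k" "y \<in> carrier_vec k" "M *\<^sub>v x = M *\<^sub>v y"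
  shows "x = y"
proof -
  obtain L where L: "L \<in> carrier_mat k N" "L * M = 1\<^sub>m k" and M: "M \<in> carrier_mat N k"
    using assms(1) unfolding frame_def by auto
  have "x = (L * M) *\<^sub>v x" using L assms(2) by simp
  also have "\<dots> = L *\<^sub>v (M *\<^sub>v y)" using assoc_mult_mat_vec[OF L(1) M assms(2)] assms(4) by simp
  also have "\<dots> = y" using assoc_mult_mat_vec[OF L(1) M assms(3)] L(2) assms(3) by simp
  finally show ?thesis .
qed

text \<open>Padding both factors with zeros gives square matrices that are inverse to each other; if
  \<open>k' < k\<close>, the product in the other order has a zero on its diagonal.\<close>

lemma mult_eq_one_dim_le:
  fixes A :: "'a::field mat"
  assumes A: "A \<in> carrier_mat k k'" and B: "B \<in> carrier_mat k' k" and AB: "A * B = 1\<^sub>m k"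
  shows "k \<le> k'"
proof (rule ccontr)
  assume "\<not> k \<le> k'"
  hence lt: "k' < k" by simp
  define A' where "A' = mat k k (\<lambda>(i,j). if j < k' then A $$ (i,j) else 0)"
  define B' where "B' = mat k k (\<lambda>(i,j). if i < k' then B $$ (i,j) else 0)"
  have "A' * B' = A * B"
  proof (rule eq_matI)
    fix i j assume "i < dim_row (A * B)" "j < dim_col (A * B)"
    hence i: "i < k" and j: "j < k" using A B by auto
    have "(A' * B') $$ (i,j) = (\<Sum>l = 0..<k. (if l < k' then A $$ (i,l) * B $$ (l,j) else 0))"
      using i j unfolding A'_def B'_def by (auto simp: scalar_prod_def intro!: sum.cong)
    also have "\<dots> = (\<Sum>l = 0..<k'. A $$ (i,l) * B $$ (l,j))"
      using lt by (intro sum.mono_neutral_cong_right) auto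
    also have "\<dots> = (A * B) $$ (i,j)" using i j A B by (auto simp: scalar_prod_def)
    finally show "(A' * B') $$ (i,j) = (A * B) $$ (i,j)" .
  qed (use A B in \<open>auto simp: A'_def B'_def\<close>)
  hence "B' * A' = 1\<^sub>m k"
    using mat_mult_left_right_inverse[of A' k B'] AB unfolding A'_def B'_def by auto
  moreover have "(B' * A') $$ (k',k') = 0"
    using lt unfolding A'_def B'_def by (auto simp: scalar_prod_def intro!: sum.neutral)
  ultimately show False using lt by simp
qed

lemma frame_dim_le:
  assumes M: "frame N k M" and M': "M' \<in> carrier_mat N k'" and sub: "colsp M \<subseteq> colsp M'"
  shows "k \<le> k'"
proof -
  obtain L where L: "L \<in> carrier_mat k N" "L * M = 1\<^sub>m k"
    using M unfolding frame_def by auto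
  note Mc = frame_carrier[OF M]
  obtain g where g: "g \<in> carrier_mat k' k" "M = M' * g"
    using colsp_factor[OF M' Mc] col_in_colsp[OF Mc] sub by blast
  have "(L * M') * g = 1\<^sub>m k" using assoc_mult_mat[OF L(1) M' g(1)] L(2) g(2) by simp
  thus ?thesis using mult_eq_one_dim_le[of "L * M'" k k' g] L(1) M' g(1) by auto
qed

lemma frame_one: "frame N N (1\<^sub>m N)"
  unfolding frame_def by (auto intro!: bexI[of _ "1\<^sub>m N"])

lemma colsp_one: "colsp (1\<^sub>m N) = carrier_vec N"
  unfolding colsp_def by (auto simp: image_iff)

lemma frame_le:
  assumes "frame N k M" shows "k \<le> N"
  using frame_dim_le[OF assms, of "1\<^sub>m N" N] lin_subD(1)[OF lin_sub_colsp[OF frame_carrier[OF assms]]]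
  by (auto simp: colsp_one)

text \<open>The projection \<open>1 - M L\<close>, with \<open>L\<close> a left inverse, kills the column space but not \<open>v\<close>; a
  multiple of one of its rows is the functional.\<close>

lemma frame_separate:
  assumes M: "frame N k M" and v: "v \<in> carrier_vec N" "v \<notin> colsp M"
  obtains c where "c \<in> carrier_vec N" "c \<bullet> v = 1" "\<And>u. u \<in> colsp M \<Longrightarrow> c \<bullet> u = 0"
proof -
  obtain L where L: "L \<in> carrier_mat k N" "L * M = 1\<^sub>m k"
    using M unfolding frame_def by auto
  note Mc = frame_carrier[OF M]
  define Q where "Q = 1\<^sub>m N - M * L"
  have Q: "Q \<in> carrier_mat N N" unfolding Q_def using Mc L by auto
  have Qv: "Q *\<^sub>v u = u - M *\<^sub>v (L *\<^sub>v u)" if "u \<in> carrier_vec N" for u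
    unfolding Q_def using that Mc L by (simp add: minus_mult_distrib_mat_vec[of _ N N])
  have QM: "Q *\<^sub>v (M *\<^sub>v x) = 0\<^sub>v N" if "x \<in> carrier_vec k" for x
  proof -
    have "L *\<^sub>v (M *\<^sub>v x) = x" using assoc_mult_mat_vec[OF L(1) Mc that] L that by simp
    thus ?thesis using Qv[of "M *\<^sub>v x"] Mc that by simp
  qed
  have "Q *\<^sub>v v \<noteq> 0\<^sub>v N"
  proof
    assume "Q *\<^sub>v v = 0\<^sub>v N"
    hence *: "v - M *\<^sub>v (L *\<^sub>v v) = 0\<^sub>v N" using Qv v by simp
    have "v = M *\<^sub>v (L *\<^sub>v v)"
    proof (rule eq_vecI)
      fix i assume i: "i < dim_vec (M *\<^sub>v (L *\<^sub>v v))"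
      have "(v - M *\<^sub>v (L *\<^sub>v v)) $ i = 0" using * i Mc by simp
      thus "v $ i = (M *\<^sub>v (L *\<^sub>v v)) $ i" using i by simp
    qed (use v Mc in auto)
    thus False using v L Mc unfolding colsp_def by auto
  qed
  then obtain i where i: "i < N" "(Q *\<^sub>v v) $ i \<noteq> 0" using Q v by (auto simp: vec_eq_iff)
  define c where "c = (1 / (Q *\<^sub>v v) $ i) \<cdot>\<^sub>v row Q i"
  have "c \<bullet> v = 1" using i Q v unfolding c_def by auto
  moreover have "c \<bullet> u = 0" if u: "u \<in> colsp M" for u
  proof -
    obtain x where x: "x \<in> carrier_vec k" "u = M *\<^sub>v x" using u Mc unfolding colsp_def by auto
    have "row Q i \<bullet> u = (Q *\<^sub>v u) $ i" using i Q by auto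
    also have "\<dots> = 0" using QM[OF x(1)] x(2) i by simp
    finally show ?thesis unfolding c_def using Q i x Mc by simp
  qed
  moreover have "c \<in> carrier_vec N" unfolding c_def using Q i by auto
  ultimately show ?thesis using that by blast
qed

definition hcat :: "'a mat \<Rightarrow> 'a mat \<Rightarrow> 'a mat" where
  "hcat M D = mat (dim_row M) (dim_col M + dim_col D)
     (\<lambda>(i,j). if j < dim_col M then M $$ (i,j) else D $$ (i, j - dim_col M))"

lemma hcat_carrier: "M \<in> carrier_mat N k \<Longrightarrow> D \<in> carrier_mat N k' \<Longrightarrow> hcat M D \<in> carrier_mat N (k + k')"
  unfolding hcat_def by auto

lemma hcat_mult_vec:
  assumes "M \<in> carrier_mat N k" "D \<in> carrier_mat N k'" "x \<in> carrier_vec k" "y \<in> carrier_vec k'"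
  shows "hcat M D *\<^sub>v (x @\<^sub>v y) = M *\<^sub>v x + D *\<^sub>v (y::'a::field vec)"
proof (rule eq_vecI)
  fix i assume "i < dim_vec (M *\<^sub>v x + D *\<^sub>v y)"
  hence i: "i < N" using assms by simp
  have "row (hcat M D) i = row M i @\<^sub>v row D i"
    using assms i unfolding hcat_def by (intro eq_vecI) (auto simp: append_vec_def)
  hence "(hcat M D *\<^sub>v (x @\<^sub>v y)) $ i = (row M i @\<^sub>v row D i) \<bullet> (x @\<^sub>v y)"
    using i assms unfolding hcat_def by simp
  also have "\<dots> = row M i \<bullet> x + row D i \<bullet> y"
    using assms i by (intro scalar_prod_append) auto
  finally show "(hcat M D *\<^sub>v (x @\<^sub>v y)) $ i = (M *\<^sub>v x + D *\<^sub>v y) $ i" using assms i by simp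
qed (use assms in \<open>auto simp: hcat_def\<close>)

lemma hcat_assoc:
  assumes "A \<in> carrier_mat N k" "B \<in> carrier_mat N k'" "C \<in> carrier_mat N k''"
  shows "hcat (hcat A B) C = hcat A (hcat B C)"
  using assms unfolding hcat_def by (intro eq_matI) (auto simp: algebra_simps)

lemma colsp_hcat:
  assumes "M \<in> carrier_mat N k" "D \<in> carrier_mat N k'"
  shows "colsp (hcat M D) = {u + v | u v. u \<in> colsp M \<and> v \<in> colsp D}"
proof (intro equalityI subsetI)
  fix w assume "w \<in> colsp (hcat M D)"
  then obtain z where z: "z \<in> carrier_vec (k + k')" "w = hcat M D *\<^sub>v z"
    using assms unfolding colsp_def hcat_def by auto
  have "z = vec_first z k @\<^sub>v vec_last z k'" using z by simp
  hence "w = M *\<^sub>v vec_first z k + D *\<^sub>v vec_last z k'"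
    using hcat_mult_vec[OF assms, of "vec_first z k" "vec_last z k'"] z(2)
      vec_first_carrier vec_last_carrier by metis
  moreover have "M *\<^sub>v vec_first z k \<in> colsp M" "D *\<^sub>v vec_last z k' \<in> colsp D"
    using assms vec_first_carrier vec_last_carrier unfolding colsp_def by auto
  ultimately show "w \<in> {u + v | u v. u \<in> colsp M \<and> v \<in> colsp D}" by blast
next
  fix w assume "w \<in> {u + v | u v. u \<in> colsp M \<and> v \<in> colsp D}"
  then obtain x y where xy: "x \<in> carrier_vec k" "y \<in> carrier_vec k'" "w = M *\<^sub>v x + D *\<^sub>v y"
    using assms unfolding colsp_def by auto
  hence "w = hcat M D *\<^sub>v (x @\<^sub>v y)" using hcat_mult_vec[OF assms] by simp
  thus "w \<in> colsp (hcat M D)" using xy assms unfolding colsp_def hcat_def by auto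
qed

text \<open>The functional that separates \<open>v\<close> from the column space is the new row of the left inverse; the
  old rows are corrected by multiples of it.\<close>

lemma frame_snoc:
  assumes M: "frame N k M" and v: "v \<in> carrier_vec N" "v \<notin> colsp M"
  shows "frame N (k + 1) (hcat M (mat_of_cols N [v]))"
proof -
  obtain c where c: "c \<in> carrier_vec N" "c \<bullet> v = 1" "\<And>u. u \<in> colsp M \<Longrightarrow> c \<bullet> u = 0"
    using frame_separate[OF M v] by blast
  obtain L where L: "L \<in> carrier_mat k N" "L * M = 1\<^sub>m k"
    using M unfolding frame_def by auto
  note Mc = frame_carrier[OF M]
  define R where "R = mat (k + 1) N (\<lambda>(i,j). if i < k then L $$ (i,j) - (L *\<^sub>v v) $ i * c $ j else c $ j)"
  have rowR: "row R i = (if i < k then row L i - (L *\<^sub>v v) $ i \<cdot>\<^sub>v c else c)" if "i < k + 1" for i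
    using that L c unfolding R_def by (intro eq_vecI) auto
  have colH: "col (hcat M (mat_of_cols N [v])) j = (if j < k then col M j else v)" if "j < k + 1" for j
    using that Mc v unfolding hcat_def by (intro eq_vecI) (auto simp: mat_of_cols_def)
  have "R * hcat M (mat_of_cols N [v]) = 1\<^sub>m (k + 1)"
  proof (rule eq_matI)
    fix i j assume "i < dim_row (1\<^sub>m (k+1))" "j < dim_col (1\<^sub>m (k+1))"
    hence i: "i < k + 1" and j: "j < k + 1" by auto
    have e: "(R * hcat M (mat_of_cols N [v])) $$ (i,j) = row R i \<bullet> col (hcat M (mat_of_cols N [v])) j"
      using i j Mc unfolding R_def hcat_def by auto
    have cM: "c \<bullet> col M j = 0" if "j < k" using c(3) col_in_colsp[OF Mc that] by blast
    have LM: "row L i \<bullet> col M j = (if i = j then 1 else 0)" if "i < k" "j < k"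
    proof -
      have "(L * M) $$ (i,j) = row L i \<bullet> col M j" using that L(1) Mc by simp
      thus ?thesis using L(2) that by simp
    qed
    have Lv: "(L *\<^sub>v v) $ i = row L i \<bullet> v" if "i < k" using that L by auto
    have d: "(row L i - (L *\<^sub>v v) $ i \<cdot>\<^sub>v c) \<bullet> w = row L i \<bullet> w - (L *\<^sub>v v) $ i * (c \<bullet> w)"
      if "i < k" "w \<in> carrier_vec N" for w
      using minus_scalar_prod_distrib[of "row L i" N "(L *\<^sub>v v) $ i \<cdot>\<^sub>v c" w] that L c by auto
    show "(R * hcat M (mat_of_cols N [v])) $$ (i,j) = 1\<^sub>m (k+1) $$ (i,j)"
      unfolding e rowR[OF i] colH[OF j] using i j cM LM Lv d[of "col M j"] d[of v] c v Mc
      by (auto)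
  qed (use Mc in \<open>auto simp: R_def hcat_def\<close>)
  moreover have "R \<in> carrier_mat (k+1) N" unfolding R_def by simp
  ultimately show ?thesis unfolding frame_def using hcat_carrier[OF Mc, of "mat_of_cols N [v]" 1]
    by (auto simp: mat_of_cols_def)
qed

text \<open>A basis of a subspace extends by vectors of any spanning set: take \<open>D\<close> with as many columns as
  possible, then \<open>frame_snoc\<close> leaves no vector of \<open>S\<close> outside.\<close>

lemma frame_extend:
  assumes M: "frame N k M" and S: "S \<subseteq> carrier_vec N"
  obtains D r where "D \<in> carrier_mat N r" "frame N (k + r) (hcat M D)"
    "\<And>j. j < r \<Longrightarrow> col D j \<in> S" "S \<subseteq> colsp (hcat M D)"
proof -
  define Q where "Q = (\<lambda>r. \<exists>D\<in>carrier_mat N r. frame N (k + r) (hcat M D) \<and> (\<forall>j<r. col D j \<in> S))"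
  note Mc = frame_carrier[OF M]
  have "hcat M (0\<^sub>m N 0) = M" using Mc unfolding hcat_def by (intro eq_matI) auto
  hence "Q 0" unfolding Q_def using M by (auto intro!: bexI[of _ "0\<^sub>m N 0"])
  moreover have "\<forall>r. Q r \<longrightarrow> r \<le> N" unfolding Q_def using frame_le by fastforce
  ultimately obtain r where r: "Q r" "\<And>r'. Q r' \<Longrightarrow> r' \<le> r"
    using Nat.ex_has_greatest_nat[of Q 0 N] by auto
  then obtain D where D: "D \<in> carrier_mat N r" "frame N (k + r) (hcat M D)" "\<And>j. j < r \<Longrightarrow> col D j \<in> S"
    unfolding Q_def by auto
  have "S \<subseteq> colsp (hcat M D)"
  proof
    fix v assume v: "v \<in> S"
    show "v \<in> colsp (hcat M D)"
    proof (rule ccontr)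
      assume nv: "v \<notin> colsp (hcat M D)"
      define D' where "D' = hcat D (mat_of_cols N [v])"
      have v1: "mat_of_cols N [v] \<in> carrier_mat N 1" by (simp add: mat_of_cols_def)
      have D': "D' \<in> carrier_mat N (r + 1)" unfolding D'_def using hcat_carrier[OF D(1) v1] .
      have "frame N (k + r + 1) (hcat M D')"
        using frame_snoc[OF D(2) _ nv] v S unfolding D'_def hcat_assoc[OF Mc D(1) v1] by auto
      moreover have "col D' j \<in> S" if "j < r + 1" for j
      proof -
        have "col D' j = (if j < r then col D j else v)"
          using that D(1) v S unfolding D'_def hcat_def by (intro eq_vecI) (auto simp: mat_of_cols_def)
        thus ?thesis using D(3) v by auto
      qed
      ultimately have "Q (r + 1)" unfolding Q_def using D' by (auto simp: add.assoc)
      thus False using r(2)[of "r + 1"] by simp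
    qed
  qed
  thus ?thesis using that D by blast
qed

lemma colsp_subsetI:
  assumes "M \<in> carrier_mat N k" "lin_sub N U" "\<And>j. j < k \<Longrightarrow> col M j \<in> U"
  shows "colsp M \<subseteq> U"
proof
  fix w assume "w \<in> colsp M"
  then obtain x where x: "x \<in> carrier_vec k" "w = M *\<^sub>v x" using assms(1) unfolding colsp_def by auto
  note U = lin_subD[OF assms(2)]
  \<comment> \<open>The partial sums of the linear combination of the columns.\<close>
  define p where "p = (\<lambda>r. vec N (\<lambda>i. \<Sum>j<r. x $ j * M $$ (i,j)))"
  have "p r \<in> U" if "r \<le> k" for r using that
  proof (induction r)
    case 0
    have "p 0 = 0\<^sub>v N" unfolding p_def by auto
    thus ?case using U by simp
  next
    case (Suc r)
    have "p (Suc r) = p r + x $ r \<cdot>\<^sub>v col M r"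
      using Suc.prems assms(1) unfolding p_def by (intro eq_vecI) auto
    thus ?case using U(3,4) Suc assms(3)[of r] by simp
  qed
  moreover have "w = p k"
    unfolding x(2) p_def using assms(1) x(1)
    by (intro eq_vecI) (auto simp: scalar_prod_def mult.commute lessThan_atLeast0)
  ultimately show "w \<in> U" by simp
qed

lemma frame_empty: "frame N 0 (0\<^sub>m N 0)"
  unfolding frame_def by (auto intro!: bexI[of _ "0\<^sub>m 0 N"])

lemma colsp_empty: "colsp (0\<^sub>m N 0) = {0\<^sub>v N :: 'a::field vec}"
proof -
  have "(0\<^sub>m N 0 :: 'a mat) *\<^sub>v x = 0\<^sub>v N" if "x \<in> carrier_vec 0" for x
    using that by (intro eq_vecI) (auto simp: scalar_prod_def)
  thus ?thesis unfolding colsp_def by (auto simp: image_iff intro!: exI[of _ "0\<^sub>v 0"])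
qed

lemma frame_extend_sub:
  assumes M: "frame N k M" "colsp M \<subseteq> U" and U: "lin_sub N U"
  obtains D r where "D \<in> carrier_mat N r" "frame N (k + r) (hcat M D)"
    "colsp D \<subseteq> U" "colsp (hcat M D) = U"
proof -
  note Mc = frame_carrier[OF M(1)]
  obtain D r where D: "D \<in> carrier_mat N r" "frame N (k + r) (hcat M D)"
    "\<And>j. j < r \<Longrightarrow> col D j \<in> U" "U \<subseteq> colsp (hcat M D)"
    using frame_extend[OF M(1) lin_subD(1)[OF U]] by blast
  have sub: "colsp D \<subseteq> U" using colsp_subsetI[OF D(1) U D(3)] .
  have "colsp (hcat M D) \<subseteq> U"
    unfolding colsp_hcat[OF Mc D(1)] using sub M(2) lin_subD(3)[OF U] by blast
  thus ?thesis using that D sub by blast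
qed

lemma lin_sub_frame:
  assumes U: "lin_sub N U"
  obtains k M where "frame N k M" "colsp M = U"
proof -
  have "colsp (0\<^sub>m N 0) \<subseteq> U" unfolding colsp_empty using lin_subD(2)[OF U] by simp
  then obtain D r where D: "frame N (0 + r) (hcat (0\<^sub>m N 0) D)" "colsp (hcat (0\<^sub>m N 0) D) = U"
    using frame_extend_sub[OF frame_empty _ U] by metis
  thus ?thesis using that by blast
qed

lemma lin_sub_sum:
  assumes A: "lin_sub N A" and B: "lin_sub N B"
  shows "lin_sub N {a + b | a b. a \<in> A \<and> b \<in> B}"
proof -
  obtain k M where M: "frame N k M" "colsp M = A" using lin_sub_frame[OF A] .
  obtain k' M' where M': "frame N k' M'" "colsp M' = B" using lin_sub_frame[OF B] .
  show ?thesis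
    using lin_sub_colsp[OF hcat_carrier[OF frame_carrier[OF M(1)] frame_carrier[OF M'(1)]]]
    unfolding colsp_hcat[OF frame_carrier[OF M(1)] frame_carrier[OF M'(1)]] M(2) M'(2) .
qed

lemma lin_sub_separate:
  assumes U: "lin_sub N U" and v: "v \<in> carrier_vec N" "v \<notin> U"
  obtains c where "c \<in> carrier_vec N" "c \<bullet> v = 1" "\<And>u. u \<in> U \<Longrightarrow> c \<bullet> u = 0"
proof -
  obtain k M where "frame N k M" "colsp M = U" using lin_sub_frame[OF U] by blast
  thus ?thesis using frame_separate[of N k M v] v that by blast
qed

text \<open>The column space has some frame \<open>F\<close>; \<open>M\<close> and \<open>F\<close> are multiples of each other, and injectivity
  makes the two factors inverse, so a left inverse of \<open>F\<close> yields one of \<open>M\<close>.\<close>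

lemma frame_if_inj:
  assumes M: "M \<in> carrier_mat N k"
    and inj: "\<And>x. x \<in> carrier_vec k \<Longrightarrow> M *\<^sub>v x = 0\<^sub>v N \<Longrightarrow> x = 0\<^sub>v k"
  shows "frame N k M"
proof -
  obtain k' F where F: "frame N k' F" "colsp F = colsp M" using lin_sub_frame[OF lin_sub_colsp[OF M]] .
  note Fc = frame_carrier[OF F(1)]
  obtain L where L: "L \<in> carrier_mat k' N" "L * F = 1\<^sub>m k'" using F(1) unfolding frame_def by auto
  obtain g where g: "g \<in> carrier_mat k' k" "M = F * g"
    using colsp_factor[OF Fc M] col_in_colsp[OF M] F(2) by blast
  obtain h where h: "h \<in> carrier_mat k k'" "F = M * h"
    using colsp_factor[OF M Fc] col_in_colsp[OF Fc] F(2) by blast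
  have "h * g = 1\<^sub>m k"
  proof (rule eq_matI)
    fix i j assume "i < dim_row (1\<^sub>m k)" "j < dim_col (1\<^sub>m k)"
    hence i: "i < k" and j: "j < k" by auto
    define x where "x = col (h * g) j - col (1\<^sub>m k) j"
    have hg: "h * g \<in> carrier_mat k k" using h g by auto
    have x: "x \<in> carrier_vec k" unfolding x_def using hg j by auto
    have "M * (h * g) = M" using assoc_mult_mat[OF M h(1) g(1)] by (simp only: h(2)[symmetric] g(2)[symmetric])
    hence "M *\<^sub>v col (h * g) j = M *\<^sub>v col (1\<^sub>m k) j"
      using col_mult2[OF M hg j] col_mult2[OF M one_carrier_mat j] M by (metis right_mult_one_mat)
    hence "M *\<^sub>v x = 0\<^sub>v N"
      unfolding x_def using mult_minus_distrib_mat_vec[OF M, of "col (h * g) j" "col (1\<^sub>m k) j"] hg j M by auto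
    hence "x = 0\<^sub>v k" using inj x by blast
    hence "x $ i = 0" using i by simp
    thus "(h * g) $$ (i,j) = 1\<^sub>m k $$ (i,j)" using i j hg unfolding x_def by (auto simp del: index_mult_mat(1) col_mult2 simp: col_def)
  qed (use h g in auto)
  moreover have "L * M = g" unfolding g(2) using assoc_mult_mat[OF L(1) Fc g(1)] L(2) g(1) by simp
  ultimately have "(h * L) * M = 1\<^sub>m k" using assoc_mult_mat[OF h(1) L(1) M] by simp
  thus ?thesis unfolding frame_def using M h L by (auto intro!: bexI[of _ "h * L"])
qed

text \<open>A maximal independent set of rows spans the whole space: otherwise a functional vanishing on all
  rows would be a kernel vector of \<open>M\<close>.\<close>

lemma frame_nonzero_minor:
  assumes M: "frame N k M"
  obtains r where "\<And>i. i < k \<Longrightarrow> r i < N" "det (mat k k (\<lambda>(i,j). M $$ (r i, j))) \<noteq> 0"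
proof -
  note Mc = frame_carrier[OF M]
  define S where "S = row M ` {..<N}"
  have S: "S \<subseteq> carrier_vec k" unfolding S_def using Mc by auto
  obtain D q where D: "D \<in> carrier_mat k q" "frame k (0 + q) (hcat (0\<^sub>m k 0) D)"
    "\<And>j. j < q \<Longrightarrow> col D j \<in> S" "S \<subseteq> colsp (hcat (0\<^sub>m k 0) D)"
    using frame_extend[OF frame_empty S] by blast
  have "hcat (0\<^sub>m k 0) D = D" using D(1) unfolding hcat_def by (intro eq_matI) auto
  hence F: "frame k q D" and SD: "S \<subseteq> colsp D" using D by auto
  have full: "v \<in> colsp D" if v: "v \<in> carrier_vec k" for v
  proof (rule ccontr)
    assume "v \<notin> colsp D"
    then obtain c where c: "c \<in> carrier_vec k" "c \<bullet> v = 1" "\<And>u. u \<in> colsp D \<Longrightarrow> c \<bullet> u = 0"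
      using frame_separate[OF F v] by blast
    have "M *\<^sub>v c = 0\<^sub>v N"
    proof (rule eq_vecI)
      fix i assume i: "i < dim_vec (0\<^sub>v N)"
      hence "row M i \<in> colsp D" using SD unfolding S_def by auto
      hence "c \<bullet> row M i = 0" using c(3) by blast
      thus "(M *\<^sub>v c) $ i = 0\<^sub>v N $ i" using i Mc c(1) by (auto simp: comm_scalar_prod[of c k])
    qed (use Mc in auto)
    hence "c = 0\<^sub>v k" using frame_inj[OF M c(1), of "0\<^sub>v k"] mult_mat_vec_zero[OF Mc] by auto
    thus False using c(2) v by auto
  qed
  have "k \<le> q" using frame_dim_le[OF frame_one D(1)] full by (auto simp: colsp_one)
  moreover have "q \<le> k" using frame_le[OF F] .
  ultimately have q: "q = k" by simp
  have "\<forall>j. \<exists>i. j < k \<longrightarrow> i < N \<and> col D j = row M i" using D(3) q unfolding S_def by fastforce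
  then obtain r where r: "\<And>j. j < k \<Longrightarrow> r j < N \<and> col D j = row M (r j)" by metis
  have DT: "mat k k (\<lambda>(i,j). M $$ (r i, j)) = transpose_mat D"
  proof (rule eq_matI)
    fix i j assume "i < dim_row (transpose_mat D)" "j < dim_col (transpose_mat D)"
    hence i: "i < k" and j: "j < k" using D(1) q by auto
    have "D $$ (j,i) = col D i $ j" using i j D(1) q by auto
    also have "\<dots> = M $$ (r i, j)" using r[OF i] j Mc by auto
    finally show "mat k k (\<lambda>(i,j). M $$ (r i, j)) $$ (i,j) = transpose_mat D $$ (i,j)" using i j D(1) q by auto
  qed (use D q in auto)
  have Dk: "D \<in> carrier_mat k k" using D(1) q by simp
  have "det D \<noteq> 0"
  proof
    assume "det D = 0"
    then obtain v where v: "v \<in> carrier_vec k" "v \<noteq> 0\<^sub>v k" "D *\<^sub>v v = 0\<^sub>v k"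
      using det_0_iff_vec_prod_zero[OF Dk] by blast
    thus False using frame_inj[OF F, of v "0\<^sub>v k"] mult_mat_vec_zero[OF Dk] q by auto
  qed
  hence "det (mat k k (\<lambda>(i,j). M $$ (r i, j))) \<noteq> 0" unfolding DT using det_transpose[OF Dk] by simp
  thus ?thesis using that r by blast
qed

text \<open>Two bases of the same subspace differ by an invertible matrix; this is why the coordinates of a
  point are unique up to a scalar in each factor.\<close>

lemma frame_change:
  assumes M: "frame N k M" and M': "M' \<in> carrier_mat N k" and eq: "colsp M' = colsp M"
  obtains g where "g \<in> carrier_mat k k" "M' = M * g" "det g \<noteq> 0" "frame N k M'"
proof -
  note Mc = frame_carrier[OF M]
  obtain L where L: "L \<in> carrier_mat k N" "L * M = 1\<^sub>m k" using M unfolding frame_def by auto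
  obtain g where g: "g \<in> carrier_mat k k" "M' = M * g"
    using colsp_factor[OF Mc M'] col_in_colsp[OF M'] eq by blast
  obtain h where h: "h \<in> carrier_mat k k" "M = M' * h"
    using colsp_factor[OF M' Mc] col_in_colsp[OF Mc] eq by blast
  have "(L * M') * h = 1\<^sub>m k" using assoc_mult_mat[OF L(1) M' h(1)] L(2) h(2) by simp
  moreover have "L * M' = g" unfolding g(2) using assoc_mult_mat[OF L(1) Mc g(1)] L(2) g(1) by simp
  ultimately have gh: "g * h = 1\<^sub>m k" by simp
  hence "det g * det h = 1" using det_mult[OF g(1) h(1)] by simp
  hence dg: "det g \<noteq> 0" by auto
  have "h * g = 1\<^sub>m k" using mat_mult_left_right_inverse[OF g(1) h(1) gh] .
  hence "(h * L) * M' = 1\<^sub>m k" using assoc_mult_mat[OF h(1) L(1) M'] \<open>L * M' = g\<close> by simp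
  hence "frame N k M'" unfolding frame_def using M' h L by (auto intro!: bexI[of _ "h * L"])
  thus ?thesis using that g dg by blast
qed

section \<open>Dimension\<close>

definition vdim :: "nat \<Rightarrow> 'a::field vec set \<Rightarrow> nat" where
  "vdim N U = vectorspace.dim class_ring ((module_vec TYPE('a) N)\<lparr>carrier := U\<rparr>)"

lemma col_space_eq_colsp:
  assumes "M \<in> carrier_mat N k"
  shows "vec_space.col_space N M = colsp M"
proof -
  interpret vec_space "TYPE('a)" N .
  show ?thesis unfolding col_space_eq[OF assms] colsp_def using assms by auto
qed

lemma vdim_colsp:
  fixes M :: "'a::field mat"
  assumes M: "frame N k M"
  shows "vdim N (colsp M) = k"
proof -
  interpret vec_space "TYPE('a)" N .
  note Mc = frame_carrier[OF M]
  have d: "distinct (cols M)"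
  proof (subst distinct_conv_nth, intro allI impI)
    fix i j assume "i < length (cols M)" "j < length (cols M)" "i \<noteq> j"
    hence ij: "i < k" "j < k" "i \<noteq> j" using Mc by auto
    have "col M i \<noteq> col M j"
    proof
      assume "col M i = col M j"
      hence "M *\<^sub>v unit_vec k i = M *\<^sub>v unit_vec k j" using ij Mc by (simp add: mult_unit_vec)
      hence "unit_vec k i = (unit_vec k j :: 'a vec)" using frame_inj[OF M] by simp
      hence "(unit_vec k i :: 'a vec) $ i = unit_vec k j $ i" by simp
      thus False using ij by auto
    qed
    thus "cols M ! i \<noteq> cols M ! j" using ij Mc by simp
  qed
  have li: "lin_indpt (set (cols M))"
  proof
    assume "lin_dep (set (cols M))"
    from lin_depE[OF Mc this d] obtain v where v: "v \<in> carrier_vec k" "v \<noteq> 0\<^sub>v k" "M *\<^sub>v v = 0\<^sub>v N" .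
    thus False using frame_inj[OF M, of v "0\<^sub>v k"] mult_mat_vec_zero[OF Mc] by auto
  qed
  have "rank M = k" using lin_indpt_full_rank[OF Mc d li] .
  thus ?thesis unfolding rank_def vdim_def
    using col_space_eq_colsp[OF Mc, unfolded col_space_def] by simp
qed

lemma subspace_iff_lin_sub:
  fixes U :: "'a::field vec set"
  shows "VectorSpace.subspace class_ring U (module_vec TYPE('a) N) \<longleftrightarrow> lin_sub N U"
proof -
  interpret vec_space "TYPE('a)" N .
  show ?thesis
  proof
    assume "VectorSpace.subspace class_ring U V"
    hence "submodule class_ring U V" unfolding subspace_def by simp
    thus "lin_sub N U" unfolding submodule_def lin_sub_def
      by (auto simp: module_vec_simps class_ring_simps)
  next
    assume "lin_sub N U"
    hence "submodule class_ring U V" unfolding submodule_def lin_sub_def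
      using vec_module by (auto simp: module_vec_simps class_ring_simps)
    thus "VectorSpace.subspace class_ring U V" unfolding subspace_def using vec_vs by simp
  qed
qed

lemma Gr_iff: "U \<in> Gr N k \<longleftrightarrow> lin_sub N U \<and> vdim N U = k"
  unfolding Gr_def vdim_def subspace_iff_lin_sub by simp

lemma Gr_frameE:
  assumes "U \<in> Gr N k"
  obtains M where "frame N k M" "colsp M = U"
proof -
  have U: "lin_sub N U" "vdim N U = k" using assms unfolding Gr_iff by auto
  obtain k' M where M: "frame N k' M" "colsp M = U" using lin_sub_frame[OF U(1)] .
  have "k' = k" using vdim_colsp[OF M(1)] M(2) U(2) by simp
  thus ?thesis using that M by simp
qed

lemma frame_Gr: "frame N k M \<Longrightarrow> colsp M \<in> Gr N k"
  unfolding Gr_iff using vdim_colsp lin_sub_colsp frame_carrier by blast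

lemma Gr_frame:
  assumes "U \<in> Gr N k" "M \<in> carrier_mat N k" "colsp M = U"
  shows "frame N k M"
proof -
  obtain M0 where M0: "frame N k M0" "colsp M0 = U" using Gr_frameE[OF assms(1)] .
  thus ?thesis using frame_change[OF M0(1) assms(2)] assms(3) by auto
qed

lemma vdim_mono:
  assumes U: "lin_sub N U" and U': "lin_sub N U'" and sub: "U \<subseteq> U'"
  shows "vdim N U \<le> vdim N U'"
proof -
  obtain k M where M: "frame N k M" "colsp M = U" using lin_sub_frame[OF U] .
  obtain k' M' where M': "frame N k' M'" "colsp M' = U'" using lin_sub_frame[OF U'] .
  show ?thesis
    using frame_dim_le[OF M(1) frame_carrier[OF M'(1)]] vdim_colsp[OF M(1)] vdim_colsp[OF M'(1)] M(2) M'(2) sub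
    by simp
qed

lemma lin_sub_eqI:
  assumes U: "lin_sub N U" and U': "lin_sub N U'" and sub: "U \<subseteq> U'" and le: "vdim N U' \<le> vdim N U"
  shows "U = U'"
proof -
  obtain k M where M: "frame N k M" "colsp M = U" using lin_sub_frame[OF U] .
  have "colsp M \<subseteq> U'" using M(2) sub by simp
  from frame_extend_sub[OF M(1) this U'] obtain D r where
    D: "D \<in> carrier_mat N r" "frame N (k + r) (hcat M D)" "colsp (hcat M D) = U'" .
  have "k + r \<le> k" using le vdim_colsp[OF M(1)] vdim_colsp[OF D(2)] M(2) D(3) by simp
  hence "hcat M D = M" using D(1) frame_carrier[OF M(1)] unfolding hcat_def by (intro eq_matI) auto
  thus ?thesis using M D by simp
qed

lemma vdim_strict_mono:
  assumes "lin_sub N U" "lin_sub N U'" "U \<subset> U'"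
  shows "vdim N U < vdim N U'"
  using lin_sub_eqI[OF assms(1,2)] assms(3) by force

lemma vdim_carrier: "vdim N (carrier_vec N :: 'a::field vec set) = N"
  using vdim_colsp[OF frame_one] by (simp add: colsp_one)

lemma lin_sub_kernel:
  assumes "P \<in> carrier_mat N' N" "lin_sub N U"
  shows "lin_sub N {u\<in>U. P *\<^sub>v u = 0\<^sub>v N'}"
  using lin_subD[OF assms(2)] mult_mat_vec_zero[OF assms(1)]
  by (intro lin_subI) (auto simp: mult_add_distrib_mat_vec[OF assms(1)] mult_mat_vec[OF assms(1)])

text \<open>Extend a basis of the kernel to one of \<open>U\<close>; the images of the added vectors are a basis of the
  image.\<close>

lemma rank_nullity:
  assumes P: "P \<in> carrier_mat N' N" and U: "lin_sub N U"
  shows "vdim N' ((\<lambda>v. P *\<^sub>v v) ` U) + vdim N {u\<in>U. P *\<^sub>v u = 0\<^sub>v N'} = vdim N U"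
proof -
  define K where "K = {u\<in>U. P *\<^sub>v u = 0\<^sub>v N'}"
  have K: "lin_sub N K" unfolding K_def using lin_sub_kernel[OF P U] .
  obtain k C where C: "frame N k C" "colsp C = K" using lin_sub_frame[OF K] .
  note Cc = frame_carrier[OF C(1)]
  have "colsp C \<subseteq> U" using C(2) unfolding K_def by auto
  from frame_extend_sub[OF C(1) this U] obtain D r where
    D: "D \<in> carrier_mat N r" "frame N (k + r) (hcat C D)" "colsp D \<subseteq> U" "colsp (hcat C D) = U" .
  have PD: "P * D \<in> carrier_mat N' r" using P D by simp
  have "frame N' r (P * D)"
  proof (rule frame_if_inj[OF PD])
    fix x assume x: "x \<in> carrier_vec r" "P * D *\<^sub>v x = 0\<^sub>v N'"
    have "P *\<^sub>v (D *\<^sub>v x) = 0\<^sub>v N'" using x assoc_mult_mat_vec[OF P D(1)] by simp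
    moreover have "D *\<^sub>v x \<in> U" using D(1,3) x(1) unfolding colsp_def by auto
    ultimately have "D *\<^sub>v x \<in> colsp C" unfolding C(2) K_def by simp
    then obtain y where y: "y \<in> carrier_vec k" "D *\<^sub>v x = C *\<^sub>v y" using Cc unfolding colsp_def by auto
    have "hcat C D *\<^sub>v (0\<^sub>v k @\<^sub>v x) = hcat C D *\<^sub>v (y @\<^sub>v 0\<^sub>v r)"
      using hcat_mult_vec[OF Cc D(1)] x(1) y mult_mat_vec_zero[OF Cc] mult_mat_vec_zero[OF D(1)] Cc D(1) by simp
    hence "0\<^sub>v k @\<^sub>v x = y @\<^sub>v 0\<^sub>v r" using frame_inj[OF D(2)] x(1) y(1) by simp
    thus "x = 0\<^sub>v r" using append_vec_eq[of "0\<^sub>v k" k y x "0\<^sub>v r"] y(1) by simp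
  qed
  moreover have "colsp (P * D) = (\<lambda>v. P *\<^sub>v v) ` U"
  proof (intro equalityI subsetI)
    fix w assume "w \<in> colsp (P * D)"
    then obtain x where x: "x \<in> carrier_vec r" "w = P *\<^sub>v (D *\<^sub>v x)"
      using D(1) assoc_mult_mat_vec[OF P D(1)] unfolding colsp_def by auto
    thus "w \<in> (\<lambda>v. P *\<^sub>v v) ` U" using D(1,3) unfolding colsp_def by auto
  next
    fix w assume "w \<in> (\<lambda>v. P *\<^sub>v v) ` U"
    then obtain u v where uv: "u \<in> K" "v \<in> colsp D" "w = P *\<^sub>v (u + v)"
      unfolding D(4)[symmetric] colsp_hcat[OF Cc D(1)] C(2) by auto
    have "u \<in> carrier_vec N" "v \<in> carrier_vec N" using uv lin_subD(5)[OF K] lin_subD(5)[OF lin_sub_colsp[OF D(1)]] by auto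
    hence "w = P *\<^sub>v v" using uv P mult_add_distrib_mat_vec[OF P] unfolding K_def by auto
    thus "w \<in> colsp (P * D)" using uv(2) D(1) assoc_mult_mat_vec[OF P D(1)] unfolding colsp_def by auto
  qed
  ultimately have "vdim N' ((\<lambda>v. P *\<^sub>v v) ` U) = r" using vdim_colsp[of N' r "P * D"] by simp
  moreover have "vdim N K = k" "vdim N U = k + r" using vdim_colsp[OF C(1)] vdim_colsp[OF D(2)] C D by auto
  ultimately show ?thesis unfolding K_def by simp
qed

definition coord_sub :: "nat \<Rightarrow> nat \<Rightarrow> nat \<Rightarrow> 'a::field vec set" where
  "coord_sub N a b = {v\<in>carrier_vec N. \<forall>i<N. i < a \<or> b \<le> i \<longrightarrow> v $ i = 0}"

lemma lin_sub_coord_sub: "lin_sub N (coord_sub N a b)"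
  unfolding coord_sub_def by (rule lin_subI) auto

lemma vdim_coord_sub:
  assumes "a \<le> b" "b \<le> N"
  shows "vdim N (coord_sub N a b :: 'a::field vec set) = b - a"
proof -
  define M :: "'a mat" where "M = mat N (b - a) (\<lambda>(i,j). if i = a + j then 1 else 0)"
  have M: "M \<in> carrier_mat N (b - a)" unfolding M_def by simp
  have Mx: "(M *\<^sub>v x) $ i = (if a \<le> i \<and> i < b then x $ (i - a) else 0)"
    if x: "x \<in> carrier_vec (b - a)" and i: "i < N" for x i
  proof -
    have "(M *\<^sub>v x) $ i = (\<Sum>j\<in>{0..<b - a}. M $$ (i,j) * x $ j)"
      using x i M by (simp add: scalar_prod_def)
    also have "\<dots> = (\<Sum>j\<in>{0..<b - a}. if j = i - a then (if a \<le> i then x $ j else 0) else 0)"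
      using i unfolding M_def by (intro sum.cong refl) auto
    also have "\<dots> = (if a \<le> i \<and> i < b then x $ (i - a) else 0)" by (subst sum.delta) auto
    finally show ?thesis .
  qed
  have "frame N (b - a) M"
  proof (rule frame_if_inj[OF M])
    fix x assume x: "x \<in> carrier_vec (b - a)" "M *\<^sub>v x = 0\<^sub>v N"
    show "x = 0\<^sub>v (b - a)"
    proof (rule eq_vecI)
      fix i assume i: "i < dim_vec (0\<^sub>v (b - a) :: 'a vec)"
      hence "(M *\<^sub>v x) $ (a + i) = x $ i" using Mx[OF x(1), of "a + i"] assms by simp
      thus "x $ i = 0\<^sub>v (b - a) $ i" unfolding x(2) using i assms by simp
    qed (use x(1) in simp)
  qed
  moreover have "colsp M = coord_sub N a b"
  proof (intro equalityI subsetI)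
    fix w :: "'a vec" assume "w \<in> colsp M"
    then obtain x where x: "x \<in> carrier_vec (b - a)" "w = M *\<^sub>v x" using M unfolding colsp_def by auto
    have "w \<in> carrier_vec N" unfolding x(2) using mult_mat_vec_carrier[OF M x(1)] .
    thus "w \<in> coord_sub N a b" unfolding coord_sub_def using Mx[OF x(1)] x(2)[symmetric] by simp
  next
    fix w :: "'a vec" assume w: "w \<in> coord_sub N a b"
    define x where "x = vec (b - a) (\<lambda>i. w $ (a + i))"
    have x: "x \<in> carrier_vec (b - a)" unfolding x_def by simp
    have "w = M *\<^sub>v x"
    proof (rule eq_vecI)
      show "dim_vec w = dim_vec (M *\<^sub>v x)" using w M unfolding coord_sub_def by simp
      fix i assume "i < dim_vec (M *\<^sub>v x)"
      hence i: "i < N" using M by simp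
      have "(M *\<^sub>v x) $ i = (if a \<le> i \<and> i < b then w $ i else 0)"
        using Mx[OF x i] unfolding x_def by auto
      thus "w $ i = (M *\<^sub>v x) $ i" using w i unfolding coord_sub_def by auto
    qed
    thus "w \<in> colsp M" using M x unfolding colsp_def by auto
  qed
  ultimately show ?thesis using vdim_colsp[of N "b - a" M] by simp
qed

lemma coord_subD:
  assumes "w \<in> coord_sub N a b"
  shows "w \<in> carrier_vec N" "\<And>i. i < N \<Longrightarrow> i < a \<Longrightarrow> w $ i = 0" "\<And>i. i < N \<Longrightarrow> b \<le> i \<Longrightarrow> w $ i = 0"
  using assms unfolding coord_sub_def by auto

lemma coord_sub_mono: "a' \<le> a \<Longrightarrow> b \<le> b' \<Longrightarrow> coord_sub N a b \<subseteq> coord_sub N a' b'"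
  unfolding coord_sub_def by auto

lemma coord_sub_least:
  fixes U :: "'a::field vec set"
  assumes U: "lin_sub N U" and e: "\<And>j. a \<le> j \<Longrightarrow> j < b \<Longrightarrow> unit_vec N j \<in> U" and b: "b \<le> N"
  shows "coord_sub N a b \<subseteq> U"
proof
  fix v :: "'a vec" assume v: "v \<in> coord_sub N a b"
  note vc = coord_subD[OF v]
  define p where "p = (\<lambda>r. vec N (\<lambda>i. if i < r then v $ i else 0))"
  have "p r \<in> U" if "r \<le> N" for r using that
  proof (induction r)
    case 0
    have "p 0 = 0\<^sub>v N" unfolding p_def by auto
    thus ?case using lin_subD(2)[OF U] by simp
  next
    case (Suc r)
    show ?case
    proof (cases "a \<le> r \<and> r < b")
      case True
      have "p (Suc r) = p r + v $ r \<cdot>\<^sub>v unit_vec N r"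
        using Suc.prems unfolding p_def by (intro eq_vecI) (auto simp: less_Suc_eq)
      thus ?thesis using lin_subD(3,4)[OF U] Suc e True by simp
    next
      case False
      have vr: "v $ r = 0" using False Suc.prems vc(2)[of r] vc(3)[of r] by auto
      have "p (Suc r) = p r"
      proof (rule eq_vecI)
        fix i assume "i < dim_vec (p r)"
        hence "i < N" unfolding p_def by simp
        thus "p (Suc r) $ i = p r $ i" using vr unfolding p_def by (cases "i = r") auto
      qed (simp add: p_def)
      thus ?thesis using Suc by simp
    qed
  qed
  moreover have "v = p N" using vc(1) unfolding p_def by (intro eq_vecI) auto
  ultimately show "v \<in> U" by simp
qed

lemma lin_sub_line:
  assumes "y \<in> carrier_vec N"
  shows "lin_sub N (range (\<lambda>c. c \<cdot>\<^sub>v y))"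
proof (rule lin_subI)
  show "range (\<lambda>c. c \<cdot>\<^sub>v y) \<subseteq> carrier_vec N" using assms by auto
  have "0\<^sub>v N = 0 \<cdot>\<^sub>v y" using assms by (intro eq_vecI) auto
  thus "0\<^sub>v N \<in> range (\<lambda>c. c \<cdot>\<^sub>v y)" by blast
  fix u a assume "u \<in> range (\<lambda>c. c \<cdot>\<^sub>v y)"
  then obtain c where u: "u = c \<cdot>\<^sub>v y" by auto
  thus "a \<cdot>\<^sub>v u \<in> range (\<lambda>c. c \<cdot>\<^sub>v y)" by (auto simp: smult_smult_assoc)
  fix v assume "v \<in> range (\<lambda>c. c \<cdot>\<^sub>v y)"
  then obtain c' where "v = c' \<cdot>\<^sub>v y" by auto
  hence "u + v = (c + c') \<cdot>\<^sub>v y" using u by (simp add: add_smult_distrib_vec)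
  thus "u + v \<in> range (\<lambda>c. c \<cdot>\<^sub>v y)" by blast
qed

lemma lin_sub_Gr: "U \<in> Gr N k \<Longrightarrow> lin_sub N U" and vdim_Gr: "U \<in> Gr N k \<Longrightarrow> vdim N U = k"
  unfolding Gr_iff by auto

lemma image_colsp:
  assumes "A \<in> carrier_mat N N" "M \<in> carrier_mat N k"
  shows "(\<lambda>v. A *\<^sub>v v) ` colsp M = colsp (A * M)"
proof -
  have "A * M \<in> carrier_mat N k" using assms by simp
  hence "colsp (A * M) = (\<lambda>x. A *\<^sub>v (M *\<^sub>v x)) ` carrier_vec k"
    unfolding colsp_def using assoc_mult_mat_vec[OF assms] by auto
  thus ?thesis unfolding colsp_def using assms by (auto simp: image_image)
qed

lemma Gr_image:
  fixes A :: "complex mat"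
  assumes A: "A \<in> carrier_mat N N" and inj: "\<And>v. v \<in> carrier_vec N \<Longrightarrow> A *\<^sub>v v = 0\<^sub>v N \<Longrightarrow> v = 0\<^sub>v N"
    and U: "U \<in> Gr N k"
  shows "(\<lambda>v. A *\<^sub>v v) ` U \<in> Gr N k"
proof -
  obtain M where M: "frame N k M" "colsp M = U" using Gr_frameE[OF U] .
  note Mc = frame_carrier[OF M(1)]
  have AM: "A * M \<in> carrier_mat N k" using A Mc by simp
  have "frame N k (A * M)"
  proof (rule frame_if_inj[OF AM])
    fix x assume x: "x \<in> carrier_vec k" "A * M *\<^sub>v x = 0\<^sub>v N"
    hence "M *\<^sub>v x = 0\<^sub>v N"
      using inj[of "M *\<^sub>v x"] mult_mat_vec_carrier[OF Mc x(1)] assoc_mult_mat_vec[OF A Mc x(1)] by simp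
    thus "x = 0\<^sub>v k" using frame_inj[OF M(1) x(1), of "0\<^sub>v k"] mult_mat_vec_zero[OF Mc] by simp
  qed
  from frame_Gr[OF this] show ?thesis using image_colsp[OF A Mc] M(2) by simp
qed

section \<open>Minors\<close>

text \<open>Rows are selected by a function rather than a set, so that replacing one row is a function
  update; every such minor is a fixed multiple of one indexed by a set.\<close>

definition rowmat :: "'a mat \<Rightarrow> nat \<Rightarrow> (nat \<Rightarrow> nat) \<Rightarrow> 'a mat" where
  "rowmat M k r = mat k k (\<lambda>(i,j). M $$ (r i, j))"

lemma rowmat_carrier[simp]: "rowmat M k r \<in> carrier_mat k k"
  unfolding rowmat_def by simp

lemma det_scale_rows:
  fixes A :: "'a::comm_ring_1 mat"
  assumes A: "A \<in> carrier_mat k k"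
  shows "det (mat k k (\<lambda>(i,j). c i * A $$ (i,j))) = (\<Prod>i\<in>{0..<k}. c i) * det A"
proof -
  have "det (mat k k (\<lambda>(i,j). c i * A $$ (i,j))) =
      (\<Sum>p\<in>{p. p permutes {0..<k}}. signof p * (\<Prod>i\<in>{0..<k}. c i * A $$ (i, p i)))"
    unfolding det_def'[OF mat_carrier]
  proof (intro sum.cong refl arg_cong2[of _ _ _ _ "(*)"] prod.cong)
    fix p i assume "p \<in> {p. p permutes {0..<k}}" "i \<in> {0..<k}"
    hence "i < k" "p i < k" using permutes_in_image[of p "{0..<k}" i] by auto
    thus "mat k k (\<lambda>(i,j). c i * A $$ (i,j)) $$ (i, p i) = c i * A $$ (i, p i)" by simp
  qed
  also have "\<dots> = (\<Prod>i\<in>{0..<k}. c i) * (\<Sum>p\<in>{p. p permutes {0..<k}}. signof p * (\<Prod>i\<in>{0..<k}. A $$ (i, p i)))"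
    unfolding sum_distrib_left prod.distrib by (intro sum.cong refl) (simp only: mult_ac)
  finally show ?thesis unfolding det_def'[OF A] .
qed

lemma det_zero_row:
  fixes A :: "'a::comm_ring_1 mat"
  assumes "A \<in> carrier_mat k k" "i < k" "\<And>j. j < k \<Longrightarrow> A $$ (i,j) = 0"
  shows "det A = 0"
  unfolding laplace_expansion_row[OF assms(1,2)] using assms(3) by (intro sum.neutral) simp

lemma det_zero_col:
  fixes A :: "'a::comm_ring_1 mat"
  assumes "A \<in> carrier_mat k k" "j < k" "\<And>i. i < k \<Longrightarrow> A $$ (i,j) = 0"
  shows "det A = 0"
  unfolding laplace_expansion_column[OF assms(1,2)] using assms(3) by (intro sum.neutral) simp

lemma rowmat_mult:
  assumes "M \<in> carrier_mat N k" "g \<in> carrier_mat k k" "\<And>i. i < k \<Longrightarrow> r i < N"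
  shows "rowmat (M * g) k r = rowmat M k r * g"
proof (rule eq_matI)
  fix i j assume "i < dim_row (rowmat M k r * g)" "j < dim_col (rowmat M k r * g)"
  hence i: "i < k" and j: "j < k" using assms(2) unfolding rowmat_def by auto
  have "row (rowmat M k r) i = row M (r i)"
    using i assms unfolding rowmat_def by (intro eq_vecI) auto
  thus "rowmat (M * g) k r $$ (i,j) = (rowmat M k r * g) $$ (i,j)"
    using i j assms unfolding rowmat_def by simp
qed (use assms in \<open>auto simp: rowmat_def\<close>)

lemma submatrix_rowmat:
  assumes "M \<in> carrier_mat N k" "I \<subseteq> {..<N}" "card I = k"
  shows "submatrix M I UNIV = rowmat M k (pick I)"
proof -
  have "{i. i < dim_row M \<and> i \<in> I} = I" "{j. j < dim_col M \<and> j \<in> UNIV} = {..<k}"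
    using assms by auto
  thus ?thesis unfolding submatrix_def rowmat_def using assms(3) by (auto simp: pick_UNIV)
qed

lemma pick_lt:
  assumes "I \<subseteq> {..<N}" "i < card I"
  shows "pick I i < N"
  using pick_in_set_le[OF assms(2)] assms(1) by auto

lemma pick_inj_on: "inj_on (pick I) {..<card I}"
proof (rule inj_onI)
  fix i j assume "i \<in> {..<card I}" "j \<in> {..<card I}" "pick I i = pick I j"
  thus "i = j" using pick_mono_le[of i I j] pick_mono_le[of j I i] by (metis lessThan_iff nat_neq_iff)
qed

lemma pick_bij:
  assumes "finite I"
  shows "bij_betw (pick I) {..<card I} I"
proof -
  have "pick I ` {..<card I} \<subseteq> I" using pick_in_set_le by auto
  moreover have "card (pick I ` {..<card I}) = card I" using card_image[OF pick_inj_on] by simp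
  ultimately have "pick I ` {..<card I} = I" using card_subset_eq[OF assms] by blast
  thus ?thesis using pick_inj_on unfolding bij_betw_def by blast
qed

lemma pick_initial:
  assumes "{..<a} \<subseteq> I" "i < a"
  shows "pick I i = i"
proof -
  have "{b \<in> I. b < i} = {..<i}" using assms by auto
  thus ?thesis using pick_card_in_set[of i I] assms by auto
qed

lemma le_pick:
  assumes "i < card I"
  shows "i \<le> pick I i"
proof -
  have "card {a \<in> I. a < pick I i} \<le> card {..<pick I i}" by (intro card_mono) auto
  thus ?thesis using card_pick_le[OF assms] by simp
qed

text \<open>The multiple depends on the selection of rows only: it is the sign of the permutation that sorts
  the rows, and zero if a row is repeated.\<close>

lemma det_rowmat_minor:
  fixes r :: "nat \<Rightarrow> nat"
  assumes r: "\<And>i. i < k \<Longrightarrow> r i < N"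
  shows "\<exists>\<kappa>. (inj_on r {..<k} \<longrightarrow> \<kappa> \<noteq> 0) \<and>
    (\<forall>M\<in>carrier_mat N k. det (rowmat M k r) = \<kappa> * det (submatrix M (r ` {..<k}) UNIV :: 'a::field mat))"
proof (cases "inj_on r {..<k}")
  case True
  define I where "I = r ` {..<k}"
  have I: "I \<subseteq> {..<N}" "card I = k" "finite I"
    unfolding I_def using r card_image[OF True] by auto
  define p where "p = (\<lambda>i. if i < k then inv_into {..<k} (pick I) (r i) else i)"
  have bij: "bij_betw (pick I) {..<k} I" using pick_bij[OF I(3)] I(2) by simp
  have br: "bij_betw r {..<k} I" using True unfolding I_def by (simp add: bij_betw_def)
  have "bij_betw (\<lambda>i. inv_into {..<k} (pick I) (r i)) {..<k} {..<k}"
    using bij_betw_trans[OF br bij_betw_inv_into[OF bij]] unfolding comp_def .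
  hence "bij_betw p {..<k} {..<k}" unfolding p_def by (rule bij_betw_cong[THEN iffD1, rotated]) auto
  hence p: "p permutes {0..<k}" unfolding p_def
    by (intro bij_imp_permutes) (auto simp: lessThan_atLeast0)
  have pp: "pick I (p i) = r i" if "i < k" for i
    using that bij unfolding p_def bij_betw_def by (auto simp: I_def f_inv_into_f)
  have "det (rowmat M k r) = signof p * det (submatrix M I UNIV)" if M: "M \<in> carrier_mat N k" for M :: "'a mat"
  proof -
    have "rowmat M k r = mat k k (\<lambda>(i,j). rowmat M k (pick I) $$ (p i, j))"
    proof (rule eq_matI)
      fix i j assume "i < dim_row (mat k k (\<lambda>(i,j). rowmat M k (pick I) $$ (p i, j)))"
        "j < dim_col (mat k k (\<lambda>(i,j). rowmat M k (pick I) $$ (p i, j)))"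
      hence i: "i < k" and j: "j < k" by auto
      have "p i < k" using permutes_in_image[OF p, of i] i by simp
      thus "rowmat M k r $$ (i,j) = mat k k (\<lambda>(i,j). rowmat M k (pick I) $$ (p i, j)) $$ (i,j)"
        using i j pp[OF i] unfolding rowmat_def by simp
    qed (auto simp: rowmat_def)
    thus ?thesis using det_permute_rows[OF rowmat_carrier p] submatrix_rowmat[OF M I(1,2)] by simp
  qed
  moreover have "(signof p :: 'a) \<noteq> 0" by (simp add: sign_def)
  ultimately show ?thesis unfolding I_def by (intro exI[of _ "signof p"]) simp
next
  case False
  then obtain a b where ab: "a < k" "b < k" "a \<noteq> b" "r a = r b" unfolding inj_on_def by auto
  have "det (rowmat M k r) = 0" for M :: "'a mat"
  proof (rule det_identical_rows[OF rowmat_carrier ab(3,1,2)])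
    show "row (rowmat M k r) a = row (rowmat M k r) b"
      using ab unfolding rowmat_def by (intro eq_vecI) auto
  qed
  thus ?thesis using False by (intro exI[of _ 0]) auto
qed

text \<open>Cramer's rule without division: the columns of the product of \<open>M\<close> with the adjugate of a square
  block lie in the column space of \<open>M\<close>, and their entries are again maximal minors of \<open>M\<close>.\<close>

lemma mult_adj_rowmat:
  fixes M :: "'a::field mat"
  assumes M: "M \<in> carrier_mat N k" and i: "i < N" and j: "j < k"
  shows "(M * adj_mat (rowmat M k r)) $$ (i,j) = det (rowmat M k (r(j := i)))"
proof -
  define A where "A = rowmat M k r"
  define A' where "A' = rowmat M k (r(j := i))"
  have A: "A \<in> carrier_mat k k" and A': "A' \<in> carrier_mat k k" unfolding A_def A'_def by simp_all
  have cof: "cofactor A' j b = cofactor A j b" if "b < k" for b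
  proof -
    have "mat_delete A' j b = mat_delete A j b"
      unfolding mat_delete_def A_def A'_def rowmat_def by (intro eq_matI) auto
    thus ?thesis unfolding cofactor_def by simp
  qed
  have "det A' = (\<Sum>b<k. A' $$ (j,b) * cofactor A' j b)" using laplace_expansion_row[OF A' j] .
  also have "\<dots> = (\<Sum>b<k. M $$ (i,b) * cofactor A j b)"
    using cof j unfolding A'_def rowmat_def by (intro sum.cong) auto
  also have "\<dots> = (M * adj_mat A) $$ (i,j)"
    using i j M A adj_mat(1)[OF A] unfolding adj_mat_def
    by (auto simp: scalar_prod_def lessThan_atLeast0 intro!: sum.cong)
  finally show ?thesis unfolding A_def A'_def by simp
qed

lemma mat_inverse_exists:
  fixes g :: "'a::field mat"
  assumes g: "g \<in> carrier_mat k k" "det g \<noteq> 0"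
  obtains h where "h \<in> carrier_mat k k" "g * h = 1\<^sub>m k" "h * g = 1\<^sub>m k"
proof -
  define h where "h = (1 / det g) \<cdot>\<^sub>m adj_mat g"
  have h: "h \<in> carrier_mat k k" unfolding h_def using adj_mat(1)[OF g(1)] by simp
  have "g * h = 1\<^sub>m k" unfolding h_def
    using mult_smult_distrib[OF g(1) adj_mat(1)[OF g(1)]] adj_mat(2)[OF g(1)] g(2)
    by auto
  thus ?thesis using that h mat_mult_left_right_inverse[OF g(1) h] by blast
qed

lemma colsp_mult_subset:
  assumes "M \<in> carrier_mat N k" "g \<in> carrier_mat k k'"
  shows "colsp (M * g) \<subseteq> colsp M"
proof
  fix w assume "w \<in> colsp (M * g)"
  then obtain x where "x \<in> carrier_vec k'" "w = M *\<^sub>v (g *\<^sub>v x)"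
    using assms assoc_mult_mat_vec[OF assms] unfolding colsp_def by auto
  thus "w \<in> colsp M" using assms unfolding colsp_def by auto
qed

lemma colsp_mult_invertible:
  fixes M :: "'a::field mat"
  assumes M: "M \<in> carrier_mat N k" and g: "g \<in> carrier_mat k k" "det g \<noteq> 0"
  shows "colsp (M * g) = colsp M"
proof -
  obtain h where h: "h \<in> carrier_mat k k" "g * h = 1\<^sub>m k" using mat_inverse_exists[OF g] by blast
  have "M * g * h = M" using assoc_mult_mat[OF M g(1) h(1)] h(2) M by simp
  hence "colsp M \<subseteq> colsp (M * g)" using colsp_mult_subset[of "M * g" N k h k] M g h by simp
  thus ?thesis using colsp_mult_subset[OF M g(1)] by blast
qed

definition bilin :: "nat \<Rightarrow> 'a::field mat \<Rightarrow> 'a vec \<Rightarrow> 'a vec \<Rightarrow> 'a" where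
  "bilin N G u v = (\<Sum>a<N. \<Sum>b<N. u $ a * G $$ (a,b) * v $ b)"

lemma scalar_prod_bilin:
  assumes "G \<in> carrier_mat N N" "v \<in> carrier_vec N"
  shows "u \<bullet> (G *\<^sub>v v) = bilin N G u v"
  using assms unfolding bilin_def scalar_prod_def
  by (auto simp: scalar_prod_def sum_distrib_left lessThan_atLeast0 mult.assoc intro!: sum.cong)

text \<open>The vectors of minors from \<open>mult_adj_rowmat\<close> lie in the column space, and for one choice of
  rows the adjugate is invertible, so that they span it.  The condition thus becomes a system of
  polynomial equations in the minors.\<close>

lemma isotropic_iff_minors:
  fixes M M' :: "'a::field mat"
  assumes M: "frame N k M" and M': "frame N k' M'" and G: "G \<in> carrier_mat N N"
  shows "(\<forall>u\<in>colsp M. \<forall>v\<in>colsp M'. u \<bullet> (G *\<^sub>v v) = 0) \<longleftrightarrow>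
    (\<forall>r r' j j'. (\<forall>i<k. r i < N) \<and> (\<forall>i<k'. r' i < N) \<and> j < k \<and> j' < k' \<longrightarrow>
      (\<Sum>a<N. \<Sum>b<N. det (rowmat M k (r(j := a))) * G $$ (a,b) * det (rowmat M' k' (r'(j' := b)))) = 0)"
    (is "?L \<longleftrightarrow> ?R")
proof -
  note Mc = frame_carrier[OF M] frame_carrier[OF M']
  have key: "(\<Sum>a<N. \<Sum>b<N. det (rowmat M k (r(j := a))) * G $$ (a,b) * det (rowmat M' k' (r'(j' := b)))) =
      col (M * adj_mat (rowmat M k r)) j \<bullet> (G *\<^sub>v col (M' * adj_mat (rowmat M' k' r')) j')"
    if "j < k" "j' < k'" for r r' j j'
  proof -
    have a: "adj_mat (rowmat M k r) \<in> carrier_mat k k" "adj_mat (rowmat M' k' r') \<in> carrier_mat k' k'"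
      using adj_mat(1) rowmat_carrier by blast+
    have c: "col (M * adj_mat (rowmat M k r)) j $ a = det (rowmat M k (r(j := a)))"
      "col (M' * adj_mat (rowmat M' k' r')) j' $ a = det (rowmat M' k' (r'(j' := a)))" if "a < N" for a
      using mult_adj_rowmat[OF Mc(1) that \<open>j < k\<close>, of r] mult_adj_rowmat[OF Mc(2) that \<open>j' < k'\<close>, of r']
        that \<open>j < k\<close> \<open>j' < k'\<close> Mc a by simp_all
    have "col (M' * adj_mat (rowmat M' k' r')) j' \<in> carrier_vec N"
      by (rule carrier_vecI) (use carrier_matD(1)[OF Mc(2)] in \<open>simp only: dim_col index_mult_mat\<close>)
    from scalar_prod_bilin[OF G this] show ?thesis
      unfolding bilin_def by (simp only:) (intro sum.cong refl, simp only: lessThan_iff c)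
  qed
  have colin: "col (M * adj_mat (rowmat M k r)) j \<in> colsp M" if "j < k" "frame N k M" for M :: "'a mat" and k r j
  proof -
    have "adj_mat (rowmat M k r) \<in> carrier_mat k k" using adj_mat(1) rowmat_carrier by blast
    thus ?thesis using colsp_mult_subset[OF frame_carrier[OF that(2)]] col_in_colsp[of "M * adj_mat (rowmat M k r)" N k j]
        that frame_carrier[OF that(2)] by fastforce
  qed
  show ?thesis
  proof
    assume ?L
    thus ?R using key colin[OF _ M] colin[OF _ M'] by simp
  next
    assume R: ?R
    obtain r where r: "\<And>i. i < k \<Longrightarrow> r i < N" "det (rowmat M k r) \<noteq> 0"
      using frame_nonzero_minor[OF M] unfolding rowmat_def by blast
    obtain r' where r': "\<And>i. i < k' \<Longrightarrow> r' i < N" "det (rowmat M' k' r') \<noteq> 0"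
      using frame_nonzero_minor[OF M'] unfolding rowmat_def by blast
    define C where "C = M * adj_mat (rowmat M k r)"
    define C' where "C' = M' * adj_mat (rowmat M' k' r')"
    have adj: "adj_mat (rowmat M k r) \<in> carrier_mat k k" "adj_mat (rowmat M' k' r') \<in> carrier_mat k' k'"
      using adj_mat(1) rowmat_carrier by blast+
    have C: "C \<in> carrier_mat N k" "C' \<in> carrier_mat N k'" unfolding C_def C'_def using adj Mc by auto
    have detadj: "det (adj_mat A) \<noteq> 0" if "A \<in> carrier_mat n n" "det A \<noteq> 0" for A :: "'a mat" and n
    proof -
      have "det A * det (adj_mat A) = det A ^ n"
        using det_mult[OF that(1) adj_mat(1)[OF that(1)]] adj_mat(2)[OF that(1)] by simp
      thus ?thesis using that(2) by auto
    qed
    have eq: "colsp C = colsp M" "colsp C' = colsp M'"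
      unfolding C_def C'_def
      using colsp_mult_invertible[OF Mc(1) adj(1)] colsp_mult_invertible[OF Mc(2) adj(2)]
        detadj[OF rowmat_carrier r(2)] detadj[OF rowmat_carrier r'(2)] by auto
    have z: "transpose_mat C * (G * C') = 0\<^sub>m k k'"
    proof (rule eq_matI)
      fix i j assume "i < dim_row (0\<^sub>m k k' :: 'a mat)" "j < dim_col (0\<^sub>m k k' :: 'a mat)"
      hence i: "i < k" and j: "j < k'" by auto
      have "col C i \<bullet> (G *\<^sub>v col C' j) = 0"
        using R[rule_format, of r r' i j] key[OF i j, of r r'] r r' i j unfolding C_def C'_def by simp
      thus "(transpose_mat C * (G * C')) $$ (i,j) = 0\<^sub>m k k' $$ (i,j)"
        using i j C G by simp
    qed (use C G in auto)
    show ?L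
    proof (intro ballI)
      fix u v assume "u \<in> colsp M" "v \<in> colsp M'"
      hence "u \<in> colsp C" "v \<in> colsp C'" unfolding eq .
      then obtain x y where x: "x \<in> carrier_vec k" "u = C *\<^sub>v x" and y: "y \<in> carrier_vec k'" "v = C' *\<^sub>v y"
        using C unfolding colsp_def by auto
      define w where "w = G *\<^sub>v v"
      have w: "w \<in> carrier_vec N"
        unfolding w_def y(2) by (rule mult_mat_vec_carrier[OF G mult_mat_vec_carrier[OF C(2) y(1)]])
      have Cw: "transpose_mat C *\<^sub>v w \<in> carrier_vec k"
        using C(1) w by (intro mult_mat_vec_carrier[of _ k N]) simp_all
      have "u \<bullet> w = w \<bullet> (C *\<^sub>v x)"
        unfolding x(2) by (rule comm_scalar_prod[OF mult_mat_vec_carrier[OF C(1) x(1)] w])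
      also have "\<dots> = (transpose_mat C *\<^sub>v w) \<bullet> x"
        using transpose_vec_mult_scalar[OF C(1) x(1) w] by simp
      also have "\<dots> = x \<bullet> (transpose_mat C *\<^sub>v w)" by (rule comm_scalar_prod[OF Cw x(1)])
      finally have "u \<bullet> (G *\<^sub>v v) = x \<bullet> (transpose_mat C *\<^sub>v (G *\<^sub>v v))" unfolding w_def .
      also have "transpose_mat C *\<^sub>v (G *\<^sub>v v) = (transpose_mat C * (G * C')) *\<^sub>v y"
      proof -
        have GC: "G * C' \<in> carrier_mat N k'" and CT: "transpose_mat C \<in> carrier_mat k N" using G C by auto
        show ?thesis unfolding y(2) assoc_mult_mat_vec[OF G C(2) y(1), symmetric]
          assoc_mult_mat_vec[OF CT GC y(1)] ..
      qed
      also have "x \<bullet> \<dots> = 0" unfolding z using x(1) y(1) by (simp add: scalar_prod_def)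
      finally show "u \<bullet> (G *\<^sub>v v) = 0" .
    qed
  qed
qed

lemma vanishing_iff_minors:
  fixes M :: "'a::field mat"
  assumes M: "frame N k M" and i: "i < N"
  shows "(\<forall>u\<in>colsp M. u $ i = 0) \<longleftrightarrow>
    (\<forall>r j. (\<forall>a<k. r a < N) \<and> j < k \<longrightarrow> det (rowmat M k (r(j := i))) = 0)" (is "?L \<longleftrightarrow> ?R")
proof -
  note Mc = frame_carrier[OF M]
  have adj: "adj_mat (rowmat M k r) \<in> carrier_mat k k" for r using adj_mat(1) rowmat_carrier by blast
  have key: "det (rowmat M k (r(j := i))) = col (M * adj_mat (rowmat M k r)) j $ i" if "j < k" for r j
    using mult_adj_rowmat[OF Mc i that, of r] i that Mc adj[of r] by simp
  show ?thesis
  proof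
    assume L: ?L
    show ?R
    proof (intro allI impI)
      fix r j assume "(\<forall>a<k. r a < N) \<and> j < k"
      hence "col (M * adj_mat (rowmat M k r)) j \<in> colsp M"
        using colsp_mult_subset[OF Mc adj, of r] col_in_colsp[of "M * adj_mat (rowmat M k r)" N k j] Mc adj[of r]
        by auto
      thus "det (rowmat M k (r(j := i))) = 0" using L key \<open>(\<forall>a<k. r a < N) \<and> j < k\<close> by simp
    qed
  next
    assume R: ?R
    obtain r where r: "\<And>i. i < k \<Longrightarrow> r i < N" "det (rowmat M k r) \<noteq> 0"
      using frame_nonzero_minor[OF M] unfolding rowmat_def by blast
    define C where "C = M * adj_mat (rowmat M k r)"
    have C: "C \<in> carrier_mat N k" unfolding C_def using adj Mc by auto
    have row0: "row C i = 0\<^sub>v k"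
    proof (rule eq_vecI)
      fix j assume "j < dim_vec (0\<^sub>v k :: 'a vec)"
      hence j: "j < k" by simp
      have "col C j $ i = 0" using R[rule_format, of r j] r j key[OF j, of r] unfolding C_def by simp
      thus "row C i $ j = 0\<^sub>v k $ j" using i j C by simp
    qed (use C in auto)
    show ?L
    proof
      fix u assume "u \<in> colsp M"
      then obtain x where x: "x \<in> carrier_vec k" "u = M *\<^sub>v x" using Mc unfolding colsp_def by auto
      define y where "y = rowmat M k r *\<^sub>v x"
      have y: "y \<in> carrier_vec k" unfolding y_def using mult_mat_vec_carrier[OF rowmat_carrier x(1)] .
      have "C *\<^sub>v y = (M * (adj_mat (rowmat M k r) * rowmat M k r)) *\<^sub>v x"
        unfolding y_def assoc_mult_mat_vec[OF C rowmat_carrier x(1), symmetric]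
        unfolding C_def assoc_mult_mat[OF Mc adj rowmat_carrier] ..
      also have "\<dots> = det (rowmat M k r) \<cdot>\<^sub>v u"
        unfolding x(2) adj_mat(3)[OF rowmat_carrier]
        mult_smult_distrib[OF Mc one_carrier_mat] using Mc x(1) by (intro eq_vecI) auto
      finally have "(C *\<^sub>v y) $ i = det (rowmat M k r) * u $ i" using i x Mc by simp
      moreover have "(C *\<^sub>v y) $ i = 0" using i C row0 y by simp
      ultimately show "u $ i = 0" using r(2) by simp
    qed
  qed
qed

section \<open>Pluecker coordinates and the Zariski topology\<close>

definition pcoord :: "nat \<Rightarrow> (nat \<Rightarrow> nat) \<Rightarrow> nat \<Rightarrow> (nat \<Rightarrow> complex mat) \<Rightarrow> coords" where
  "pcoord N d s M = (\<lambda>l I. if l \<in> {1..s} \<and> I \<subseteq> {..<N} \<and> card I = d l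
             then det (submatrix (M l) I UNIV) else 0)"

lemma Gr_prodD: "U \<in> Gr_prod N d s \<Longrightarrow> l \<in> {1..s} \<Longrightarrow> U l \<in> Gr N (d l)"
  unfolding Gr_prod_def by auto

lemma Gr_prod_ext: "U \<in> Gr_prod N d s \<Longrightarrow> U \<in> extensional {1..s}"
  unfolding Gr_prod_def by (simp add: PiE_iff)

lemma Gr_prodI:
  assumes "U \<in> extensional {1..s}" "\<And>l. l \<in> {1..s} \<Longrightarrow> U l \<in> Gr N (d l)"
  shows "U \<in> Gr_prod N d s"
  using assms unfolding Gr_prod_def by (simp add: PiE_iff)

lemma pluecker_iff:
  "x \<in> pluecker N d s U \<longleftrightarrow> (\<exists>M. x = pcoord N d s M \<and>
     (\<forall>l\<in>{1..s}. M l \<in> carrier_mat N (d l) \<and> colsp (M l) = U l))"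
  unfolding pluecker_def pcoord_def mem_Collect_eq
  by (rule ex_cong1, rule conj_cong, rule refl, rule ball_cong, rule refl, rule conj_cong, rule refl)
    (simp add: col_space_eq_colsp)

lemma plueckerE:
  assumes "U \<in> Gr_prod N d s" "x \<in> pluecker N d s U"
  obtains M where "x = pcoord N d s M" "\<And>l. l \<in> {1..s} \<Longrightarrow> frame N (d l) (M l)"
    "\<And>l. l \<in> {1..s} \<Longrightarrow> colsp (M l) = U l"
  using assms Gr_frame[OF Gr_prodD[OF assms(1)]] unfolding pluecker_iff by metis

lemma plueckerI:
  assumes "\<And>l. l \<in> {1..s} \<Longrightarrow> M l \<in> carrier_mat N (d l)" "\<And>l. l \<in> {1..s} \<Longrightarrow> colsp (M l) = U l"
  shows "pcoord N d s M \<in> pluecker N d s U"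
  using assms unfolding pluecker_iff by blast

lemma pluecker_nonempty:
  assumes "U \<in> Gr_prod N d s"
  obtains x where "x \<in> pluecker N d s U"
proof -
  have "\<forall>l. \<exists>M. l \<in> {1..s} \<longrightarrow> frame N (d l) M \<and> colsp M = U l"
    using Gr_frameE[OF Gr_prodD[OF assms]] by metis
  then obtain M where "\<And>l. l \<in> {1..s} \<Longrightarrow> frame N (d l) (M l) \<and> colsp (M l) = U l" by metis
  thus ?thesis using that plueckerI[of s M N d U] frame_carrier by blast
qed

lemma det_submatrix_mult:
  fixes M :: "'a::field mat"
  assumes "M \<in> carrier_mat N k" "g \<in> carrier_mat k k" "I \<subseteq> {..<N}" "card I = k"
  shows "det (submatrix (M * g) I UNIV) = det g * det (submatrix M I UNIV)"
proof -
  have "rowmat (M * g) k (pick I) = rowmat M k (pick I) * g"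
    by (rule rowmat_mult[OF assms(1,2)]) (use pick_lt[OF assms(3)] assms(4) in auto)
  thus ?thesis
    using submatrix_rowmat[OF assms(1,3,4)] submatrix_rowmat[of "M * g" N k I] assms
      det_mult[OF rowmat_carrier assms(2)] by simp
qed

lemma pluecker_unique:
  assumes U: "U \<in> Gr_prod N d s" and x: "x \<in> pluecker N d s U" and x': "x' \<in> pluecker N d s U"
  obtains c where "\<And>l. c l \<noteq> (0::complex)" "\<And>l I. x' l I = c l * x l I"
proof -
  obtain M where M: "x = pcoord N d s M" "\<And>l. l \<in> {1..s} \<Longrightarrow> frame N (d l) (M l)"
    "\<And>l. l \<in> {1..s} \<Longrightarrow> colsp (M l) = U l" using plueckerE[OF U x] by blast
  obtain M' where M': "x' = pcoord N d s M'" "\<And>l. l \<in> {1..s} \<Longrightarrow> frame N (d l) (M' l)"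
    "\<And>l. l \<in> {1..s} \<Longrightarrow> colsp (M' l) = U l" using plueckerE[OF U x'] by blast
  have "\<exists>g. l \<in> {1..s} \<longrightarrow> g \<in> carrier_mat (d l) (d l) \<and> M' l = M l * g \<and> det g \<noteq> 0" for l
  proof (cases "l \<in> {1..s}")
    case True
    show ?thesis using frame_change[OF M(2)[OF True] frame_carrier[OF M'(2)[OF True]]] M(3) M'(3) True by metis
  qed auto
  then obtain g where g: "\<And>l. l \<in> {1..s} \<Longrightarrow> g l \<in> carrier_mat (d l) (d l) \<and> M' l = M l * g l \<and> det (g l) \<noteq> 0"
    by metis
  show ?thesis
  proof (rule that[of "\<lambda>l. if l \<in> {1..s} then det (g l) else 1"])
    fix l I
    show "x' l I = (if l \<in> {1..s} then det (g l) else 1) * x l I"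
      unfolding M(1) M'(1) pcoord_def
      using g[of l] det_submatrix_mult[OF frame_carrier[OF M(2)]] by auto
  qed (use g in auto)
qed

text \<open>Any scalars are realized by scaling the first column of each basis; this needs a column.\<close>

lemma pluecker_rescale:
  assumes U: "U \<in> Gr_prod N d s" and x: "x \<in> pluecker N d s U"
    and c: "\<And>l. c l \<noteq> (0::complex)" and d: "\<And>l. l \<in> {1..s} \<Longrightarrow> 1 \<le> d l"
  shows "(\<lambda>l I. c l * x l I) \<in> pluecker N d s U"
proof -
  obtain M where M: "x = pcoord N d s M" "\<And>l. l \<in> {1..s} \<Longrightarrow> frame N (d l) (M l)"
    "\<And>l. l \<in> {1..s} \<Longrightarrow> colsp (M l) = U l" using plueckerE[OF U x] by blast
  define g where "g = (\<lambda>l. multrow_mat (d l) 0 (c l))"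
  have g: "g l \<in> carrier_mat (d l) (d l)" for l unfolding g_def by simp
  have dg: "det (g l) = c l" if "l \<in> {1..s}" for l
    using det_multrow_mat[of 0 "d l" "c l"] d[OF that] unfolding g_def by simp
  have "(\<lambda>l I. c l * x l I) = pcoord N d s (\<lambda>l. M l * g l)"
    unfolding M(1) pcoord_def using det_submatrix_mult[OF frame_carrier[OF M(2)] g] dg
    by (auto simp: fun_eq_iff)
  moreover have "pcoord N d s (\<lambda>l. M l * g l) \<in> pluecker N d s U"
  proof (rule plueckerI)
    fix l assume l: "l \<in> {1..s}"
    show "M l * g l \<in> carrier_mat N (d l)"
      by (rule mult_carrier_mat[OF frame_carrier[OF M(2)[OF l]] g])
    show "colsp (M l * g l) = U l"
      using colsp_mult_invertible[OF frame_carrier[OF M(2)[OF l]] g] dg[OF l] c M(3)[OF l] by simp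
  qed
  ultimately show ?thesis by simp
qed

lemma multihom_cmult:
  assumes "multihom s e F"
  shows "multihom s e (\<lambda>x. c * F x)"
  using multihom.mult[OF multihom.const[of s c] assms] by simp

lemma multihom_sum:
  assumes "finite A" "A \<noteq> {}" "\<And>a. a \<in> A \<Longrightarrow> multihom s e (F a)"
  shows "multihom s e (\<lambda>x. \<Sum>a\<in>A. F a x)"
  using assms by (induction A rule: finite_ne_induct) (auto intro: multihom.add)

lemma multihom_scale:
  assumes "multihom s e F" "\<And>l I. l \<in> {1..s} \<Longrightarrow> x' l I = c l * x l I"
  shows "F x' = (\<Prod>l\<in>{1..s}. c l ^ e l) * F x"
  using assms(1)
proof induction
  case (var l I)
  have "(\<Prod>k\<in>{1..s}. c k ^ (if k = l then 1 else 0)) = (\<Prod>k\<in>{1..s}. if k = l then c l else 1)"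
    by (intro prod.cong) auto
  thus ?case using var assms(2) by simp
qed (auto simp: algebra_simps power_add prod.distrib)

text \<open>Whether a multihomogeneous polynomial vanishes at a point can be tested on any one system of
  coordinates.\<close>

lemma multihom_zero_iff:
  assumes "multihom s e F" "U \<in> Gr_prod N d s" "x \<in> pluecker N d s U" "x' \<in> pluecker N d s U"
  shows "F x = 0 \<longleftrightarrow> F x' = 0"
proof -
  obtain c where c: "\<And>l. c l \<noteq> (0::complex)" "\<And>l I. x' l I = c l * x l I"
    using pluecker_unique[OF assms(2-4)] by blast
  have "F x' = (\<Prod>l\<in>{1..s}. c l ^ e l) * F x" using multihom_scale[OF assms(1) c(2)] .
  moreover have "(\<Prod>l\<in>{1..s}. c l ^ e l) \<noteq> 0" using c(1) by simp
  ultimately show ?thesis by (simp only: mult_eq_0_iff) simp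
qed

definition nonvanishing :: "nat \<Rightarrow> (nat \<Rightarrow> nat) \<Rightarrow> nat \<Rightarrow> (coords \<Rightarrow> complex) \<Rightarrow> point set" where
  "nonvanishing N d s F = {U \<in> Gr_prod N d s. \<forall>x\<in>pluecker N d s U. F x \<noteq> 0}"

lemma zariski_eq: "zariski N d s = topology_generated_by {nonvanishing N d s F | e F. multihom s e F}"
  unfolding zariski_def nonvanishing_def by simp

lemma openin_nonvanishing: "multihom s e F \<Longrightarrow> openin (zariski N d s) (nonvanishing N d s F)"
  unfolding zariski_eq by (rule topology_generated_by_Basis) blast

lemma topspace_zariski: "topspace (zariski N d s) = Gr_prod N d s"
proof -
  have "nonvanishing N d s (\<lambda>_. 1) = Gr_prod N d s" unfolding nonvanishing_def by auto
  moreover have "multihom s (\<lambda>_. 0) (\<lambda>_. 1)" by (rule multihom.const)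
  ultimately have "Gr_prod N d s \<in> {nonvanishing N d s F | e F. multihom s e F}" by force
  moreover have "nonvanishing N d s F \<subseteq> Gr_prod N d s" for F unfolding nonvanishing_def by auto
  ultimately show ?thesis unfolding zariski_eq topology_generated_by_topspace by blast
qed

text \<open>The product of two polynomials is nonzero exactly where both are, so the generating sets are
  closed under intersection.\<close>

lemma zariski_base:
  assumes "openin (zariski N d s) T" "p \<in> T"
  obtains e F where "multihom s e F" "p \<in> nonvanishing N d s F" "nonvanishing N d s F \<subseteq> T"
proof -
  have "generate_topology_on {nonvanishing N d s F | e F. multihom s e F} T"
    using assms(1) unfolding zariski_eq openin_topology_generated_by_iff .
  hence "\<forall>p\<in>T. \<exists>e F. multihom s e F \<and> p \<in> nonvanishing N d s F \<and> nonvanishing N d s F \<subseteq> T"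
  proof induction
    case (Int a b)
    show ?case
    proof
      fix p assume p: "p \<in> a \<inter> b"
      obtain e F where F: "multihom s e F" "p \<in> nonvanishing N d s F" "nonvanishing N d s F \<subseteq> a"
        using Int.IH(1) p by blast
      obtain e' F' where F': "multihom s e' F'" "p \<in> nonvanishing N d s F'" "nonvanishing N d s F' \<subseteq> b"
        using Int.IH(2) p by blast
      have "nonvanishing N d s (\<lambda>x. F x * F' x) = nonvanishing N d s F \<inter> nonvanishing N d s F'"
        unfolding nonvanishing_def by auto
      thus "\<exists>e F. multihom s e F \<and> p \<in> nonvanishing N d s F \<and> nonvanishing N d s F \<subseteq> a \<inter> b"
        using multihom.mult[OF F(1) F'(1)] F F' by (metis (no_types, lifting) Int_iff Int_mono)
    qed
  next
    case (UN K)
    thus ?case by (meson Union_iff Union_upper subset_trans)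
  qed auto
  thus ?thesis using assms(2) that by blast
qed

lemma closedin_zero_locus:
  assumes "\<And>F. F \<in> \<F> \<Longrightarrow> \<exists>e. multihom s e F"
  shows "closedin (zariski N d s) {U \<in> Gr_prod N d s. \<forall>F\<in>\<F>. \<forall>x\<in>pluecker N d s U. F x = 0}"
proof -
  have "Gr_prod N d s - {U \<in> Gr_prod N d s. \<forall>F\<in>\<F>. \<forall>x\<in>pluecker N d s U. F x = 0}
      = \<Union> (nonvanishing N d s ` \<F>)"
  proof (intro equalityI subsetI)
    fix U assume "U \<in> Gr_prod N d s - {U \<in> Gr_prod N d s. \<forall>F\<in>\<F>. \<forall>x\<in>pluecker N d s U. F x = 0}"
    then obtain F x where F: "F \<in> \<F>" "U \<in> Gr_prod N d s" "x \<in> pluecker N d s U" "F x \<noteq> 0" by auto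
    obtain e where "multihom s e F" using assms F(1) by blast
    hence "U \<in> nonvanishing N d s F" unfolding nonvanishing_def
      using multihom_zero_iff F(2,3,4) by blast
    thus "U \<in> \<Union> (nonvanishing N d s ` \<F>)" using F(1) by blast
  next
    fix U assume "U \<in> \<Union> (nonvanishing N d s ` \<F>)"
    then obtain F where F: "F \<in> \<F>" "U \<in> Gr_prod N d s" "\<forall>x\<in>pluecker N d s U. F x \<noteq> 0"
      unfolding nonvanishing_def by auto
    obtain x where "x \<in> pluecker N d s U" using pluecker_nonempty[OF F(2)] .
    thus "U \<in> Gr_prod N d s - {U \<in> Gr_prod N d s. \<forall>F\<in>\<F>. \<forall>x\<in>pluecker N d s U. F x = 0}"
      using F by blast
  qed
  moreover have "openin (zariski N d s) (\<Union> (nonvanishing N d s ` \<F>))"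
    using assms openin_nonvanishing by (intro openin_Union) blast
  ultimately show ?thesis unfolding closedin_def topspace_zariski by auto
qed

section \<open>Closed conditions\<close>

lemma minor_multihom:
  assumes l: "l \<in> {1..s}" and r: "\<And>i. i < d l \<Longrightarrow> r i < N"
  obtains F where "multihom s (\<lambda>k. if k = l then 1 else 0) F"
    "\<And>M. M l \<in> carrier_mat N (d l) \<Longrightarrow> F (pcoord N d s M) = det (rowmat (M l) (d l) r)"
proof -
  obtain c :: complex where c0: "inj_on r {..<d l} \<longrightarrow> c \<noteq> 0"
    and c: "\<And>M. M \<in> carrier_mat N (d l) \<Longrightarrow> det (rowmat M (d l) r) = c * det (submatrix M (r ` {..<d l}) UNIV)"
    using det_rowmat_minor[of "d l" r N] r by blast
  define F where "F = (\<lambda>x::coords. (if inj_on r {..<d l} then c else 0) * x l (r ` {..<d l}))"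
  have "multihom s (\<lambda>k. if k = l then 1 else 0) F" unfolding F_def
    by (intro multihom_cmult multihom.var l)
  moreover have "F (pcoord N d s M) = det (rowmat (M l) (d l) r)" if M: "M l \<in> carrier_mat N (d l)" for M
  proof (cases "inj_on r {..<d l}")
    case True
    thus ?thesis using c[OF M] l r card_image[OF True] unfolding F_def pcoord_def by auto
  next
    case False
    then obtain a b where ab: "a < d l" "b < d l" "a \<noteq> b" "r a = r b" unfolding inj_on_def by auto
    have "row (rowmat (M l) (d l) r) a = row (rowmat (M l) (d l) r) b"
      using ab unfolding rowmat_def by (intro eq_vecI) auto
    hence "det (rowmat (M l) (d l) r) = 0" by (rule det_identical_rows[OF rowmat_carrier ab(3,1,2)])
    thus ?thesis using False unfolding F_def by simp
  qed
  ultimately show ?thesis using that by blast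
qed

lemma closedin_isotropic:
  assumes l: "l \<in> {1..s}" "l' \<in> {1..s}" and G: "G \<in> carrier_mat N N" and N: "0 < N"
  shows "closedin (zariski N d s) {U \<in> Gr_prod N d s. \<forall>u\<in>U l. \<forall>v\<in>U l'. u \<bullet> (G *\<^sub>v v) = 0}"
proof -
  have "\<forall>l r. \<exists>F. l \<in> {1..s} \<and> (\<forall>i<d l. r i < N) \<longrightarrow> multihom s (\<lambda>k. if k = l then 1 else 0) F \<and>
      (\<forall>M. M l \<in> carrier_mat N (d l) \<longrightarrow> F (pcoord N d s M) = det (rowmat (M l) (d l) r))"
    using minor_multihom by metis
  then obtain F where F: "\<And>l r. l \<in> {1..s} \<and> (\<forall>i<d l. r i < N) \<longrightarrow> multihom s (\<lambda>k. if k = l then 1 else 0) (F l r) \<and>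
      (\<forall>M. M l \<in> carrier_mat N (d l) \<longrightarrow> F l r (pcoord N d s M) = det (rowmat (M l) (d l) r))"
    by metis
  define pl where "pl = (\<lambda>x l r. F l r x)"
  have mh: "multihom s (\<lambda>k. if k = l then 1 else 0) (\<lambda>x. pl x l r)"
    if "l \<in> {1..s}" "\<And>i. i < d l \<Longrightarrow> r i < N" for l r
    using F[of l r] that unfolding pl_def by auto
  have pl: "pl (pcoord N d s M) l r = det (rowmat (M l) (d l) r)"
    if "l \<in> {1..s}" "M l \<in> carrier_mat N (d l)" "\<And>i. i < d l \<Longrightarrow> r i < N" for M l r
    using F[of l r] that unfolding pl_def by auto
  \<comment> \<open>The value of the form on two of the vectors of minors.\<close>
  define PP where "PP = (\<lambda>(r,r',j,j') (x::coords). \<Sum>a<N. \<Sum>b<N. pl x l (r(j := a)) * G $$ (a,b) * pl x l' (r'(j' := b)))"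
  define Ind where "Ind = {(r,r',j,j'). (\<forall>i<d l. r i < N) \<and> (\<forall>i<d l'. r' i < N) \<and> j < d l \<and> j' < d l'}"
  have eq: "(\<forall>u\<in>U l. \<forall>v\<in>U l'. u \<bullet> (G *\<^sub>v v) = 0) \<longleftrightarrow> (\<forall>F\<in>PP ` Ind. \<forall>x\<in>pluecker N d s U. F x = 0)"
    if U: "U \<in> Gr_prod N d s" for U
  proof -
    have "(\<forall>u\<in>U l. \<forall>v\<in>U l'. u \<bullet> (G *\<^sub>v v) = 0) \<longleftrightarrow> (\<forall>F\<in>PP ` Ind. F x = 0)"
      if x: "x \<in> pluecker N d s U" for x
    proof -
      obtain M where M: "x = pcoord N d s M" "\<And>l. l \<in> {1..s} \<Longrightarrow> frame N (d l) (M l)"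
        "\<And>l. l \<in> {1..s} \<Longrightarrow> colsp (M l) = U l" using plueckerE[OF U x] by blast
      have "PP (r,r',j,j') x = (\<Sum>a<N. \<Sum>b<N. det (rowmat (M l) (d l) (r(j := a))) * G $$ (a,b) *
          det (rowmat (M l') (d l') (r'(j' := b))))" if "(r,r',j,j') \<in> Ind" for r r' j j'
      proof -
        have "pl x l (r(j := a)) = det (rowmat (M l) (d l) (r(j := a)))" if "a < N" for a
          unfolding M(1) using that \<open>(r,r',j,j') \<in> Ind\<close> unfolding Ind_def
          by (intro pl[where l = l and M = M, OF l(1) frame_carrier[OF M(2)[OF l(1)]]]) auto
        moreover have "pl x l' (r'(j' := a)) = det (rowmat (M l') (d l') (r'(j' := a)))" if "a < N" for a
          unfolding M(1) using that \<open>(r,r',j,j') \<in> Ind\<close> unfolding Ind_def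
          by (intro pl[where l = l' and M = M, OF l(2) frame_carrier[OF M(2)[OF l(2)]]]) auto
        ultimately show ?thesis unfolding PP_def prod.case by (intro sum.cong refl) (simp only: lessThan_iff)
      qed
      thus ?thesis
        unfolding M(3)[OF l(1), symmetric] M(3)[OF l(2), symmetric]
          isotropic_iff_minors[OF M(2)[OF l(1)] M(2)[OF l(2)] G] Ind_def by auto
    qed
    thus ?thesis using pluecker_nonempty[OF U] by metis
  qed
  have "\<exists>e. multihom s e F" if F: "F \<in> PP ` Ind" for F
  proof -
    obtain r r' j j' where F: "F = PP (r,r',j,j')" and ind: "(r,r',j,j') \<in> Ind" using F by auto
    have "multihom s (\<lambda>k. (if k = l then 1 else 0) + (if k = l' then 1 else 0)) F"
      unfolding F PP_def prod.case
    proof (intro multihom_sum)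
      fix a b assume ab: "a \<in> {..<N}" "b \<in> {..<N}"
      have "multihom s (\<lambda>k. (if k = l then 1 else 0) + (if k = l' then 1 else 0))
          (\<lambda>x. (G $$ (a,b) * pl x l (r(j := a))) * pl x l' (r'(j' := b)))"
        using ab ind unfolding Ind_def by (intro multihom.mult multihom_cmult mh l) auto
      thus "multihom s (\<lambda>k. (if k = l then 1 else 0) + (if k = l' then 1 else 0))
          (\<lambda>x. pl x l (r(j := a)) * G $$ (a,b) * pl x l' (r'(j' := b)))" by (simp add: mult.commute)
    qed (use N in auto)
    thus ?thesis by blast
  qed
  note deg = this
  have "{U \<in> Gr_prod N d s. \<forall>u\<in>U l. \<forall>v\<in>U l'. u \<bullet> (G *\<^sub>v v) = 0} =
      {U \<in> Gr_prod N d s. \<forall>F\<in>PP ` Ind. \<forall>x\<in>pluecker N d s U. F x = 0}"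
    by (rule Collect_cong, rule conj_cong, rule refl, rule eq)
  thus ?thesis by (simp only:) (rule closedin_zero_locus, rule deg, assumption)
qed

lemma closedin_vanishing:
  assumes l: "l \<in> {1..s}" and a: "a < N"
  shows "closedin (zariski N d s) {U \<in> Gr_prod N d s. \<forall>u\<in>U l. u $ a = 0}"
proof -
  define \<F> where "\<F> = {F. multihom s (\<lambda>k. if k = l then 1 else 0) F \<and> (\<exists>r j. (\<forall>i<d l. r i < N) \<and> j < d l \<and>
    (\<forall>M. M l \<in> carrier_mat N (d l) \<longrightarrow> F (pcoord N d s M) = det (rowmat (M l) (d l) (r(j := a)))))}"
  have ex: "\<exists>F\<in>\<F>. \<forall>M. M l \<in> carrier_mat N (d l) \<longrightarrow> F (pcoord N d s M) = det (rowmat (M l) (d l) (r(j := a)))"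
    if "\<forall>i<d l. r i < N" "j < d l" for r j
  proof -
    have "\<And>i. i < d l \<Longrightarrow> (r(j := a)) i < N" using that a by auto
    from minor_multihom[of l s d "r(j := a)" N, OF l this] obtain F where
      "multihom s (\<lambda>k. if k = l then 1 else 0) F"
      "\<And>M. M l \<in> carrier_mat N (d l) \<Longrightarrow> F (pcoord N d s M) = det (rowmat (M l) (d l) (r(j := a)))" by blast
    thus ?thesis using that unfolding \<F>_def by blast
  qed
  have eq: "(\<forall>u\<in>U l. u $ a = 0) \<longleftrightarrow> (\<forall>F\<in>\<F>. \<forall>x\<in>pluecker N d s U. F x = 0)"
    if U: "U \<in> Gr_prod N d s" for U
  proof -
    have "(\<forall>u\<in>U l. u $ a = 0) \<longleftrightarrow> (\<forall>F\<in>\<F>. F x = 0)" if x: "x \<in> pluecker N d s U" for x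
    proof -
      obtain M where M: "x = pcoord N d s M" "\<And>l. l \<in> {1..s} \<Longrightarrow> frame N (d l) (M l)"
        "\<And>l. l \<in> {1..s} \<Longrightarrow> colsp (M l) = U l" using plueckerE[OF U x] by blast
      have "(\<forall>F\<in>\<F>. F x = 0) \<longleftrightarrow>
          (\<forall>r j. (\<forall>i<d l. r i < N) \<and> j < d l \<longrightarrow> det (rowmat (M l) (d l) (r(j := a))) = 0)"
        (is "?A \<longleftrightarrow> ?B")
      proof
        assume ?A
        thus ?B using ex frame_carrier[OF M(2)[OF l]] M(1) by metis
      next
        assume B: ?B
        show ?A
        proof
          fix F assume "F \<in> \<F>"
          then obtain r j where "\<forall>i<d l. r i < N" "j < d l"
            "F (pcoord N d s M) = det (rowmat (M l) (d l) (r(j := a)))"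
            unfolding \<F>_def using frame_carrier[OF M(2)[OF l]] by blast
          thus "F x = 0" using B M(1) by simp
        qed
      qed
      thus ?thesis unfolding M(3)[OF l, symmetric] vanishing_iff_minors[OF M(2)[OF l] a] by simp
    qed
    thus ?thesis using pluecker_nonempty[OF U] by metis
  qed
  have "\<exists>e. multihom s e F" if "F \<in> \<F>" for F using that unfolding \<F>_def by blast
  note deg = this
  have "{U \<in> Gr_prod N d s. \<forall>u\<in>U l. u $ a = 0} =
      {U \<in> Gr_prod N d s. \<forall>F\<in>\<F>. \<forall>x\<in>pluecker N d s U. F x = 0}"
    by (rule Collect_cong, rule conj_cong, rule refl, rule eq)
  thus ?thesis by (simp only:) (rule closedin_zero_locus, rule deg, assumption)
qed

section \<open>Morphisms induced by linear maps of coordinates\<close>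

definition coord_subst :: "(nat \<Rightarrow> nat set \<Rightarrow> complex) \<Rightarrow> (nat \<Rightarrow> nat set \<Rightarrow> nat set) \<Rightarrow> coords \<Rightarrow> coords" where
  "coord_subst c J x = (\<lambda>l I. c l I * x l (J l I))"

lemma multihom_coord_subst:
  "multihom s e F \<Longrightarrow> multihom s e (\<lambda>x. F (coord_subst c J x))"
proof (induction rule: multihom.induct)
  case (var l I)
  show ?case unfolding coord_subst_def by (intro multihom_cmult multihom.var var)
qed (auto intro: multihom.intros)

text \<open>Pulling back along the substitution turns the nonvanishing loci and the local fractions on \<open>Y\<close>
  into those on \<open>X\<close>, degrees included.\<close>

lemma morphism_coord_subst:
  assumes X: "X \<subseteq> Gr_prod N d s" and Y: "Y \<subseteq> Gr_prod N' d' s" and f: "f ` X \<subseteq> Y"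
    and L: "\<And>p x. p \<in> X \<Longrightarrow> x \<in> pluecker N d s p \<Longrightarrow> coord_subst c J x \<in> pluecker N' d' s (f p)"
  shows "morphism N d s X N' d' s Y f"
proof -
  let ?S = "subtopology (zariski N d s) X"
  let ?T = "subtopology (zariski N' d' s) Y"
  have nv: "{p \<in> X. f p \<in> nonvanishing N' d' s F} = X \<inter> nonvanishing N d s (\<lambda>x. F (coord_subst c J x))"
    if F: "multihom s e F" for e F
  proof -
    have "f p \<in> nonvanishing N' d' s F \<longleftrightarrow> p \<in> nonvanishing N d s (\<lambda>x. F (coord_subst c J x))" if p: "p \<in> X" for p
    proof -
      have pG: "p \<in> Gr_prod N d s" "f p \<in> Gr_prod N' d' s" using p X Y f by auto
      obtain x where x: "x \<in> pluecker N d s p" using pluecker_nonempty[OF pG(1)] .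
      have "f p \<in> nonvanishing N' d' s F \<longleftrightarrow> F (coord_subst c J x) \<noteq> 0"
        using multihom_zero_iff[OF F pG(2) L[OF p x]] L[OF p x] pG unfolding nonvanishing_def by blast
      also have "\<dots> \<longleftrightarrow> p \<in> nonvanishing N d s (\<lambda>x. F (coord_subst c J x))"
        using multihom_zero_iff[OF multihom_coord_subst[OF F] pG(1) x] x pG unfolding nonvanishing_def by blast
      finally show ?thesis .
    qed
    thus ?thesis by auto
  qed
  have cont: "continuous_map ?S ?T f"
  proof -
    have "continuous_map ?S (zariski N' d' s) f"
      unfolding zariski_eq[of N' d' s]
    proof (rule continuous_on_generated_topo)
      fix U assume "U \<in> {nonvanishing N' d' s F |e F. multihom s e F}"
      then obtain e F where F: "multihom s e F" "U = nonvanishing N' d' s F" by blast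
      have "f -` U \<inter> topspace ?S = X \<inter> nonvanishing N d s (\<lambda>x. F (coord_subst c J x))"
        using nv[OF F(1)] X unfolding F(2) topspace_subtopology topspace_zariski by auto
      thus "openin ?S (f -` U \<inter> topspace ?S)"
        using openin_subtopology_Int2[OF openin_nonvanishing[OF multihom_coord_subst[OF F(1)]]] by metis
    next
      show "f ` topspace ?S \<subseteq> \<Union> {nonvanishing N' d' s F |e F. multihom s e F}"
        using f Y topspace_zariski[of N' d' s]
        unfolding topspace_subtopology zariski_eq[of N' d' s] topology_generated_by_topspace by blast
    qed
    thus ?thesis using f by (auto simp: continuous_map_in_subtopology topspace_subtopology)
  qed
  have "regular_on N d s X {p \<in> X. f p \<in> \<Omega>} (g \<circ> f)"
    if \<Omega>: "openin ?T \<Omega>" and g: "regular_on N' d' s Y \<Omega> g" for \<Omega> g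
    unfolding regular_on_def
  proof
    fix p assume p: "p \<in> {p \<in> X. f p \<in> \<Omega>}"
    hence "f p \<in> \<Omega>" by simp
    from bspec[OF g[unfolded regular_on_def] this] obtain \<Omega>' e F G where O: "openin ?T \<Omega>'" "f p \<in> \<Omega>'" "\<Omega>' \<subseteq> \<Omega>" "multihom s e F" "multihom s e G"
      and q: "\<forall>q\<in>\<Omega>'. \<forall>x\<in>pluecker N' d' s q. G x \<noteq> 0 \<and> g q = F x / G x"
      by (elim exE conjE) (rule that; assumption)
    have "openin ?S {p \<in> topspace ?S. f p \<in> \<Omega>'}" using cont O(1) by (rule openin_continuous_map_preimage)
    moreover have "topspace ?S = X" using X by (auto simp: topspace_zariski)
    ultimately have op: "openin ?S {p \<in> X. f p \<in> \<Omega>'}" by (simp only:)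
    have fr: "\<forall>q\<in>{p \<in> X. f p \<in> \<Omega>'}. \<forall>x\<in>pluecker N d s q.
        G (coord_subst c J x) \<noteq> 0 \<and> (g \<circ> f) q = F (coord_subst c J x) / G (coord_subst c J x)"
      using q L by auto
    show "\<exists>\<Omega>'. openin ?S \<Omega>' \<and> p \<in> \<Omega>' \<and> \<Omega>' \<subseteq> {p \<in> X. f p \<in> \<Omega>} \<and>
       (\<exists>e F G. multihom s e F \<and> multihom s e G \<and>
          (\<forall>q\<in>\<Omega>'. \<forall>x\<in>pluecker N d s q. G x \<noteq> 0 \<and> (g \<circ> f) q = F x / G x))"
    proof (intro exI[of _ "{p \<in> X. f p \<in> \<Omega>'}"] conjI)
      show "\<exists>e F G. multihom s e F \<and> multihom s e G \<and>
          (\<forall>q\<in>{p \<in> X. f p \<in> \<Omega>'}. \<forall>x\<in>pluecker N d s q. G x \<noteq> 0 \<and> (g \<circ> f) q = F x / G x)"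
        using multihom_coord_subst[OF O(4), of c J] multihom_coord_subst[OF O(5), of c J] fr
        by (intro exI[of _ e] exI[of _ "\<lambda>x. F (coord_subst c J x)"] exI[of _ "\<lambda>x. G (coord_subst c J x)"] conjI)
    qed (use op p O(2,3) in auto)
  qed
  thus ?thesis unfolding morphism_def using cont by blast
qed

section \<open>Limits of curves\<close>

lemma continuous_det:
  fixes A :: "complex \<Rightarrow> complex mat"
  assumes "\<And>t. A t \<in> carrier_mat k k" "\<And>i j. i < k \<Longrightarrow> j < k \<Longrightarrow> isCont (\<lambda>t. A t $$ (i,j)) t0"
  shows "isCont (\<lambda>t. det (A t)) t0"
proof -
  have "det (A t) = (\<Sum>p\<in>{p. p permutes {0..<k}}. signof p * (\<Prod>i\<in>{0..<k}. A t $$ (i, p i)))" for t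
    using det_def'[OF assms(1)] by simp
  moreover have "isCont (\<lambda>t. \<Sum>p\<in>{p. p permutes {0..<k}}. signof p * (\<Prod>i\<in>{0..<k}. A t $$ (i, p i))) t0"
  proof (intro continuous_intros assms(2))
    fix p i assume "p \<in> {p. p permutes {0..<k}}" "i \<in> {0..<k}"
    thus "p i < k" "i < k" using permutes_in_image[of p "{0..<k}" i] by auto
  qed
  ultimately show ?thesis by simp
qed

lemma continuous_multihom:
  assumes "multihom s e F" "\<And>l I. isCont (\<lambda>t. x t l I) (t0::complex)"
  shows "isCont (\<lambda>t. F (x t)) t0"
  using assms(1) by induction (auto intro!: continuous_intros assms(2))

text \<open>A polynomial that is nonzero at time \<open>0\<close> is nonzero at some other time, because its value along the
  curve is continuous; but on \<open>C\<close> the polynomials separating the limit from \<open>C\<close> vanish.\<close>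

lemma limit_in_closed:
  fixes M :: "complex \<Rightarrow> nat \<Rightarrow> complex mat"
  assumes C: "closedin (zariski N d s) C" and U: "U 0 \<in> Gr_prod N d s"
    and M: "\<And>t l. l \<in> {1..s} \<Longrightarrow> M t l \<in> carrier_mat N (d l)"
    and MU: "\<And>t l. l \<in> {1..s} \<Longrightarrow> colsp (M t l) = U t l"
    and cont: "\<And>l i j. l \<in> {1..s} \<Longrightarrow> i < N \<Longrightarrow> j < d l \<Longrightarrow> isCont (\<lambda>t. M t l $$ (i,j)) 0"
    and in_C: "\<And>t. t \<noteq> 0 \<Longrightarrow> U t \<in> C"
  shows "U 0 \<in> C"
proof (rule ccontr)
  assume nC: "U 0 \<notin> C"
  have "openin (zariski N d s) (Gr_prod N d s - C)" using C unfolding closedin_def topspace_zariski by auto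
  moreover have "U 0 \<in> Gr_prod N d s - C" using U nC by simp
  ultimately obtain e F where F: "multihom s e F" "U 0 \<in> nonvanishing N d s F"
    "nonvanishing N d s F \<subseteq> Gr_prod N d s - C" using zariski_base by metis
  define x where "x = (\<lambda>t. pcoord N d s (M t))"
  have x: "x t \<in> pluecker N d s (U t)" for t unfolding x_def using M MU by (intro plueckerI)
  have "isCont (\<lambda>t. x t l I) 0" for l I
  proof (cases "l \<in> {1..s} \<and> I \<subseteq> {..<N} \<and> card I = d l")
    case True
    have "isCont (\<lambda>t. det (rowmat (M t l) (d l) (pick I))) 0"
    proof (rule continuous_det)
      fix i j assume ij: "i < d l" "j < d l"
      hence "pick I i < N" using True pick_lt[of I N i] by simp
      thus "isCont (\<lambda>t. rowmat (M t l) (d l) (pick I) $$ (i,j)) 0"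
        using cont[of l "pick I i" j] True ij unfolding rowmat_def by simp
    qed (rule rowmat_carrier)
    moreover have "x t l I = det (rowmat (M t l) (d l) (pick I))" for t
      using True submatrix_rowmat[OF M] unfolding x_def pcoord_def by auto
    ultimately show ?thesis by simp
  next
    case False
    hence "x t l I = 0" for t unfolding x_def pcoord_def by auto
    thus ?thesis by simp
  qed
  hence "isCont (\<lambda>t. F (x t)) 0" using continuous_multihom[OF F(1)] by blast
  moreover have "F (x 0) \<noteq> 0" using F(2) x unfolding nonvanishing_def by blast
  ultimately have "eventually (\<lambda>t. F (x t) \<noteq> 0) (at 0)"
    using tendsto_imp_eventually_ne unfolding isCont_def by blast
  then obtain \<delta> where "\<delta> > 0" "\<And>t. t \<noteq> 0 \<Longrightarrow> dist t 0 < \<delta> \<Longrightarrow> F (x t) \<noteq> 0"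
    unfolding eventually_at by auto
  hence "F (x (of_real (\<delta> / 2))) \<noteq> 0" "(of_real (\<delta> / 2) :: complex) \<noteq> 0" by auto
  then obtain t where t: "t \<noteq> 0" "F (x t) \<noteq> 0" by blast
  have Ut: "U t \<in> C" using in_C t(1) .
  hence UG: "U t \<in> Gr_prod N d s" using closedin_subset[OF C] unfolding topspace_zariski by auto
  hence "U t \<in> nonvanishing N d s F"
    using multihom_zero_iff[OF F(1) UG x] t(2) unfolding nonvanishing_def by blast
  thus False using F(3) Ut by blast
qed

section \<open>Transvections\<close>

text \<open>The map \<open>v \<mapsto> v + t \<xi>(v) y\<close>.\<close>

definition transv :: "nat \<Rightarrow> complex vec \<Rightarrow> complex vec \<Rightarrow> complex \<Rightarrow> complex mat" where
  "transv N \<xi> y t = mat N N (\<lambda>(i,j). (if i = j then 1 else 0) + t * y $ i * \<xi> $ j)"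

lemma transv_carrier: "transv N \<xi> y t \<in> carrier_mat N N"
  unfolding transv_def by simp

lemma transv_index:
  assumes "v \<in> carrier_vec N" "\<xi> \<in> carrier_vec N" "y \<in> carrier_vec N" "i < N"
  shows "(transv N \<xi> y t *\<^sub>v v) $ i = v $ i + t * (\<xi> \<bullet> v) * y $ i"
proof -
  have "(transv N \<xi> y t *\<^sub>v v) $ i = (\<Sum>j\<in>{0..<N}. ((if i = j then 1 else 0) + t * y $ i * \<xi> $ j) * v $ j)"
    using assms unfolding transv_def by (simp add: scalar_prod_def)
  also have "\<dots> = (\<Sum>j\<in>{0..<N}. (if i = j then v $ j else 0)) + (\<Sum>j\<in>{0..<N}. t * y $ i * (\<xi> $ j * v $ j))"
    unfolding sum.distrib[symmetric] by (intro sum.cong) (auto simp: algebra_simps)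
  also have "(\<Sum>j\<in>{0..<N}. (if i = j then v $ j else 0)) = v $ i" using assms(4) by simp
  also have "(\<Sum>j\<in>{0..<N}. t * y $ i * (\<xi> $ j * v $ j)) = t * (\<xi> \<bullet> v) * y $ i"
    using assms(1) unfolding scalar_prod_def sum_distrib_left[symmetric] by simp
  finally show ?thesis .
qed

lemma transv_mult:
  assumes "v \<in> carrier_vec N" "\<xi> \<in> carrier_vec N" "y \<in> carrier_vec N"
  shows "transv N \<xi> y t *\<^sub>v v = v + (t * (\<xi> \<bullet> v)) \<cdot>\<^sub>v y"
  using assms transv_index[OF assms] transv_carrier[of N \<xi> y t] by (intro eq_vecI) (auto simp del: index_mult_mat_vec)

lemma transv_fix:
  assumes "v \<in> carrier_vec N" "\<xi> \<in> carrier_vec N" "y \<in> carrier_vec N" "\<xi> \<bullet> v = 0"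
  shows "transv N \<xi> y t *\<^sub>v v = v"
  unfolding transv_mult[OF assms(1-3)] assms(4) using assms(1,3) by (intro eq_vecI) auto

lemma transv_zero:
  assumes "v \<in> carrier_vec N" "\<xi> \<in> carrier_vec N" "y \<in> carrier_vec N"
  shows "transv N \<xi> y 0 *\<^sub>v v = v"
  unfolding transv_mult[OF assms] using assms by (intro eq_vecI) auto

lemma transv_inj:
  assumes v: "v \<in> carrier_vec N" and \<xi>: "\<xi> \<in> carrier_vec N" and y: "y \<in> carrier_vec N" "\<xi> \<bullet> y = 0"
    and z: "transv N \<xi> y t *\<^sub>v v = 0\<^sub>v N"
  shows "v = 0\<^sub>v N"
proof -
  have "\<xi> \<bullet> (transv N \<xi> y t *\<^sub>v v) = \<xi> \<bullet> v"
    unfolding transv_mult[OF v \<xi> y(1)] using v \<xi> y by (simp add: scalar_prod_add_distrib[of _ N])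
  hence "\<xi> \<bullet> v = 0" unfolding z using \<xi> by simp
  thus ?thesis using transv_fix[OF v \<xi> y(1)] z by simp
qed

section \<open>Orthogonals and coordinate projections\<close>

text \<open>The orthogonal has the complementary dimension by \<open>rank_nullity\<close>, so for subspaces of
  complementary dimensions orthogonality already gives equality.\<close>

lemma perp_eq_iff:
  assumes G: "G \<in> carrier_mat N N" and inj: "\<And>v. v \<in> carrier_vec N \<Longrightarrow> G *\<^sub>v v = 0\<^sub>v N \<Longrightarrow> v = 0\<^sub>v N"
    and U: "U \<in> Gr N k" and U': "U' \<in> Gr N k'" and kk: "k + k' = N"
  shows "perp G U' = U \<longleftrightarrow> (\<forall>u\<in>U. \<forall>v\<in>U'. u \<bullet> (G *\<^sub>v v) = 0)"
proof
  assume "perp G U' = U"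
  thus "\<forall>u\<in>U. \<forall>v\<in>U'. u \<bullet> (G *\<^sub>v v) = 0" unfolding perp_def by auto
next
  assume iso: "\<forall>u\<in>U. \<forall>v\<in>U'. u \<bullet> (G *\<^sub>v v) = 0"
  obtain M where M: "frame N k' M" "colsp M = U'" using Gr_frameE[OF U'] .
  note Mc = frame_carrier[OF M(1)]
  have GM: "G * M \<in> carrier_mat N k'" using G Mc by simp
  have fGM: "frame N k' (G * M)"
  proof (rule frame_if_inj[OF GM])
    fix x assume x: "x \<in> carrier_vec k'" "G * M *\<^sub>v x = 0\<^sub>v N"
    hence "M *\<^sub>v x = 0\<^sub>v N"
      using inj[of "M *\<^sub>v x"] mult_mat_vec_carrier[OF Mc x(1)] assoc_mult_mat_vec[OF G Mc x(1)] by simp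
    thus "x = 0\<^sub>v k'" using frame_inj[OF M(1) x(1), of "0\<^sub>v k'"] mult_mat_vec_zero[OF Mc] by simp
  qed
  define P where "P = transpose_mat (G * M)"
  have P: "P \<in> carrier_mat k' N" unfolding P_def using GM by simp
  have perp: "perp G U' = {v \<in> carrier_vec N. P *\<^sub>v v = 0\<^sub>v k'}"
  proof -
    have key: "x \<bullet> (P *\<^sub>v v) = v \<bullet> (G *\<^sub>v (M *\<^sub>v x))" if "v \<in> carrier_vec N" "x \<in> carrier_vec k'" for v x
    proof -
      have "x \<bullet> (P *\<^sub>v v) = (P *\<^sub>v v) \<bullet> x"
        using comm_scalar_prod[OF that(2) mult_mat_vec_carrier[OF P that(1)]] .
      also have "\<dots> = v \<bullet> (G * M *\<^sub>v x)" unfolding P_def using transpose_vec_mult_scalar[OF GM that(2,1)] .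
      finally show ?thesis using assoc_mult_mat_vec[OF G Mc that(2)] by simp
    qed
    have "(\<forall>u\<in>U'. v \<bullet> (G *\<^sub>v u) = 0) \<longleftrightarrow> P *\<^sub>v v = 0\<^sub>v k'" if v: "v \<in> carrier_vec N" for v
    proof
      assume h: "\<forall>u\<in>U'. v \<bullet> (G *\<^sub>v u) = 0"
      show "P *\<^sub>v v = 0\<^sub>v k'"
      proof (rule eq_vecI)
        fix i assume "i < dim_vec (0\<^sub>v k' :: complex vec)"
        hence i: "i < k'" by simp
        have "M *\<^sub>v unit_vec k' i \<in> U'" unfolding M(2)[symmetric] colsp_def using Mc by auto
        hence "unit_vec k' i \<bullet> (P *\<^sub>v v) = 0" using key[OF v, of "unit_vec k' i"] h by simp
        thus "(P *\<^sub>v v) $ i = 0\<^sub>v k' $ i"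
          using scalar_prod_left_unit[OF mult_mat_vec_carrier[OF P v] i] i by simp
      qed (use P in simp)
    next
      assume "P *\<^sub>v v = 0\<^sub>v k'"
      thus "\<forall>u\<in>U'. v \<bullet> (G *\<^sub>v u) = 0"
        unfolding M(2)[symmetric] colsp_def using key[OF v] Mc by fastforce
    qed
    thus ?thesis unfolding perp_def using G by auto
  qed
  obtain L where L: "L \<in> carrier_mat k' N" "L * (G * M) = 1\<^sub>m k'" using fGM unfolding frame_def by auto
  have "P * transpose_mat L = 1\<^sub>m k'"
    using transpose_mult[OF L(1) GM] L(2) unfolding P_def by simp
  hence surj: "(\<lambda>v. P *\<^sub>v v) ` carrier_vec N = carrier_vec k'"
  proof (intro equalityI subsetI)
    fix y :: "complex vec" assume y: "y \<in> carrier_vec k'"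
    have LT: "transpose_mat L \<in> carrier_mat N k'" using L(1) by simp
    have "P *\<^sub>v (transpose_mat L *\<^sub>v y) = y"
      using assoc_mult_mat_vec[OF P LT y] \<open>P * transpose_mat L = 1\<^sub>m k'\<close> y by simp
    thus "y \<in> (\<lambda>v. P *\<^sub>v v) ` carrier_vec N" using mult_mat_vec_carrier[OF LT y] by (metis imageI)
  qed (use P in auto)
  have lp: "lin_sub N (perp G U')" unfolding perp by (rule lin_sub_kernel[OF P lin_sub_carrier])
  have "vdim N (perp G U') = k"
    using rank_nullity[OF P lin_sub_carrier] kk unfolding surj perp vdim_carrier by simp
  moreover have "U \<subseteq> perp G U'" using iso U G unfolding perp_def Gr_iff lin_sub_def by auto
  ultimately have "U = perp G U'" using lin_sub_eqI[OF _ lp] U unfolding Gr_iff by auto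
  thus "perp G U' = U" by simp
qed

lemma perp_involution_fixed_iff:
  assumes U: "U \<in> Gr_prod N d s"
  shows "perp_involution G s U = U \<longleftrightarrow> (\<forall>l\<in>{1..s}. perp G (U (s + 1 - l)) = U l)"
proof
  assume h: "perp_involution G s U = U"
  show "\<forall>l\<in>{1..s}. perp G (U (s + 1 - l)) = U l"
  proof
    fix l assume "l \<in> {1..s}"
    thus "perp G (U (s + 1 - l)) = U l" using fun_cong[OF h, of l] unfolding perp_involution_def by simp
  qed
next
  assume h: "\<forall>l\<in>{1..s}. perp G (U (s + 1 - l)) = U l"
  show "perp_involution G s U = U"
    by (rule extensionalityI[of _ "{1..s}"])
      (use h Gr_prod_ext[OF U] in \<open>auto simp: perp_involution_def\<close>)
qed

lemma pr_range_index:
  "pr_range i j v = vec (dim_vec v) (\<lambda>a. if i \<le> a + 1 \<and> a + 1 < j then 0 else v $ a)"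
proof (induction j)
  case 0
  show ?case unfolding pr_range_def by (intro eq_vecI) auto
next
  case (Suc j)
  show ?case
  proof (cases "i \<le> j")
    case True
    hence "pr_range i (Suc j) v = pr j (pr_range i j v)" unfolding pr_range_def by simp
    also have "\<dots> = vec (dim_vec v) (\<lambda>a. if i \<le> a + 1 \<and> a + 1 < Suc j then 0 else v $ a)"
      unfolding Suc pr_def using True by (intro eq_vecI) auto
    finally show ?thesis .
  next
    case False
    hence "pr_range i (Suc j) v = v" unfolding pr_range_def by simp
    thus ?thesis using False by (intro eq_vecI) auto
  qed
qed

section \<open>Symmetric dimension vectors\<close>

lemma strict_mono_on_image_unique:
  fixes f g :: "nat \<Rightarrow> nat"
  assumes f: "strict_mono_on {1..s} f" and g: "strict_mono_on {1..s} g" and im: "f ` {1..s} = g ` {1..s}"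
    and l: "l \<in> {1..s}"
  shows "f l = g l"
proof -
  have srt: "sorted (map h [1..<s+1]) \<and> distinct (map h [1..<s+1])" if h: "strict_mono_on {1..s} h" for h :: "nat \<Rightarrow> nat"
  proof -
    have "sorted_wrt (<) (map h [1..<s+1])"
      unfolding sorted_wrt_map
      by (rule sorted_wrt_mono_rel[OF _ sorted_wrt_upt]) (use h in \<open>auto simp: strict_mono_on_def\<close>)
    thus ?thesis by (simp add: strict_sorted_iff)
  qed
  have "{1..s} = set [1..<s+1]" by auto
  hence "set (map f [1..<s+1]) = set (map g [1..<s+1])" using im by simp
  hence "map f [1..<s+1] = map g [1..<s+1]"
    using sorted_distinct_set_unique srt[OF f] srt[OF g] by blast
  hence "\<forall>x\<in>{1..s}. f x = g x" unfolding \<open>{1..s} = set [1..<s+1]\<close> by (simp only: map_eq_conv)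
  thus ?thesis using l by blast
qed

lemma choice2:
  assumes "\<forall>l I. \<exists>c J. R l I c J"
  obtains c J where "\<forall>l I. R l I (c l I) (J l I)"
  using assms by metis

locale symplectic_type =
  fixes m n s :: nat and d :: "nat \<Rightarrow> nat"
  assumes m1: "1 \<le> m" and n_eq: "n = 2 * m - 1" and s1: "1 \<le> s"
    and d_strict: "strict_mono_on {1..s} d"
    and d_range: "\<forall>i\<in>{1..s}. 1 \<le> d i \<and> d i \<le> 2 * m"
    and d_sym: "(\<lambda>k. 2 * m - k) ` d ` {1..s} = d ` {1..s}"
    and d0: "d 0 = 0" and d_last: "d (s + 1) = n + 1"
begin

lemma n_pos: "1 \<le> n" "n + 1 = 2 * m" "0 < 2 * n" using m1 n_eq by auto

lemma d_ge: "l \<in> {1..s} \<Longrightarrow> 1 \<le> d l" using d_range by auto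

lemma d_le:
  assumes l: "l \<in> {1..s}" shows "d l \<le> n"
proof -
  have "2 * m - d l \<in> (\<lambda>k. 2 * m - k) ` d ` {1..s}" using l by blast
  then obtain i where "i \<in> {1..s}" "d i = 2 * m - d l" unfolding d_sym by auto
  thus ?thesis using d_ge[of i] n_pos(2) by simp
qed

lemma d_less: "l \<in> {1..s} \<Longrightarrow> l' \<in> {1..s} \<Longrightarrow> l < l' \<Longrightarrow> d l < d l'"
  using d_strict unfolding strict_mono_on_def by blast

lemma d_mono: "l \<in> {1..s} \<Longrightarrow> l' \<in> {1..s} \<Longrightarrow> l \<le> l' \<Longrightarrow> d l \<le> d l'"
  using d_less[of l l'] by (cases "l = l'") auto

text \<open>The reflected sequence is increasing with the same set of values, hence it is the same sequence.\<close>

lemma d_dual: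
  assumes l: "l \<in> {1..s}" shows "d l + d (s + 1 - l) = n + 1"
proof -
  define g where "g = (\<lambda>l. 2 * m - d (s + 1 - l))"
  have "strict_mono_on {1..s} g"
  proof (rule strict_mono_onI)
    fix a b assume ab: "a \<in> {1..s}" "b \<in> {1..s}" "a < b"
    have "d (s + 1 - b) < d (s + 1 - a)" using ab by (intro d_less) auto
    moreover have "d (s + 1 - a) \<le> n" using ab by (intro d_le) auto
    ultimately show "g a < g b" unfolding g_def using n_pos by auto
  qed
  moreover have "g ` {1..s} = d ` {1..s}"
  proof -
    have "(\<lambda>l. s + 1 - l) ` {1..s} = {1..s}"
    proof (intro equalityI subsetI)
      fix x assume "x \<in> {1..s}"
      thus "x \<in> (\<lambda>l. s + 1 - l) ` {1..s}" by (intro image_eqI[of _ _ "s + 1 - x"]) auto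
    qed auto
    hence "g ` {1..s} = (\<lambda>k. 2 * m - k) ` d ` {1..s}" unfolding g_def by (metis image_image)
    thus ?thesis using d_sym by simp
  qed
  ultimately have "g l = d l" using strict_mono_on_image_unique[OF _ d_strict] l by blast
  moreover have "d (s + 1 - l) \<le> n" using l by (intro d_le) auto
  ultimately show ?thesis unfolding g_def using n_pos by simp
qed

lemma dual_index: "l \<in> {1..s} \<Longrightarrow> s + 1 - l \<in> {1..s}" "l \<in> {1..s} \<Longrightarrow> s + 1 - (s + 1 - l) = l" by auto

section \<open>The subquotients of the standard flag\<close>

text \<open>The signs of the form on \<open>V\<close>: it is negative on the pairs whose first index is between \<open>m\<close>
  and \<open>n - 1\<close> (counted from \<open>1\<close>), while on \<open>W\<close> all pairs with first index at most \<open>n\<close> are positive.\<close>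

definition eps :: "nat \<Rightarrow> complex" where
  "eps j = (if m \<le> j + 1 \<and> j + 1 < n then -1 else 1)"

text \<open>The projection onto the subquotient for \<open>d = D\<close>, in the coordinates of \<open>V\<close>; \<open>lift_vec\<close> is a
  section of it.\<close>

definition quot_mat :: "nat \<Rightarrow> complex mat" where
  "quot_mat D = mat (n + 1) (2 * n) (\<lambda>(j,i).
     if D \<le> j + 1 then (if i = j then eps j else 0) else (if i = n + 1 + j then 1 else 0))"

definition lift_vec :: "nat \<Rightarrow> complex vec \<Rightarrow> complex vec" where
  "lift_vec D u = vec (2 * n) (\<lambda>i.
     if i + 1 < D then 0 else if i \<le> n then eps i * u $ i else if i < n + D then u $ (i - n - 1) else 0)"

text \<open>The preimage of \<open>U\<close> in the span of the first \<open>n + D\<close> basis vectors.\<close>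

definition emb :: "nat \<Rightarrow> complex vec set \<Rightarrow> complex vec set" where
  "emb D U = {w \<in> coord_sub (2 * n) 0 (n + D). quot_mat D *\<^sub>v w \<in> U}"

lemma eps_sq: "eps j * eps j = 1" "eps j \<noteq> 0" "eps j * (eps j * z) = z"
  unfolding eps_def by auto

lemma quot_mat_carrier: "quot_mat D \<in> carrier_mat (n + 1) (2 * n)"
  unfolding quot_mat_def by simp

lemma quot_mat_index:
  assumes w: "w \<in> carrier_vec (2 * n)" and j: "j < n + 1" and D: "D \<le> n"
  shows "(quot_mat D *\<^sub>v w) $ j = (if D \<le> j + 1 then eps j * w $ j else w $ (n + 1 + j))"
proof (cases "D \<le> j + 1")
  case True
  have "(quot_mat D *\<^sub>v w) $ j = eps j * w $ j"
    by (rule mult_mat_vec_single[OF quot_mat_carrier w j])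
      (use True j n_pos in \<open>auto simp: quot_mat_def\<close>)
  thus ?thesis using True by simp
next
  case False
  have "(quot_mat D *\<^sub>v w) $ j = 1 * w $ (n + 1 + j)"
    by (rule mult_mat_vec_single[OF quot_mat_carrier w j])
      (use False j n_pos D in \<open>auto simp: quot_mat_def\<close>)
  thus ?thesis using False by simp
qed

lemma lift_vec_coord_sub: "1 \<le> D \<Longrightarrow> lift_vec D u \<in> coord_sub (2 * n) (D - 1) (n + D)"
  unfolding coord_sub_def lift_vec_def by auto

lemma quot_lift:
  assumes u: "u \<in> carrier_vec (n + 1)" and D: "1 \<le> D" "D \<le> n"
  shows "quot_mat D *\<^sub>v lift_vec D u = u"
proof (rule eq_vecI)
  show "dim_vec (quot_mat D *\<^sub>v lift_vec D u) = dim_vec u" using u quot_mat_carrier[of D] by simp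
  fix j assume "j < dim_vec u"
  hence j: "j < n + 1" using u by simp
  have w: "lift_vec D u \<in> carrier_vec (2 * n)" unfolding lift_vec_def by simp
  show "(quot_mat D *\<^sub>v lift_vec D u) $ j = u $ j"
    unfolding quot_mat_index[OF w j D(2)] using j D n_pos eps_sq(3)
    unfolding lift_vec_def by auto
qed

lemma quot_kernel:
  assumes D: "1 \<le> D" "D \<le> n"
  shows "{w \<in> coord_sub (2 * n) 0 (n + D). quot_mat D *\<^sub>v w = 0\<^sub>v (n + 1)} = coord_sub (2 * n) 0 (D - 1)"
proof (intro equalityI subsetI)
  fix w assume "w \<in> {w \<in> coord_sub (2 * n) 0 (n + D). quot_mat D *\<^sub>v w = 0\<^sub>v (n + 1)}"
  hence w: "w \<in> coord_sub (2 * n) 0 (n + D)" "quot_mat D *\<^sub>v w = 0\<^sub>v (n + 1)" by auto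
  note wc = coord_subD[OF w(1)]
  have z: "(if D \<le> j + 1 then eps j * w $ j else w $ (n + 1 + j)) = 0" if "j < n + 1" for j
    using quot_mat_index[OF wc(1) that D(2)] w(2) that by simp
  have "w $ i = 0" if i: "i < 2 * n" "D - 1 \<le> i" for i
  proof (cases "i \<le> n")
    case True
    moreover have "D \<le> i + 1" using i D by simp
    ultimately show ?thesis using z[of i] eps_sq(2)[of i] by simp
  next
    case False
    show ?thesis
    proof (cases "i < n + D")
      case True
      hence "i - n - 1 < n + 1" "\<not> D \<le> i - n - 1 + 1" "n + 1 + (i - n - 1) = i"
        using \<open>\<not> i \<le> n\<close> D by auto
      thus ?thesis using z[of "i - n - 1"] by (simp only: if_False)
    qed (use wc(3) i in auto)
  qed
  thus "w \<in> coord_sub (2 * n) 0 (D - 1)" using wc(1) unfolding coord_sub_def by auto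
next
  fix w :: "complex vec" assume w: "w \<in> coord_sub (2 * n) 0 (D - 1)"
  have "quot_mat D *\<^sub>v w = 0\<^sub>v (n + 1)"
  proof (rule eq_vecI)
    fix j assume "j < dim_vec (0\<^sub>v (n + 1) :: complex vec)"
    hence j: "j < n + 1" by simp
    show "(quot_mat D *\<^sub>v w) $ j = 0\<^sub>v (n + 1) $ j"
      unfolding quot_mat_index[OF coord_subD(1)[OF w] j D(2)] using coord_subD(3)[OF w] j D n_pos
      by auto
  qed (use quot_mat_carrier[of D] in simp)
  moreover have "w \<in> coord_sub (2 * n) 0 (n + D)"
  proof -
    have "D - 1 \<le> n + D" by simp
    thus ?thesis using subsetD[OF coord_sub_mono[of 0 0 "D - 1" "n + D" "2 * n"] w] by blast
  qed
  ultimately show "w \<in> {w \<in> coord_sub (2 * n) 0 (n + D). quot_mat D *\<^sub>v w = 0\<^sub>v (n + 1)}" by simp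
qed

lemma lin_sub_emb:
  assumes "lin_sub (n + 1) U"
  shows "lin_sub (2 * n) (emb D U)"
proof -
  note E = lin_subD[OF lin_sub_coord_sub[of "2 * n" 0 "n + D"]]
  note U = lin_subD[OF assms]
  note Q = quot_mat_carrier[of D]
  show ?thesis
  proof (rule lin_subI)
    show "emb D U \<subseteq> carrier_vec (2 * n)" unfolding emb_def using E(1) by blast
    show "0\<^sub>v (2 * n) \<in> emb D U" unfolding emb_def using E(2) U(2) mult_mat_vec_zero[OF Q] by simp
    fix u a assume u: "u \<in> emb D U"
    hence uc: "u \<in> carrier_vec (2 * n)" unfolding emb_def using E(5) by blast
    show "a \<cdot>\<^sub>v u \<in> emb D U" using u E(4)[of u a] U(4) unfolding emb_def by (auto simp: mult_mat_vec[OF Q uc])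
    fix v assume v: "v \<in> emb D U"
    hence vc: "v \<in> carrier_vec (2 * n)" unfolding emb_def using E(5) by blast
    show "u + v \<in> emb D U" using u v E(3)[of u v] U(3) unfolding emb_def
      by (auto simp: mult_add_distrib_mat_vec[OF Q uc vc])
  qed
qed

lemma emb_image:
  assumes U: "lin_sub (n + 1) U" and D: "1 \<le> D" "D \<le> n"
  shows "(\<lambda>w. quot_mat D *\<^sub>v w) ` emb D U = U"
proof (intro equalityI subsetI)
  fix u assume u: "u \<in> U"
  hence "quot_mat D *\<^sub>v lift_vec D u = u" using quot_lift[OF _ D] lin_subD(5)[OF U] by blast
  moreover have "lift_vec D u \<in> emb D U"
    unfolding emb_def using calculation u lift_vec_coord_sub[of D u] D(1)
      coord_sub_mono[of 0 "D - 1" "n + D" "n + D" "2 * n"] by auto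
  ultimately show "u \<in> (\<lambda>w. quot_mat D *\<^sub>v w) ` emb D U" by (metis imageI)
qed (auto simp: emb_def)

lemma coord_sub_le_emb:
  assumes U: "lin_sub (n + 1) U" and D: "1 \<le> D" "D \<le> n"
  shows "coord_sub (2 * n) 0 (D - 1) \<subseteq> emb D U"
proof
  fix w :: "complex vec" assume "w \<in> coord_sub (2 * n) 0 (D - 1)"
  hence "w \<in> coord_sub (2 * n) 0 (n + D)" "quot_mat D *\<^sub>v w = 0\<^sub>v (n + 1)"
    unfolding quot_kernel[OF D, symmetric] by auto
  thus "w \<in> emb D U" unfolding emb_def using lin_subD(2)[OF U] by simp
qed

lemma vdim_emb:
  assumes U: "lin_sub (n + 1) U" and D: "1 \<le> D" "D \<le> n"
  shows "vdim (2 * n) (emb D U) = vdim (n + 1) U + (D - 1)"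
proof -
  have "{w \<in> emb D U. quot_mat D *\<^sub>v w = 0\<^sub>v (n + 1)} = coord_sub (2 * n) 0 (D - 1)"
    unfolding quot_kernel[OF D, symmetric] emb_def using lin_subD(2)[OF U] by auto
  moreover have "vdim (2 * n) (coord_sub (2 * n) 0 (D - 1) :: complex vec set) = D - 1"
    by (subst vdim_coord_sub) (use D in auto)
  ultimately show ?thesis
    using rank_nullity[OF quot_mat_carrier lin_sub_emb[OF U], of D D] emb_image[OF U D] by simp
qed

lemma emb_quot:
  assumes W: "lin_sub (2 * n) W" and D: "1 \<le> D" "D \<le> n"
    and lo: "coord_sub (2 * n) 0 (D - 1) \<subseteq> W" and hi: "W \<subseteq> coord_sub (2 * n) 0 (n + D)"
  shows "emb D ((\<lambda>w. quot_mat D *\<^sub>v w) ` W) = W"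
proof (intro equalityI subsetI)
  fix w assume "w \<in> emb D ((\<lambda>w. quot_mat D *\<^sub>v w) ` W)"
  then obtain w' where w: "w \<in> coord_sub (2 * n) 0 (n + D)" "w' \<in> W" "quot_mat D *\<^sub>v w = quot_mat D *\<^sub>v w'"
    unfolding emb_def by auto
  have c: "w \<in> carrier_vec (2 * n)" "w' \<in> carrier_vec (2 * n)"
    using coord_subD(1)[OF w(1)] lin_subD(5)[OF W w(2)] by auto
  have "quot_mat D *\<^sub>v (w - w') = 0\<^sub>v (n + 1)"
    using mult_minus_distrib_mat_vec[OF quot_mat_carrier c] w(3) mult_mat_vec_carrier[OF quot_mat_carrier c(2)]
    by simp
  moreover have "w - w' \<in> coord_sub (2 * n) 0 (n + D)"
    using lin_sub_diff[OF lin_sub_coord_sub w(1)] w(2) hi by auto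
  ultimately have "w - w' \<in> W" using quot_kernel[OF D] lo by auto
  hence "(w - w') + w' \<in> W" using lin_subD(3)[OF W] w(2) by blast
  moreover have "(w - w') + w' = w" using c by (intro eq_vecI) auto
  ultimately show "w \<in> W" by simp
qed (use hi in \<open>auto simp: emb_def\<close>)

lemma emb_mono_iff:
  assumes "lin_sub (n + 1) U" "lin_sub (n + 1) U'" "1 \<le> D" "D \<le> n"
  shows "emb D U = emb D U' \<longleftrightarrow> U = U'"
  using emb_image[OF assms(1,3,4)] emb_image[OF assms(2,3,4)] by metis

section \<open>The two symplectic forms\<close>

lemma gram_V_carrier: "gram_V m \<in> carrier_mat (n + 1) (n + 1)"
  unfolding gram_V_def n_pos(2) Let_def by simp

lemma gram_W_carrier: "gram_W n \<in> carrier_mat (2 * n) (2 * n)"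
proof -
  have "gram_W n \<in> carrier_mat (n + n) (n + n)"
    unfolding gram_W_def anti_diag_def by (intro four_block_carrier_mat) auto
  thus ?thesis by (simp add: mult_2)
qed

lemma gram_W_index:
  assumes w: "w \<in> carrier_vec (2 * n)" and i: "i < 2 * n"
  shows "(gram_W n *\<^sub>v w) $ i = (if i < n then 1 else -1) * w $ (2 * n - 1 - i)"
  by (rule mult_mat_vec_single[OF gram_W_carrier w i])
    (use i in \<open>auto simp: gram_W_def anti_diag_def index_mat_four_block\<close>)

lemma gram_V_entry:
  assumes "j < n + 1" "b < n + 1"
  shows "gram_V m $$ (j,b) =
    (if j + 1 < m \<and> b = n - 2 - j \<or> j = n - 1 \<and> b = n then 1
     else if b + 1 < m \<and> j = n - 2 - b \<or> b = n - 1 \<and> j = n then -1 else 0)"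
proof -
  have pos: "(1 \<le> k + 1 \<and> k + 1 \<le> m - 1 \<and> l + 1 = 2 * m - 1 - (k + 1)) \<or> (k + 1 = 2 * m - 1 \<and> l + 1 = 2 * m)
      \<longleftrightarrow> k + 1 < m \<and> l = n - 2 - k \<or> k = n - 1 \<and> l = n" for k l :: nat
    using n_eq m1 by auto
  have "j < 2 * m" "b < 2 * m" using assms n_pos(2) by auto
  thus ?thesis unfolding gram_V_def Let_def pos[symmetric] by simp
qed

lemma gram_V_index:
  assumes v: "v \<in> carrier_vec (n + 1)"
  shows "j + 1 < n \<Longrightarrow> (gram_V m *\<^sub>v v) $ j = (if j + 1 < m then 1 else -1) * v $ (n - 2 - j)"
    and "(gram_V m *\<^sub>v v) $ (n - 1) = v $ n"
    and "(gram_V m *\<^sub>v v) $ n = - v $ (n - 1)"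
proof -
  show "(gram_V m *\<^sub>v v) $ j = (if j + 1 < m then 1 else -1) * v $ (n - 2 - j)" if j: "j + 1 < n"
  proof (rule mult_mat_vec_single[OF gram_V_carrier v])
    fix b assume b: "b < n + 1"
    have "b + 1 < m \<and> j = n - 2 - b \<or> b = n - 1 \<and> j = n \<longleftrightarrow> \<not> j + 1 < m \<and> b = n - 2 - j"
      using n_eq m1 j by auto
    moreover have "j \<noteq> n - 1" using j by linarith
    ultimately show "gram_V m $$ (j, b) = (if b = n - 2 - j then if j + 1 < m then 1 else -1 else 0)"
      using gram_V_entry[OF _ b, of j] j by auto
  qed (use j in auto)
  have "(gram_V m *\<^sub>v v) $ (n - 1) = 1 * v $ n"
  proof (rule mult_mat_vec_single[OF gram_V_carrier v])
    fix b assume b: "b < n + 1"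
    have "\<not> (b + 1 < m \<and> n - 1 = n - 2 - b)" "n - 1 \<noteq> n" using n_eq m1 by auto
    moreover have "\<not> (n - 1 + 1 < m \<and> b = n - 2 - (n - 1))" using n_eq m1 by auto
    ultimately show "gram_V m $$ (n - 1, b) = (if b = n then 1 else 0)"
      using gram_V_entry[OF _ b, of "n - 1"] by auto
  qed (use n_pos in auto)
  thus "(gram_V m *\<^sub>v v) $ (n - 1) = v $ n" by simp
  have "(gram_V m *\<^sub>v v) $ n = (- 1) * v $ (n - 1)"
  proof (rule mult_mat_vec_single[OF gram_V_carrier v])
    fix b assume b: "b < n + 1"
    have "\<not> (n + 1 < m \<and> b = n - 2 - n)" "\<not> (b + 1 < m \<and> n = n - 2 - b)" "n \<noteq> n - 1" using n_eq m1 by auto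
    thus "gram_V m $$ (n, b) = (if b = n - 1 then - 1 else 0)"
      using gram_V_entry[OF _ b, of n] by auto
  qed (use n_pos in auto)
  thus "(gram_V m *\<^sub>v v) $ n = - v $ (n - 1)" by simp
qed

text \<open>Only the coordinates from \<open>D - 1\<close> to \<open>n + D - 1\<close> of \<open>w\<close> meet nonzero coordinates of \<open>w'\<close>; those up to
  \<open>n\<close> are the last coordinates of the projection and the remaining ones its first \<open>D - 1\<close>.\<close>

lemma form_compat:
  assumes D: "1 \<le> D" "D \<le> n" "D + D' = n + 1"
    and w: "w \<in> coord_sub (2 * n) 0 (n + D)" and w': "w' \<in> coord_sub (2 * n) 0 (n + D')"
  shows "w \<bullet> (gram_W n *\<^sub>v w') = (quot_mat D *\<^sub>v w) \<bullet> (gram_V m *\<^sub>v (quot_mat D' *\<^sub>v w'))"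
proof -
  note wc = coord_subD[OF w] and wc' = coord_subD[OF w']
  define v where "v = quot_mat D *\<^sub>v w"
  define v' where "v' = quot_mat D' *\<^sub>v w'"
  have D': "1 \<le> D'" "D' \<le> n" using D by auto
  have v: "v \<in> carrier_vec (n + 1)" "v' \<in> carrier_vec (n + 1)"
    unfolding v_def v'_def using mult_mat_vec_carrier[OF quot_mat_carrier] wc(1) wc'(1) by auto
  have vi: "v $ j = (if D \<le> j + 1 then eps j * w $ j else w $ (n + 1 + j))" if "j < n + 1" for j
    unfolding v_def using quot_mat_index[OF wc(1) that D(2)] .
  have vi': "v' $ j = (if D' \<le> j + 1 then eps j * w' $ j else w' $ (n + 1 + j))" if "j < n + 1" for j
    unfolding v'_def using quot_mat_index[OF wc'(1) that D'(2)] .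
  define L where "L = (\<lambda>i. w $ i * ((if i < n then 1 else -1) * w' $ (2 * n - 1 - i)))"
  define R where "R = (\<lambda>j. v $ j * (gram_V m *\<^sub>v v') $ j)"
  have "w \<bullet> (gram_W n *\<^sub>v w') = (\<Sum>i\<in>{0..<2 * n}. L i)"
    using gram_W_carrier wc(1) gram_W_index[OF wc'(1)] unfolding L_def scalar_prod_def
    by (auto intro!: sum.cong simp del: index_mult_mat_vec)
  also have "\<dots> = (\<Sum>i\<in>{D - 1..<n + D}. L i)"
  proof (rule sum.mono_neutral_right)
    show "\<forall>i\<in>{0..<2 * n} - {D - 1..<n + D}. L i = 0"
    proof
      fix i assume i: "i \<in> {0..<2 * n} - {D - 1..<n + D}"
      show "L i = 0"
      proof (cases "i < D - 1")
        case True
        hence "w' $ (2 * n - 1 - i) = 0" using i D by (intro wc'(3)) auto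
        thus ?thesis unfolding L_def by simp
      next
        case False
        hence "w $ i = 0" using i by (intro wc(3)) auto
        thus ?thesis unfolding L_def by simp
      qed
    qed
  qed (use D in auto)
  also have "{D - 1..<n + D} = {D - 1..<n + 1} \<union> {n + 1..<n + D}" using D by auto
  also have "(\<Sum>i\<in>{D - 1..<n + 1} \<union> {n + 1..<n + D}. L i) =
      (\<Sum>i\<in>{D - 1..<n + 1}. L i) + (\<Sum>i\<in>{n + 1..<n + D}. L i)"
    by (rule sum.union_disjoint) auto
  also have "(\<Sum>i\<in>{n + 1..<n + D}. L i) = (\<Sum>j\<in>{0..<D - 1}. L (n + 1 + j))"
    by (rule sum.reindex_bij_witness[of _ "\<lambda>j. n + 1 + j" "\<lambda>i. i - (n + 1)"]) auto
  also have "(\<Sum>j\<in>{0..<D - 1}. L (n + 1 + j)) = (\<Sum>j\<in>{0..<D - 1}. R j)"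
  proof (rule sum.cong[OF refl])
    fix j assume "j \<in> {0..<D - 1}"
    hence j: "j + 1 < D" by auto
    have 1: "v $ j = w $ (n + 1 + j)" using vi[of j] j D by auto
    have 2: "(gram_V m *\<^sub>v v') $ j = (if j + 1 < m then 1 else -1) * v' $ (n - 2 - j)"
      using j D by (intro gram_V_index(1)[OF v(2)]) auto
    have 3: "v' $ (n - 2 - j) = eps (n - 2 - j) * w' $ (n - 2 - j)" using vi'[of "n - 2 - j"] j D by auto
    have 4: "(if j + 1 < m then 1 else -1) * eps (n - 2 - j) = -1"
      unfolding eps_def using j D n_eq by auto
    have "2 * n - 1 - (n + 1 + j) = n - 2 - j" using j D by auto
    thus "L (n + 1 + j) = R j" unfolding L_def R_def 1 2 3 using 4 by (simp add: mult.assoc[symmetric])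
  qed
  also have "(\<Sum>i\<in>{D - 1..<n + 1}. L i) = (\<Sum>i\<in>{D - 1..<n + 1}. R i)"
  proof (rule sum.cong[OF refl])
    fix i assume "i \<in> {D - 1..<n + 1}"
    hence i: "D \<le> i + 1" "i < n + 1" by auto
    have 1: "v $ i = eps i * w $ i" using vi[of i] i by auto
    consider "i + 1 < n" | "i = n - 1" | "i = n" using i by linarith
    thus "L i = R i"
    proof cases
      case 1
      have 2: "(gram_V m *\<^sub>v v') $ i = (if i + 1 < m then 1 else -1) * v' $ (n - 2 - i)"
        using 1 by (intro gram_V_index(1)[OF v(2)]) auto
      have "n + 1 + (n - 2 - i) = 2 * n - 1 - i" using 1 by auto
      hence 3: "v' $ (n - 2 - i) = w' $ (2 * n - 1 - i)" using vi'[of "n - 2 - i"] i 1 D by auto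
      have "eps i * (if i + 1 < m then 1 else -1) = 1" unfolding eps_def using 1 by auto
      thus ?thesis unfolding L_def R_def 2 3 \<open>v $ i = eps i * w $ i\<close> using 1 by auto
    next
      case 2
      have "v' $ n = w' $ n" using vi'[of n] D n_pos unfolding eps_def by auto
      moreover have "eps i = 1" unfolding eps_def using 2 n_pos by auto
      moreover have "2 * n - 1 - (n - 1) = n" using n_pos by auto
      ultimately show ?thesis unfolding L_def R_def 1 using gram_V_index(2)[OF v(2)] 2 n_pos by simp
    next
      case 3
      have "v' $ (n - 1) = w' $ (n - 1)" using vi'[of "n - 1"] D D' n_pos unfolding eps_def by auto
      moreover have "eps i = 1" unfolding eps_def using 3 by auto
      moreover have "2 * n - 1 - n = n - 1" using n_pos by auto
      ultimately show ?thesis unfolding L_def R_def 1 using gram_V_index(3)[OF v(2)] 3 by simp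
    qed
  qed
  also have "(\<Sum>i\<in>{D - 1..<n + 1}. R i) + (\<Sum>j\<in>{0..<D - 1}. R j) = (\<Sum>j\<in>{0..<n + 1}. R j)"
    using sum.atLeastLessThan_concat[of 0 "D - 1" "n + 1" R] D by (simp add: add.commute)
  also have "\<dots> = v \<bullet> (gram_V m *\<^sub>v v')"
    using gram_V_carrier unfolding R_def scalar_prod_def by (auto simp del: index_mult_mat_vec)
  finally show ?thesis unfolding v_def v'_def .
qed

lemma gram_W_inj:
  assumes w: "w \<in> carrier_vec (2 * n)" "gram_W n *\<^sub>v w = 0\<^sub>v (2 * n)"
  shows "w = 0\<^sub>v (2 * n)"
proof (rule eq_vecI)
  fix i assume "i < dim_vec (0\<^sub>v (2 * n) :: complex vec)"
  hence i: "i < 2 * n" by simp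
  have "(gram_W n *\<^sub>v w) $ (2 * n - 1 - i) = 0" unfolding w(2) using i by simp
  moreover have "2 * n - 1 - (2 * n - 1 - i) = i" using i by simp
  ultimately show "w $ i = 0\<^sub>v (2 * n) $ i"
    using gram_W_index[OF w(1), of "2 * n - 1 - i"] i by (auto split: if_splits)
qed (use w in simp)

lemma gram_V_inj:
  assumes v: "v \<in> carrier_vec (n + 1)" "gram_V m *\<^sub>v v = 0\<^sub>v (n + 1)"
  shows "v = 0\<^sub>v (n + 1)"
proof (rule eq_vecI)
  have z: "(gram_V m *\<^sub>v v) $ j = 0" if "j < n + 1" for j unfolding v(2) using that by simp
  fix i assume "i < dim_vec (0\<^sub>v (n + 1) :: complex vec)"
  hence i: "i < n + 1" by simp
  consider "i + 1 < n" | "i = n - 1" | "i = n" using i by linarith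
  hence "v $ i = 0"
  proof cases
    case 1
    hence "n - 2 - (n - 2 - i) = i" "n - 2 - i + 1 < n" by auto
    thus ?thesis using gram_V_index(1)[OF v(1), of "n - 2 - i"] z[of "n - 2 - i"] by (auto split: if_splits)
  next
    case 2
    thus ?thesis using gram_V_index(3)[OF v(1)] z[of n] by auto
  next
    case 3
    thus ?thesis using gram_V_index(2)[OF v(1)] z[of "n - 1"] n_pos by auto
  qed
  thus "v $ i = 0\<^sub>v (n + 1) $ i" using i by simp
qed (use v in simp)

section \<open>Passing from degenerate flags to flags\<close>

definition zeta :: "point \<Rightarrow> point" where
  "zeta U = (\<lambda>l\<in>{1..s}. emb (d l) (U l))"

abbreviation "dW \<equiv> (\<lambda>l. 2 * d l - 1)"

lemma emb_Gr:
  assumes U: "U \<in> Gr (n + 1) D" and D: "1 \<le> D" "D \<le> n"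
  shows "emb D U \<in> Gr (2 * n) (2 * D - 1)"
  unfolding Gr_iff using lin_sub_emb[OF lin_sub_Gr[OF U]] vdim_emb[OF lin_sub_Gr[OF U] D] vdim_Gr[OF U] D by simp

lemma zeta_Gr_prod: "U \<in> Gr_prod (n + 1) d s \<Longrightarrow> zeta U \<in> Gr_prod (2 * n) dW s"
  by (rule Gr_prodI) (use emb_Gr[OF Gr_prodD] d_ge d_le in \<open>auto simp: zeta_def\<close>)

text \<open>A coordinate \<open>j\<close> with \<open>D \<le> j + 1 < D'\<close> is killed on the right; on the left it is read at position
  \<open>n + 1 + j\<close>, where \<open>w\<close> vanishes.\<close>

lemma quot_pr:
  assumes D: "D \<le> D'" "D' \<le> n" and w: "w \<in> coord_sub (2 * n) 0 (n + D)"
  shows "quot_mat D' *\<^sub>v w = pr_range D D' (quot_mat D *\<^sub>v w)"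
proof (rule eq_vecI)
  have dm: "dim_vec (quot_mat D *\<^sub>v w) = n + 1" using quot_mat_carrier[of D] by simp
  show "dim_vec (quot_mat D' *\<^sub>v w) = dim_vec (pr_range D D' (quot_mat D *\<^sub>v w))"
    unfolding pr_range_index using dm quot_mat_carrier[of D'] by simp
  fix j assume "j < dim_vec (pr_range D D' (quot_mat D *\<^sub>v w))"
  hence j: "j < n + 1" unfolding pr_range_index using dm by simp
  have z: "w $ (n + 1 + j) = 0" if "D \<le> j + 1" "j + 1 < D'" using that D by (intro coord_subD(3)[OF w]) auto
  have "pr_range D D' (quot_mat D *\<^sub>v w) $ j = (if D \<le> j + 1 \<and> j + 1 < D' then 0 else (quot_mat D *\<^sub>v w) $ j)"
    unfolding pr_range_index dm using j by simp
  also have "(quot_mat D *\<^sub>v w) $ j = (if D \<le> j + 1 then eps j * w $ j else w $ (n + 1 + j))"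
    using quot_mat_index[OF coord_subD(1)[OF w] j, of D] D by simp
  finally have e: "pr_range D D' (quot_mat D *\<^sub>v w) $ j = (if D \<le> j + 1 \<and> j + 1 < D' then 0 else
      if D \<le> j + 1 then eps j * w $ j else w $ (n + 1 + j))" .
  show "(quot_mat D' *\<^sub>v w) $ j = pr_range D D' (quot_mat D *\<^sub>v w) $ j"
    unfolding e quot_mat_index[OF coord_subD(1)[OF w] j D(2)] using z D by auto
qed

lemma emb_subset_iff:
  assumes U: "lin_sub (n + 1) U" and D: "1 \<le> D" "D \<le> D'" "D' \<le> n"
  shows "emb D U \<subseteq> emb D' U' \<longleftrightarrow> pr_range D D' ` U \<subseteq> U'"
proof
  assume h: "emb D U \<subseteq> emb D' U'"
  show "pr_range D D' ` U \<subseteq> U'"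
  proof
    fix x assume "x \<in> pr_range D D' ` U"
    then obtain u where u: "u \<in> U" "x = pr_range D D' u" by auto
    have "D \<le> n" using D by simp
    from emb_image[OF U D(1) this] have "u \<in> (\<lambda>w. quot_mat D *\<^sub>v w) ` emb D U" using u(1) by simp
    then obtain w where w: "w \<in> emb D U" "x = pr_range D D' (quot_mat D *\<^sub>v w)"
      using u(2) by auto
    have "w \<in> coord_sub (2 * n) 0 (n + D)" using w(1) unfolding emb_def by simp
    hence "x = quot_mat D' *\<^sub>v w" using w(2) quot_pr[OF D(2,3)] by simp
    thus "x \<in> U'" using h w(1) unfolding emb_def by auto
  qed
next
  assume h: "pr_range D D' ` U \<subseteq> U'"
  show "emb D U \<subseteq> emb D' U'"
  proof
    fix w assume "w \<in> emb D U"
    hence w: "w \<in> coord_sub (2 * n) 0 (n + D)" "quot_mat D *\<^sub>v w \<in> U" unfolding emb_def by auto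
    have "n + D \<le> n + D'" using D by simp
    hence "w \<in> coord_sub (2 * n) 0 (n + D')" using w(1) coord_sub_mono[of 0 0 "n + D" "n + D'" "2 * n"] by blast
    moreover have "quot_mat D' *\<^sub>v w \<in> U'" using quot_pr[OF D(2,3) w(1)] h w(2) by auto
    ultimately show "w \<in> emb D' U'" unfolding emb_def by simp
  qed
qed

lemma perp_emb_iff:
  assumes U: "U \<in> Gr (n + 1) D" and U': "U' \<in> Gr (n + 1) D'" and D: "1 \<le> D" "D \<le> n" "D + D' = n + 1"
  shows "perp (gram_W n) (emb D' U') = emb D U \<longleftrightarrow> perp (gram_V m) U' = U"
proof -
  have D': "1 \<le> D'" "D' \<le> n" using D by auto
  have dims: "(2 * D - 1) + (2 * D' - 1) = 2 * n" using D D' by auto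
  have im: "U = (\<lambda>w. quot_mat D *\<^sub>v w) ` emb D U" "U' = (\<lambda>w. quot_mat D' *\<^sub>v w) ` emb D' U'"
    using emb_image[OF lin_sub_Gr[OF U] D(1,2)] emb_image[OF lin_sub_Gr[OF U'] D'] by auto
  have fc: "w \<bullet> (gram_W n *\<^sub>v w') = (quot_mat D *\<^sub>v w) \<bullet> (gram_V m *\<^sub>v (quot_mat D' *\<^sub>v w'))"
    if "w \<in> emb D U" "w' \<in> emb D' U'" for w w'
    using form_compat[OF D] that unfolding emb_def by blast
  have "perp (gram_W n) (emb D' U') = emb D U \<longleftrightarrow> (\<forall>w\<in>emb D U. \<forall>w'\<in>emb D' U'. w \<bullet> (gram_W n *\<^sub>v w') = 0)"
    by (rule perp_eq_iff[OF gram_W_carrier gram_W_inj emb_Gr[OF U D(1,2)] emb_Gr[OF U' D'] dims])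
  also have "\<dots> \<longleftrightarrow> (\<forall>w\<in>emb D U. \<forall>w'\<in>emb D' U'. (quot_mat D *\<^sub>v w) \<bullet> (gram_V m *\<^sub>v (quot_mat D' *\<^sub>v w')) = 0)"
    by (intro ball_cong refl) (simp only: fc)
  also have "\<dots> \<longleftrightarrow> (\<forall>u\<in>U. \<forall>v\<in>U'. u \<bullet> (gram_V m *\<^sub>v v) = 0)"
    by (subst (2) im(1), subst (2) im(2)) (simp only: ball_simps)
  also have "\<dots> \<longleftrightarrow> perp (gram_V m) U' = U"
    by (rule perp_eq_iff[OF gram_V_carrier gram_V_inj U U' D(3), symmetric])
  finally show ?thesis .
qed

lemma SpFl_deg_iff: "V \<in> SpFl_deg m d s \<longleftrightarrow> V \<in> Gr_prod (n + 1) d s \<and> zeta V \<in> flags_Sp n d s"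
proof (cases "V \<in> Gr_prod (n + 1) d s")
  case V: True
  have z: "zeta V l = emb (d l) (V l)" if "l \<in> {1..s}" for l using that unfolding zeta_def by simp
  have "(\<forall>l\<in>{1..<s}. zeta V l \<subseteq> zeta V (l + 1)) \<longleftrightarrow> (\<forall>l\<in>{1..<s}. pr_range (d l) (d (l + 1)) ` V l \<subseteq> V (l + 1))"
  proof (rule ball_cong[OF refl])
    fix l assume "l \<in> {1..<s}"
    hence l: "l \<in> {1..s}" "l + 1 \<in> {1..s}" by auto
    have "d l \<le> d (l + 1)" using d_mono[OF l] by simp
    from emb_subset_iff[OF lin_sub_Gr[OF Gr_prodD[OF V l(1)]] d_ge[OF l(1)] this d_le[OF l(2)]]
    show "zeta V l \<subseteq> zeta V (l + 1) \<longleftrightarrow> pr_range (d l) (d (l + 1)) ` V l \<subseteq> V (l + 1)"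
      unfolding z[OF l(1)] z[OF l(2)] .
  qed
  moreover have "perp_involution (gram_W n) s (zeta V) = zeta V \<longleftrightarrow> perp_involution (gram_V m) s V = V"
    unfolding perp_involution_fixed_iff[OF V] perp_involution_fixed_iff[OF zeta_Gr_prod[OF V]]
  proof (rule ball_cong[OF refl])
    fix l assume l: "l \<in> {1..s}"
    note l' = dual_index(1)[OF l]
    from perp_emb_iff[OF Gr_prodD[OF V l] Gr_prodD[OF V l'] d_ge[OF l] d_le[OF l] d_dual[OF l]]
    show "perp (gram_W n) (zeta V (s + 1 - l)) = zeta V l \<longleftrightarrow> perp (gram_V m) (V (s + 1 - l)) = V l"
      unfolding z[OF l] z[OF l'] .
  qed
  ultimately show ?thesis
    using V zeta_Gr_prod[OF V] n_eq n_pos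
    unfolding SpFl_deg_def Fl_deg_def flags_Sp_def flags_SL_def by auto
next
  case False
  thus ?thesis using n_eq unfolding SpFl_deg_def Fl_deg_def by auto
qed

text \<open>The image of \<open>zeta\<close>, and also the Schubert variety.\<close>

definition bounded_flags_Sp :: "point set" where
  "bounded_flags_Sp = {W \<in> flags_Sp n d s. \<forall>l\<in>{1..s}. W l \<subseteq> coord_sub (2 * n) 0 (n + d l)}"

lemma flags_SL_Gr: "W \<in> flags_SL n d s \<Longrightarrow> W \<in> Gr_prod (2 * n) dW s"
  unfolding flags_SL_def by simp

lemma flags_Sp_Gr: "W \<in> flags_Sp n d s \<Longrightarrow> W \<in> Gr_prod (2 * n) dW s"
  unfolding flags_Sp_def flags_SL_def by simp

section \<open>The image\<close>

text \<open>\<open>W\<^sub>l\<close> is the orthogonal of \<open>W\<^bsub>s+1-l\<^esub>\<close>, which is contained in \<open>E\<^bsub>n+d\<^esub>\<close> for \<open>d = n + 1 - d\<^sub>l\<close>, and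
  the orthogonal of the latter is \<open>E\<^bsub>d\<^sub>l-1\<^esub>\<close>.\<close>

lemma coord_sub_le_flag:
  assumes W: "W \<in> bounded_flags_Sp" and l: "l \<in> {1..s}"
  shows "coord_sub (2 * n) 0 (d l - 1) \<subseteq> W l"
proof
  fix v :: "complex vec" assume v: "v \<in> coord_sub (2 * n) 0 (d l - 1)"
  note vc = coord_subD[OF v]
  have Wf: "W \<in> flags_Sp n d s" using W unfolding bounded_flags_Sp_def by simp
  have "perp (gram_W n) (W (s + 1 - l)) = W l"
    using Wf perp_involution_fixed_iff[OF flags_Sp_Gr[OF Wf]] l unfolding flags_Sp_def by blast
  moreover have "v \<bullet> (gram_W n *\<^sub>v u) = 0" if "u \<in> W (s + 1 - l)" for u
  proof -
    have u: "u \<in> coord_sub (2 * n) 0 (n + d (s + 1 - l))"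
      using that W dual_index(1)[OF l] unfolding bounded_flags_Sp_def by blast
    note uc = coord_subD[OF u]
    have "v \<bullet> (gram_W n *\<^sub>v u) = (\<Sum>i\<in>{0..<2 * n}. v $ i * (gram_W n *\<^sub>v u) $ i)"
      using gram_W_carrier unfolding scalar_prod_def by simp
    also have "\<dots> = 0"
    proof (rule sum.neutral, rule ballI)
      fix i assume "i \<in> {0..<2 * n}"
      hence i: "i < 2 * n" by simp
      show "v $ i * (gram_W n *\<^sub>v u) $ i = 0"
      proof (cases "i < d l - 1")
        case True
        hence "u $ (2 * n - 1 - i) = 0" using d_dual[OF l] i by (intro uc(3)) auto
        thus ?thesis using gram_W_index[OF uc(1) i] by simp
      next
        case False
        thus ?thesis using vc(3)[OF i] by simp
      qed
    qed
    finally show ?thesis .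
  qed
  ultimately show "v \<in> W l" using vc(1) gram_W_carrier unfolding perp_def by auto
qed

lemma zeta_inj_on: "inj_on zeta (Gr_prod (n + 1) d s)"
proof (rule inj_onI)
  fix U V assume U: "U \<in> Gr_prod (n + 1) d s" and V: "V \<in> Gr_prod (n + 1) d s" and eq: "zeta U = zeta V"
  show "U = V"
  proof (rule extensionalityI[OF Gr_prod_ext[OF U] Gr_prod_ext[OF V]])
    fix l assume l: "l \<in> {1..s}"
    have "emb (d l) (U l) = emb (d l) (V l)" using fun_cong[OF eq, of l] l unfolding zeta_def by simp
    thus "U l = V l"
      using emb_mono_iff[OF lin_sub_Gr[OF Gr_prodD[OF U l]] lin_sub_Gr[OF Gr_prodD[OF V l]] d_ge[OF l] d_le[OF l]]
      by blast
  qed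
qed

lemma zeta_surj:
  assumes W: "W \<in> Gr_prod (2 * n) dW s"
    and lo: "\<And>l. l \<in> {1..s} \<Longrightarrow> coord_sub (2 * n) 0 (d l - 1) \<subseteq> W l"
    and hi: "\<And>l. l \<in> {1..s} \<Longrightarrow> W l \<subseteq> coord_sub (2 * n) 0 (n + d l)"
  obtains V where "V \<in> Gr_prod (n + 1) d s" "zeta V = W"
proof -
  define V where "V = (\<lambda>l\<in>{1..s}. (\<lambda>w. quot_mat (d l) *\<^sub>v w) ` W l)"
  have Vl: "V l = (\<lambda>w. quot_mat (d l) *\<^sub>v w) ` W l" if "l \<in> {1..s}" for l using that unfolding V_def by simp
  have e: "emb (d l) (V l) = W l" if l: "l \<in> {1..s}" for l
    unfolding Vl[OF l] using emb_quot[OF lin_sub_Gr[OF Gr_prodD[OF W l]] d_ge[OF l] d_le[OF l] lo[OF l] hi[OF l]] .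
  have "V \<in> Gr_prod (n + 1) d s"
  proof (rule Gr_prodI)
    fix l assume l: "l \<in> {1..s}"
    have sub: "lin_sub (n + 1) (V l)"
      unfolding Vl[OF l] by (rule lin_sub_image[OF quot_mat_carrier lin_sub_Gr[OF Gr_prodD[OF W l]]])
    have "vdim (n + 1) (V l) + (d l - 1) = 2 * d l - 1"
      using vdim_emb[OF sub d_ge[OF l] d_le[OF l]] vdim_Gr[OF Gr_prodD[OF W l]] unfolding e[OF l] by simp
    thus "V l \<in> Gr (n + 1) (d l)" unfolding Gr_iff using sub d_ge[OF l] by simp
  qed (simp add: V_def)
  moreover have "zeta V = W"
  proof (rule extensionalityI[of _ "{1..s}"])
    show "zeta V \<in> extensional {1..s}" unfolding zeta_def by simp
    show "W \<in> extensional {1..s}" using Gr_prod_ext[OF W] .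
    fix l assume "l \<in> {1..s}"
    thus "zeta V l = W l" using e unfolding zeta_def by simp
  qed
  ultimately show ?thesis using that by blast
qed

lemma bij_betw_zeta: "bij_betw zeta (SpFl_deg m d s) bounded_flags_Sp"
proof -
  have "inj_on zeta (SpFl_deg m d s)" by (rule inj_on_subset[OF zeta_inj_on]) (auto simp: SpFl_deg_iff)
  moreover have "zeta ` SpFl_deg m d s = bounded_flags_Sp"
  proof (intro equalityI subsetI)
    fix W assume "W \<in> zeta ` SpFl_deg m d s"
    then obtain V where V: "V \<in> SpFl_deg m d s" "W = zeta V" by auto
    thus "W \<in> bounded_flags_Sp" unfolding bounded_flags_Sp_def using SpFl_deg_iff by (auto simp: zeta_def emb_def)
  next
    fix W assume W: "W \<in> bounded_flags_Sp"
    hence f: "W \<in> flags_Sp n d s" and hi: "\<And>l. l \<in> {1..s} \<Longrightarrow> W l \<subseteq> coord_sub (2 * n) 0 (n + d l)"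
      unfolding bounded_flags_Sp_def by auto
    obtain V where "V \<in> Gr_prod (n + 1) d s" "zeta V = W"
      using zeta_surj[OF flags_Sp_Gr[OF f] coord_sub_le_flag[OF W] hi] by blast
    thus "W \<in> zeta ` SpFl_deg m d s" using SpFl_deg_iff f by blast
  qed
  ultimately show ?thesis unfolding bij_betw_def by blast
qed

section \<open>Closedness of the symplectic flags\<close>

text \<open>With the involution in force, an inclusion \<open>U\<^sub>l \<subseteq> U\<^bsub>l+1\<^esub>\<close> says that \<open>U\<^sub>l\<close> is orthogonal to
  \<open>U\<^bsub>s-l\<^esub>\<close>; so all conditions are of the kind treated in \<open>closedin_isotropic\<close>.\<close>

lemma flags_Sp_eq_isotropic:
  "flags_Sp n d s = (\<Inter>(l,l')\<in>{(l,l'). l \<in> {1..s} \<and> (l' = s + 1 - l \<or> l' = s - l \<and> l < s)}.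
     {U \<in> Gr_prod (2 * n) dW s. \<forall>u\<in>U l. \<forall>v\<in>U l'. u \<bullet> (gram_W n *\<^sub>v v) = 0})" (is "_ = ?R")
proof (intro equalityI subsetI)
  fix U assume f: "U \<in> flags_Sp n d s"
  note UG = flags_Sp_Gr[OF f]
  have p: "perp (gram_W n) (U (s + 1 - l)) = U l" if "l \<in> {1..s}" for l
    using f perp_involution_fixed_iff[OF UG] that unfolding flags_Sp_def by blast
  have iso: "u \<bullet> (gram_W n *\<^sub>v v) = 0" if "l \<in> {1..s}" "u \<in> U l" "v \<in> U (s + 1 - l)" for l u v
    using that p[OF that(1)] unfolding perp_def by blast
  have "u \<bullet> (gram_W n *\<^sub>v v) = 0" if "l \<in> {1..s}" "l < s" "u \<in> U l" "v \<in> U (s - l)" for l u v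
  proof (rule iso[of "l + 1"])
    show "u \<in> U (l + 1)" using f that unfolding flags_Sp_def flags_SL_def by auto
  qed (use that in auto)
  thus "U \<in> ?R" using UG iso by auto
next
  fix U assume R: "U \<in> ?R"
  have iso: "u \<bullet> (gram_W n *\<^sub>v v) = 0" if "l \<in> {1..s}" "u \<in> U l" "v \<in> U (s + 1 - l)" for l u v
    using R that by blast
  have iso': "u \<bullet> (gram_W n *\<^sub>v v) = 0" if "l \<in> {1..s}" "l < s" "u \<in> U l" "v \<in> U (s - l)" for l u v
    using R that by blast
  have "1 \<in> {1..s}" using s1 by simp
  hence UG: "U \<in> Gr_prod (2 * n) dW s" using R by blast
  have p: "perp (gram_W n) (U (s + 1 - l)) = U l" if l: "l \<in> {1..s}" for l
  proof -
    have "(2 * d l - 1) + (2 * d (s + 1 - l) - 1) = 2 * n"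
      using d_dual[OF l] d_ge[OF l] d_ge[OF dual_index(1)[OF l]] by simp
    from perp_eq_iff[OF gram_W_carrier gram_W_inj Gr_prodD[OF UG l] Gr_prodD[OF UG dual_index(1)[OF l]] this]
    show ?thesis using iso[OF l] by blast
  qed
  have "U l \<subseteq> U (l + 1)" if l: "l \<in> {1..<s}" for l
  proof
    fix u assume u: "u \<in> U l"
    have "l \<in> {1..s}" using l by auto
    hence "u \<in> carrier_vec (2 * n)" using lin_subD(5)[OF lin_sub_Gr[OF Gr_prodD[OF UG]] u] by blast
    moreover have "\<forall>v\<in>U (s - l). u \<bullet> (gram_W n *\<^sub>v v) = 0" using iso'[of l u] u l by auto
    ultimately have "u \<in> perp (gram_W n) (U (s - l))" unfolding perp_def using gram_W_carrier by auto
    moreover have "s + 1 - (l + 1) = s - l" "l + 1 \<in> {1..s}" using l by auto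
    ultimately show "u \<in> U (l + 1)" using p[of "l + 1"] by simp
  qed
  thus "U \<in> flags_Sp n d s"
    using UG p perp_involution_fixed_iff[OF UG] unfolding flags_Sp_def flags_SL_def by blast
qed

lemma closedin_flags_Sp: "closedin (zariski (2 * n) dW s) (flags_Sp n d s)"
  unfolding flags_Sp_eq_isotropic
proof (rule closedin_INT)
  show "{(l,l'). l \<in> {1..s} \<and> (l' = s + 1 - l \<or> l' = s - l \<and> l < s)} \<noteq> {}"
    (is "?P \<noteq> {}")
  proof -
    have "(1, s) \<in> ?P" using s1 by simp
    thus ?thesis by blast
  qed
  fix p assume "p \<in> {(l,l'). l \<in> {1..s} \<and> (l' = s + 1 - l \<or> l' = s - l \<and> l < s)}"
  then obtain l l' where p: "p = (l,l')" "l \<in> {1..s}" and l'': "l' = s + 1 - l \<or> l' = s - l \<and> l < s" by auto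
  have p3: "l' \<in> {1..s}" using p(2) l'' by auto
  show "closedin (zariski (2 * n) dW s) (case p of (l,l') \<Rightarrow>
      {U \<in> Gr_prod (2 * n) dW s. \<forall>u\<in>U l. \<forall>v\<in>U l'. u \<bullet> (gram_W n *\<^sub>v v) = 0})"
    unfolding p(1) prod.case by (rule closedin_isotropic[OF p(2) p3 gram_W_carrier n_pos(3)])
qed

lemma closedin_bounded:
  "closedin (zariski (2 * n) dW s)
    {U \<in> Gr_prod (2 * n) dW s. \<forall>l\<in>{1..s}. U l \<subseteq> coord_sub (2 * n) 0 (n + d l)}"
proof -
  define P where "P = {(l,a). l \<in> {1..s} \<and> n + d l \<le> a \<and> a < 2 * n}"
  have eq: "{U \<in> Gr_prod (2 * n) dW s. \<forall>l\<in>{1..s}. U l \<subseteq> coord_sub (2 * n) 0 (n + d l)} =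
      Gr_prod (2 * n) dW s \<inter> (\<Inter>(l,a)\<in>P. {U \<in> Gr_prod (2 * n) dW s. \<forall>u\<in>U l. u $ a = 0})" (is "?A = ?B")
  proof (intro equalityI subsetI)
    fix U assume "U \<in> ?A"
    thus "U \<in> ?B" unfolding P_def coord_sub_def by blast
  next
    fix U assume U: "U \<in> ?B"
    have "u \<in> coord_sub (2 * n) 0 (n + d l)" if l: "l \<in> {1..s}" and u: "u \<in> U l" for l u
    proof -
      have "u \<in> carrier_vec (2 * n)"
      proof -
        have "U \<in> Gr_prod (2 * n) dW s" using U by blast
        from lin_subD(5)[OF lin_sub_Gr[OF Gr_prodD[OF this l]] u] show ?thesis .
      qed
      moreover have "u $ a = 0" if "a < 2 * n" "n + d l \<le> a" for a
        using U l u that unfolding P_def by blast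
      ultimately show ?thesis unfolding coord_sub_def by auto
    qed
    thus "U \<in> ?A" using U by blast
  qed
  have "closedin (zariski (2 * n) dW s) (Gr_prod (2 * n) dW s \<inter> \<Inter>((\<lambda>(l,a). {U \<in> Gr_prod (2 * n) dW s. \<forall>u\<in>U l. u $ a = 0}) ` P))"
  proof (cases "P = {}")
    case True
    thus ?thesis using closedin_topspace[of "zariski (2 * n) dW s"] unfolding topspace_zariski by simp
  next
    case False
    have "closedin (zariski (2 * n) dW s) (\<Inter>(l,a)\<in>P. {U \<in> Gr_prod (2 * n) dW s. \<forall>u\<in>U l. u $ a = 0})"
    proof (rule closedin_INT[OF False])
      fix p assume "p \<in> P"
      then obtain l a where p: "p = (l,a)" "l \<in> {1..s}" "a < 2 * n" unfolding P_def by auto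
      show "closedin (zariski (2 * n) dW s) (case p of (l,a) \<Rightarrow> {U \<in> Gr_prod (2 * n) dW s. \<forall>u\<in>U l. u $ a = 0})"
        unfolding p(1) prod.case by (rule closedin_vanishing[OF p(2,3)])
    qed
    thus ?thesis using closedin_topspace[of "zariski (2 * n) dW s"] unfolding topspace_zariski by blast
  qed
  thus ?thesis unfolding eq by simp
qed

section \<open>The permutation\<close>

lemma d_ext_less: "i < i' \<Longrightarrow> i' \<le> s + 1 \<Longrightarrow> d i < d i'"
proof -
  assume h: "i < i'" "i' \<le> s + 1"
  consider "i = 0" "i' = s + 1" | "i = 0" "i' \<in> {1..s}" | "i \<in> {1..s}" "i' = s + 1" | "i \<in> {1..s}" "i' \<in> {1..s}"
    using h by force
  thus "d i < d i'"
  proof cases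
    case 1 thus ?thesis using d0 d_last by simp
  next
    case 2 thus ?thesis using d0 d_ge[of i'] by simp
  next
    case 3 thus ?thesis using d_last d_le[of i] by simp
  next
    case 4 thus ?thesis using d_less h by blast
  qed
qed

lemma d_ext_mono: "i \<le> i' \<Longrightarrow> i' \<le> s + 1 \<Longrightarrow> d i \<le> d i'"
  using d_ext_less[of i i'] by (cases "i = i'") auto

lemma block_exists:
  assumes k: "k \<le> 2 * n"
  obtains i where "i \<le> s" "2 * d i \<le> k" "k < 2 * d (i + 1)"
proof -
  define S where "S = {i. i \<le> s \<and> 2 * d i \<le> k}"
  have S: "finite S" "0 \<in> S" unfolding S_def using d0 by auto
  have M: "Max S \<in> S" using Max_in[OF S(1)] S(2) by blast
  have "k < 2 * d (Max S + 1)"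
  proof (cases "Max S = s")
    case True thus ?thesis using d_last k by simp
  next
    case False
    hence "Max S + 1 \<le> s" using M unfolding S_def by simp
    moreover have "Max S + 1 \<notin> S" using Max_ge[OF S(1), of "Max S + 1"] by auto
    ultimately show ?thesis unfolding S_def by simp
  qed
  thus ?thesis using that M unfolding S_def by blast
qed

lemma block_unique:
  assumes "i \<le> s" "i' \<le> s" "d i \<le> k" "k < d (i + 1)" "d i' \<le> k" "k < d (i' + 1)"
  shows "i = i'"
proof (rule ccontr)
  assume "i \<noteq> i'"
  hence "i + 1 \<le> i' \<or> i' + 1 \<le> i" by auto
  thus False using d_ext_mono[of "i + 1" i'] d_ext_mono[of "i' + 1" i] assms by auto
qed

lemma sigma_eq:
  assumes k: "k \<in> {1..2 * n}" and i: "i \<le> s" "2 * d i \<le> k" "k < 2 * d (i + 1)"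
  shows "sigma n d s k = (if k < d i + d (i + 1) then k - d i else n + 1 + k - d (i + 1))"
proof -
  have iff: "(k \<in> {2 * d i'..d i' + d (i' + 1) - 1} \<and> j = k - d i') \<or>
        (k \<in> {d i' + d (i' + 1)..2 * d (i' + 1) - 1} \<and> j = n + 1 + k - d (i' + 1))
      \<longleftrightarrow> 2 * d i' \<le> k \<and> k < 2 * d (i' + 1) \<and>
        j = (if k < d i' + d (i' + 1) then k - d i' else n + 1 + k - d (i' + 1))" if "i' \<le> s" for i' j
  proof -
    have "d i' < d (i' + 1)" using d_ext_less[of i' "i' + 1"] that by simp
    thus ?thesis by auto
  qed
  have uniq: "i' = i" if "i' \<le> s" "2 * d i' \<le> k" "k < 2 * d (i' + 1)" for i'
  proof (rule ccontr)
    assume "i' \<noteq> i"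
    hence "i + 1 \<le> i' \<or> i' + 1 \<le> i" by auto
    thus False using d_ext_mono[of "i + 1" i'] d_ext_mono[of "i' + 1" i] that i by auto
  qed
  have "(THE j. \<exists>i'\<le>s. (k \<in> {2 * d i'..d i' + d (i' + 1) - 1} \<and> j = k - d i') \<or>
        (k \<in> {d i' + d (i' + 1)..2 * d (i' + 1) - 1} \<and> j = n + 1 + k - d (i' + 1)))
      = (if k < d i + d (i + 1) then k - d i else n + 1 + k - d (i + 1))"
  proof (rule the_equality)
    show "\<exists>i'\<le>s. (k \<in> {2 * d i'..d i' + d (i' + 1) - 1} \<and> (if k < d i + d (i + 1) then k - d i else n + 1 + k - d (i + 1)) = k - d i') \<or>
        (k \<in> {d i' + d (i' + 1)..2 * d (i' + 1) - 1} \<and> (if k < d i + d (i + 1) then k - d i else n + 1 + k - d (i + 1)) = n + 1 + k - d (i' + 1))"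
      by (rule exI[of _ i]) (use iff[OF i(1)] i in blast)
  next
    fix j assume "\<exists>i'\<le>s. (k \<in> {2 * d i'..d i' + d (i' + 1) - 1} \<and> j = k - d i') \<or>
        (k \<in> {d i' + d (i' + 1)..2 * d (i' + 1) - 1} \<and> j = n + 1 + k - d (i' + 1))"
    then obtain i' where i': "i' \<le> s" "2 * d i' \<le> k \<and> k < 2 * d (i' + 1) \<and>
        j = (if k < d i' + d (i' + 1) then k - d i' else n + 1 + k - d (i' + 1))" using iff by blast
    hence "i' = i" using uniq by blast
    thus "j = (if k < d i + d (i + 1) then k - d i else n + 1 + k - d (i + 1))" using i'(2) by blast
  qed
  thus ?thesis unfolding sigma_def using k by (simp only: if_True)
qed

text \<open>\<open>sigma\<close> interleaves the blocks of \<open>{1..n}\<close> with those of \<open>{n+1..2n}\<close>, and is increasing on the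
  positions of either kind.\<close>

lemma sigma_cases:
  assumes k: "k \<in> {1..2 * n}"
  obtains i where "i \<le> s" "2 * d i \<le> k" "k < 2 * d (i + 1)" "1 \<le> sigma n d s k"
      "d i \<le> sigma n d s k" "sigma n d s k < d (i + 1)" "sigma n d s k \<le> n" "k = sigma n d s k + d i"
  | i where "i \<le> s" "2 * d i \<le> k" "k < 2 * d (i + 1)"
      "n + 1 + d i \<le> sigma n d s k" "sigma n d s k < n + 1 + d (i + 1)" "sigma n d s k \<le> 2 * n"
      "k + (n + 1) = sigma n d s k + d (i + 1)"
proof -
  obtain i where i: "i \<le> s" "2 * d i \<le> k" "k < 2 * d (i + 1)" using block_exists[of k] k by auto
  have dd: "d i < d (i + 1)" "d (i + 1) \<le> n + 1"
    using d_ext_less[of i "i + 1"] d_ext_mono[of "i + 1" "s + 1"] d_last i(1) by auto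
  note e = sigma_eq[OF k i]
  show ?thesis
  proof (cases "k < d i + d (i + 1)")
    case True
    hence "sigma n d s k = k - d i" using e by simp
    thus ?thesis using that(1)[OF i] True i dd k d0 by auto
  next
    case False
    hence v: "sigma n d s k = n + 1 + k - d (i + 1)" using e by simp
    have "n + 1 + k - d (i + 1) \<le> 2 * n"
    proof (cases "i = s")
      case True thus ?thesis using d_last k by simp
    next
      case False
      hence "d (i + 1) \<le> n" using d_le[of "i + 1"] i(1) by auto
      thus ?thesis using i(3) by simp
    qed
    thus ?thesis using that(2)[OF i] v False i dd k by auto
  qed
qed

lemma sigma_inj_on: "inj_on (sigma n d s) {1..2 * n}"
proof (rule inj_onI)
  fix k k' assume k: "k \<in> {1..2 * n}" and k': "k' \<in> {1..2 * n}" and eq: "sigma n d s k = sigma n d s k'"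
  show "k = k'"
  proof (cases rule: sigma_cases[OF k])
    case (1 i)
    show ?thesis
    proof (cases rule: sigma_cases[OF k'])
      case (1 i')
      have "i = i'" using block_unique[of i i' "sigma n d s k"] 1 \<open>i \<le> s\<close> \<open>d i \<le> sigma n d s k\<close>
          \<open>sigma n d s k < d (i + 1)\<close> eq by simp
      thus ?thesis using 1 \<open>k = sigma n d s k + d i\<close> eq by simp
    qed (use 1 eq in simp)
  next
    case (2 i)
    show ?thesis
    proof (cases rule: sigma_cases[OF k'])
      case (2 i')
      have "i = i'" using block_unique[of i i' "sigma n d s k - (n + 1)"] 2 \<open>i \<le> s\<close>
          \<open>n + 1 + d i \<le> sigma n d s k\<close> \<open>sigma n d s k < n + 1 + d (i + 1)\<close> eq by simp
      thus ?thesis using 2 \<open>k + (n + 1) = sigma n d s k + d (i + 1)\<close> eq by simp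
    qed (use 2 eq in simp)
  qed
qed

lemma sigma_range: "k \<in> {1..2 * n} \<Longrightarrow> sigma n d s k \<in> {1..2 * n}"
  by (cases k rule: sigma_cases) auto

lemma sigma_permutes: "sigma n d s permutes {1..2 * n}"
proof (rule bij_imp_permutes)
  have "sigma n d s ` {1..2 * n} = {1..2 * n}"
    by (rule endo_inj_surj) (use sigma_range sigma_inj_on in auto)
  thus "bij_betw (sigma n d s) {1..2 * n} {1..2 * n}" using sigma_inj_on unfolding bij_betw_def by blast
  show "sigma n d s k = k" if "k \<notin> {1..2 * n}" for k
    unfolding sigma_def using that by (simp only: if_False)
qed

text \<open>The positions before \<open>2 d\<^sub>l\<close> make up complete blocks, so the values fall into the two intervals;
  equality follows by counting.\<close>

lemma sigma_image:
  assumes l: "l \<in> {1..s}"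
  shows "(\<lambda>k. sigma n d s k - 1) ` {1..2 * d l - 1} = {..<d l - 1} \<union> {n..<n + d l}"
proof (rule card_subset_eq)
  have sub: "{1..2 * d l - 1} \<subseteq> {1..2 * n}" using d_le[OF l] by auto
  show "(\<lambda>k. sigma n d s k - 1) ` {1..2 * d l - 1} \<subseteq> {..<d l - 1} \<union> {n..<n + d l}"
  proof
    fix x assume "x \<in> (\<lambda>k. sigma n d s k - 1) ` {1..2 * d l - 1}"
    then obtain k where k: "k \<in> {1..2 * d l - 1}" "x = sigma n d s k - 1" by auto
    have k2: "k \<in> {1..2 * n}" using k(1) sub by blast
    have il: "d (i + 1) \<le> d l" if "i \<le> s" "2 * d i \<le> k" for i
    proof -
      have "i < l"
      proof (rule ccontr)
        assume "\<not> i < l"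
        hence "d l \<le> d i" using d_ext_mono[of l i] that by simp
        thus False using k(1) that d_ge[OF l] by auto
      qed
      thus ?thesis using d_ext_mono[of "i + 1" l] l by auto
    qed
    show "x \<in> {..<d l - 1} \<union> {n..<n + d l}"
    proof (cases rule: sigma_cases[OF k2])
      case (1 i)
      thus ?thesis using il[of i] k(2) by auto
    next
      case (2 i)
      thus ?thesis using il[of i] k(2) by auto
    qed
  qed
  have "inj_on (\<lambda>k. sigma n d s k - 1) {1..2 * d l - 1}"
  proof (rule inj_onI)
    fix k k' assume k: "k \<in> {1..2 * d l - 1}" "k' \<in> {1..2 * d l - 1}" "sigma n d s k - 1 = sigma n d s k' - 1"
    have "k \<in> {1..2 * n}" "k' \<in> {1..2 * n}" using k sub by auto
    moreover from this have "sigma n d s k = sigma n d s k'" using sigma_range[of k] sigma_range[of k'] k(3) by auto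
    ultimately show "k = k'" using sigma_inj_on unfolding inj_on_def by blast
  qed
  hence "card ((\<lambda>k. sigma n d s k - 1) ` {1..2 * d l - 1}) = 2 * d l - 1" by (simp add: card_image)
  moreover have "card ({..<d l - 1} \<union> {n..<n + d l}) = (d l - 1) + d l"
    using d_le[OF l] by (subst card_Un_disjoint) auto
  ultimately show "card ((\<lambda>k. sigma n d s k - 1) ` {1..2 * d l - 1}) = card ({..<d l - 1} \<union> {n..<n + d l})"
    using d_ge[OF l] by simp
qed simp

definition coord_mat :: "nat \<Rightarrow> complex mat" where
  "coord_mat l = mat (2 * n) (2 * d l - 1) (\<lambda>(i,j). if i + 1 = sigma n d s (j + 1) then 1 else 0)"

lemma coord_mat_carrier: "coord_mat l \<in> carrier_mat (2 * n) (2 * d l - 1)"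
  unfolding coord_mat_def by simp

lemma col_coord_mat:
  assumes l: "l \<in> {1..s}" and j: "j < 2 * d l - 1"
  shows "col (coord_mat l) j = unit_vec (2 * n) (sigma n d s (j + 1) - 1)"
proof -
  have "j + 1 \<in> {1..2 * n}" using d_le[OF l] j by auto
  hence "sigma n d s (j + 1) \<in> {1..2 * n}" by (rule sigma_range)
  thus ?thesis using j unfolding coord_mat_def by (intro eq_vecI) auto
qed

lemma coord_flag_eq:
  assumes l: "l \<in> {1..s}"
  shows "coord_flag n d s (sigma n d s) l = colsp (coord_mat l)"
proof -
  have "set (cols (coord_mat l)) = (\<lambda>j. unit_vec (2 * n) (sigma n d s (j + 1) - 1)) ` {0..<2 * d l - 1}"
    unfolding cols_def using col_coord_mat[OF l] coord_mat_carrier[of l] by (auto simp: image_iff)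
  also have "\<dots> = (\<lambda>k. unit_vec (2 * n) (sigma n d s k - 1)) ` (\<lambda>j. j + 1) ` {0..<2 * d l - 1}"
    unfolding image_image ..
  also have "(\<lambda>j. j + 1) ` {0..<2 * d l - 1} = {1..2 * d l - 1}"
    using image_Suc_atLeastLessThan[of 0 "2 * d l - 1"] by (simp add: atLeastLessThanSuc_atLeastAtMost)
  finally have "set (cols (coord_mat l)) = (\<lambda>k. unit_vec (2 * n) (sigma n d s k - 1)) ` {1..2 * d l - 1}" .
  thus ?thesis
    using l col_space_eq_colsp[OF coord_mat_carrier, of l] unfolding coord_flag_def vec_space.col_space_def by simp
qed

lemma frame_coord_mat:
  assumes l: "l \<in> {1..s}"
  shows "frame (2 * n) (2 * d l - 1) (coord_mat l)"
proof (rule frame_if_inj[OF coord_mat_carrier])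
  fix x assume x: "x \<in> carrier_vec (2 * d l - 1)" "coord_mat l *\<^sub>v x = 0\<^sub>v (2 * n)"
  show "x = 0\<^sub>v (2 * d l - 1)"
  proof (rule eq_vecI)
    fix j assume "j < dim_vec (0\<^sub>v (2 * d l - 1) :: complex vec)"
    hence j: "j < 2 * d l - 1" by simp
    have jn: "j + 1 \<in> {1..2 * n}" using d_le[OF l] j by auto
    have r: "sigma n d s (j + 1) \<in> {1..2 * n}" by (rule sigma_range[OF jn])
    have "(coord_mat l *\<^sub>v x) $ (sigma n d s (j + 1) - 1) = 1 * x $ j"
    proof (rule mult_mat_vec_single[OF coord_mat_carrier x(1) _ j])
      show "sigma n d s (j + 1) - 1 < 2 * n" using r by auto
      fix i assume i: "i < 2 * d l - 1"
      have inn: "i + 1 \<in> {1..2 * n}" using d_le[OF l] i by auto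
      have "sigma n d s (j + 1) = sigma n d s (i + 1) \<longleftrightarrow> i = j"
        using inj_onD[OF sigma_inj_on _ jn inn] by auto
      thus "coord_mat l $$ (sigma n d s (j + 1) - 1, i) = (if i = j then 1 else 0)"
        using r i unfolding coord_mat_def by auto
    qed
    moreover have "sigma n d s (j + 1) - 1 < 2 * n" using r by auto
    ultimately show "x $ j = 0\<^sub>v (2 * d l - 1) $ j" unfolding x(2) using j by simp
  qed (use x in simp)
qed

section \<open>The Borel orbit\<close>

definition orbit :: "point set" where
  "orbit = (\<lambda>A. act_W s A (coord_flag n d s (sigma n d s))) ` borel_SL n"

text \<open>The columns of \<open>A\<close> at the positions of the coordinate flag lie in \<open>W l\<close>; they are independent and of
  the right number.\<close>

lemma act_W_coord_flag:
  assumes W: "W \<in> Gr_prod (2 * n) (\<lambda>l. 2 * d l - 1) s" and A: "A \<in> SL (2 * n)"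
    and c: "\<And>l i. l \<in> {1..s} \<Longrightarrow> i < d l - 1 \<or> n \<le> i \<and> i < n + d l \<Longrightarrow> col A i \<in> W l"
  shows "act_W s A (coord_flag n d s (sigma n d s)) = W"
proof (rule extensionalityI[of _ "{1..s}"])
  show "act_W s A (coord_flag n d s (sigma n d s)) \<in> extensional {1..s}" unfolding act_W_def by simp
  show "W \<in> extensional {1..s}" using W unfolding Gr_prod_def by (simp add: PiE_iff)
  fix l assume l: "l \<in> {1..s}"
  have Ac: "A \<in> carrier_mat (2 * n) (2 * n)" and dA: "det A \<noteq> 0" using A unfolding SL_def by auto
  note Mc = coord_mat_carrier[of l]
  have AM: "A * coord_mat l \<in> carrier_mat (2 * n) (2 * d l - 1)" using Ac Mc by simp
  have W_l: "W l \<in> Gr (2 * n) (2 * d l - 1)" using Gr_prodD[OF W l] .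
  hence lW: "lin_sub (2 * n) (W l)" "vdim (2 * n) (W l) = 2 * d l - 1" unfolding Gr_iff by auto
  have "colsp (A * coord_mat l) \<subseteq> W l"
  proof (rule colsp_subsetI[OF AM lW(1)])
    fix j assume j: "j < 2 * d l - 1"
    have jn: "j + 1 \<in> {1..2 * d l - 1}" using j by auto
    hence i: "sigma n d s (j + 1) - 1 \<in> {..<d l - 1} \<union> {n..<n + d l}"
      using sigma_image[OF l] by blast
    hence i2: "sigma n d s (j + 1) - 1 < 2 * n" using d_le[OF l] by auto
    have "col (A * coord_mat l) j = A *\<^sub>v col (coord_mat l) j" by (rule col_mult2[OF Ac Mc j])
    also have "\<dots> = col A (sigma n d s (j + 1) - 1)"
      unfolding col_coord_mat[OF l j] by (rule mult_unit_vec[OF Ac i2])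
    finally show "col (A * coord_mat l) j \<in> W l" using c[OF l, of "sigma n d s (j + 1) - 1"] i by auto
  qed
  moreover have "vdim (2 * n) (colsp (A * coord_mat l)) = 2 * d l - 1"
  proof -
    have "colsp (A * coord_mat l) \<in> Gr (2 * n) (2 * d l - 1)"
      unfolding image_colsp[OF Ac Mc, symmetric]
    proof (rule Gr_image[OF Ac _ frame_Gr[OF frame_coord_mat[OF l]]])
      fix v assume "v \<in> carrier_vec (2 * n)" "A *\<^sub>v v = 0\<^sub>v (2 * n)"
      thus "v = 0\<^sub>v (2 * n)" using det_0_iff_vec_prod_zero[OF Ac] dA by blast
    qed
    thus ?thesis unfolding Gr_iff by simp
  qed
  ultimately have "colsp (A * coord_mat l) = W l"
    using lin_sub_eqI[OF lin_sub_colsp[OF AM] lW(1)] lW(2) by simp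
  thus "act_W s A (coord_flag n d s (sigma n d s)) l = W l"
    using l coord_flag_eq[OF l] image_colsp[OF Ac Mc] unfolding act_W_def by simp
qed

lemma orbit_bounded:
  assumes "U \<in> orbit" "l \<in> {1..s}"
  shows "U l \<subseteq> coord_sub (2 * n) 0 (n + d l)"
proof -
  obtain A where A: "A \<in> borel_SL n" "U = act_W s A (coord_flag n d s (sigma n d s))"
    using assms(1) unfolding orbit_def by auto
  have Ac: "A \<in> carrier_mat (2 * n) (2 * n)" and ut: "upper_triangular A"
    using A(1) unfolding borel_SL_def SL_def by auto
  note Mc = coord_mat_carrier[of l]
  have cm: "colsp (coord_mat l) \<subseteq> coord_sub (2 * n) 0 (n + d l)"
  proof (rule colsp_subsetI[OF Mc lin_sub_coord_sub])
    fix j assume j: "j < 2 * d l - 1"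
    hence "sigma n d s (j + 1) - 1 \<in> {..<d l - 1} \<union> {n..<n + d l}"
      using sigma_image[OF assms(2)] by (metis (no_types, lifting) One_nat_def Suc_eq_plus1 Suc_leI atLeastAtMost_iff image_eqI le_add2)
    hence "sigma n d s (j + 1) - 1 < n + d l" by auto
    thus "col (coord_mat l) j \<in> coord_sub (2 * n) 0 (n + d l)"
      unfolding col_coord_mat[OF assms(2) j] coord_sub_def unit_vec_def by auto
  qed
  show ?thesis
  proof
    fix u assume "u \<in> U l"
    then obtain v where v: "v \<in> coord_sub (2 * n) 0 (n + d l)" "u = A *\<^sub>v v"
      using A(2) assms(2) coord_flag_eq[OF assms(2)] cm unfolding act_W_def by auto
    note vc = coord_subD[OF v(1)]
    have "u $ i = 0" if i: "i < 2 * n" "n + d l \<le> i" for i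
    proof -
      have "u $ i = (\<Sum>j\<in>{0..<2 * n}. A $$ (i,j) * v $ j)"
        unfolding v(2) using Ac vc(1) i by (simp add: scalar_prod_def)
      also have "\<dots> = 0"
      proof (rule sum.neutral, rule ballI)
        fix j assume "j \<in> {0..<2 * n}"
        thus "A $$ (i,j) * v $ j = 0" using upper_triangularD[OF ut, of j i] vc(3)[of j] Ac i by (cases "j < i") auto
      qed
      finally show ?thesis .
    qed
    thus "u \<in> coord_sub (2 * n) 0 (n + d l)"
      using mult_mat_vec_carrier[OF Ac vc(1)] unfolding coord_sub_def v(2) by simp
  qed
qed

section \<open>Density of the orbit\<close>

text \<open>The whole Schubert variety in the flag variety of the special linear group; the degeneration
  argument needs room outside the symplectic flags.\<close>

definition bounded_flags :: "point set" where
  "bounded_flags = {W \<in> flags_SL n d s. \<forall>l\<in>{1..s}.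
     coord_sub (2 * n) 0 (d l - 1) \<subseteq> W l \<and> W l \<subseteq> coord_sub (2 * n) 0 (n + d l)}"

text \<open>\<open>W l\<close> contains a vector congruent to the basis vector \<open>j\<close> modulo the first \<open>n\<close> basis vectors.\<close>

definition hits :: "point \<Rightarrow> nat \<Rightarrow> nat \<Rightarrow> bool" where
  "hits W l j \<longleftrightarrow> (\<exists>w\<in>W l. w $ j = 1 \<and> (\<forall>i. n \<le> i \<and> i < 2 * n \<and> i \<noteq> j \<longrightarrow> w $ i = 0))"

text \<open>Minimal exactly on the generic flags.\<close>

definition excess :: "point \<Rightarrow> nat" where
  "excess W = (\<Sum>l\<in>{1..s}. vdim (2 * n) (W l \<inter> coord_sub (2 * n) 0 n))"

lemma bounded_flagsD:
  assumes "W \<in> bounded_flags"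
  shows "W \<in> Gr_prod (2 * n) dW s" "l \<in> {1..s} \<Longrightarrow> coord_sub (2 * n) 0 (d l - 1) \<subseteq> W l"
    "l \<in> {1..s} \<Longrightarrow> W l \<subseteq> coord_sub (2 * n) 0 (n + d l)" "l \<in> {1..s} \<Longrightarrow> lin_sub (2 * n) (W l)"
    "l \<in> {1..s} \<Longrightarrow> vdim (2 * n) (W l) = 2 * d l - 1" "l \<in> {1..s} \<Longrightarrow> u \<in> W l \<Longrightarrow> u \<in> carrier_vec (2 * n)"
proof -
  show G: "W \<in> Gr_prod (2 * n) dW s" using assms flags_SL_Gr unfolding bounded_flags_def by blast
  show "l \<in> {1..s} \<Longrightarrow> coord_sub (2 * n) 0 (d l - 1) \<subseteq> W l" "l \<in> {1..s} \<Longrightarrow> W l \<subseteq> coord_sub (2 * n) 0 (n + d l)"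
    using assms unfolding bounded_flags_def by auto
  show L: "l \<in> {1..s} \<Longrightarrow> lin_sub (2 * n) (W l)" "l \<in> {1..s} \<Longrightarrow> vdim (2 * n) (W l) = 2 * d l - 1"
    using Gr_prodD[OF G] unfolding Gr_iff by auto
  show "l \<in> {1..s} \<Longrightarrow> u \<in> W l \<Longrightarrow> u \<in> carrier_vec (2 * n)" using lin_subD(5)[OF L(1)] by blast
qed

lemma flag_mono:
  assumes W: "W \<in> flags_SL n d s" and l: "l \<in> {1..s}" "l' \<in> {1..s}" "l \<le> l'"
  shows "W l \<subseteq> W l'"
  using l(3,2)
proof (induction l' rule: dec_induct)
  case (step k)
  have "k \<in> {1..<s}" using step l(1) by auto
  hence "W k \<subseteq> W (k + 1)" using W unfolding flags_SL_def by blast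
  moreover have "W l \<subseteq> W k" using step l(1) by auto
  ultimately show ?case by simp
qed simp

definition upper_proj :: "complex mat" where
  "upper_proj = mat (2 * n) (2 * n) (\<lambda>(i,j). if i = j \<and> n \<le> i then 1 else 0)"

lemma upper_proj_carrier: "upper_proj \<in> carrier_mat (2 * n) (2 * n)"
  unfolding upper_proj_def by simp

lemma upper_proj_index:
  assumes "w \<in> carrier_vec (2 * n)" "i < 2 * n"
  shows "(upper_proj *\<^sub>v w) $ i = (if n \<le> i then w $ i else 0)"
proof -
  have "(upper_proj *\<^sub>v w) $ i = (if n \<le> i then 1 else 0) * w $ i"
    by (rule mult_mat_vec_single[OF upper_proj_carrier assms assms(2)])
      (use assms in \<open>auto simp: upper_proj_def\<close>)
  thus ?thesis by simp
qed

lemma upper_proj_dims: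
  assumes W: "W \<in> bounded_flags" and l: "l \<in> {1..s}"
  shows "vdim (2 * n) ((\<lambda>w. upper_proj *\<^sub>v w) ` W l) + vdim (2 * n) (W l \<inter> coord_sub (2 * n) 0 n) = 2 * d l - 1"
    and "(\<lambda>w. upper_proj *\<^sub>v w) ` W l \<subseteq> coord_sub (2 * n) n (n + d l)"
    and "\<And>j. n \<le> j \<Longrightarrow> j < 2 * n \<Longrightarrow> unit_vec (2 * n) j \<in> (\<lambda>w. upper_proj *\<^sub>v w) ` W l \<longleftrightarrow> hits W l j"
proof -
  have ker: "{u \<in> W l. upper_proj *\<^sub>v u = 0\<^sub>v (2 * n)} = W l \<inter> coord_sub (2 * n) 0 n"
  proof -
    have "upper_proj *\<^sub>v u = 0\<^sub>v (2 * n) \<longleftrightarrow> u \<in> coord_sub (2 * n) 0 n" if "u \<in> W l" for u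
    proof -
      have u: "u \<in> carrier_vec (2 * n)" using bounded_flagsD(6)[OF W l that] .
      have "upper_proj *\<^sub>v u = 0\<^sub>v (2 * n) \<longleftrightarrow> (\<forall>i<2 * n. (upper_proj *\<^sub>v u) $ i = 0)"
        using upper_proj_carrier by (auto simp: vec_eq_iff simp del: index_mult_mat_vec)
      also have "\<dots> \<longleftrightarrow> u \<in> coord_sub (2 * n) 0 n"
        using u upper_proj_index[OF u] unfolding coord_sub_def by auto
      finally show ?thesis .
    qed
    thus ?thesis by auto
  qed
  show "vdim (2 * n) ((\<lambda>w. upper_proj *\<^sub>v w) ` W l) + vdim (2 * n) (W l \<inter> coord_sub (2 * n) 0 n) = 2 * d l - 1"
    using rank_nullity[OF upper_proj_carrier bounded_flagsD(4)[OF W l]] bounded_flagsD(5)[OF W l] unfolding ker by simp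
  show "(\<lambda>w. upper_proj *\<^sub>v w) ` W l \<subseteq> coord_sub (2 * n) n (n + d l)"
  proof
    fix x assume "x \<in> (\<lambda>w. upper_proj *\<^sub>v w) ` W l"
    then obtain w where w: "w \<in> W l" "x = upper_proj *\<^sub>v w" by auto
    have wc: "w \<in> carrier_vec (2 * n)" using bounded_flagsD(6)[OF W l w(1)] .
    have "w \<in> coord_sub (2 * n) 0 (n + d l)" using bounded_flagsD(3)[OF W l] w(1) by blast
    thus "x \<in> coord_sub (2 * n) n (n + d l)"
      using mult_mat_vec_carrier[OF upper_proj_carrier wc] upper_proj_index[OF wc]
      unfolding w(2) coord_sub_def by auto
  qed
  show "unit_vec (2 * n) j \<in> (\<lambda>w. upper_proj *\<^sub>v w) ` W l \<longleftrightarrow> hits W l j" if j: "n \<le> j" "j < 2 * n" for j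
  proof -
    have "unit_vec (2 * n) j = upper_proj *\<^sub>v w \<longleftrightarrow> w $ j = 1 \<and> (\<forall>i. n \<le> i \<and> i < 2 * n \<and> i \<noteq> j \<longrightarrow> w $ i = 0)"
      if "w \<in> W l" for w
    proof -
      have w: "w \<in> carrier_vec (2 * n)" using bounded_flagsD(6)[OF W l that] .
      have "unit_vec (2 * n) j = upper_proj *\<^sub>v w \<longleftrightarrow>
          (\<forall>i<2 * n. (if i = j then 1 else 0) = (upper_proj *\<^sub>v w) $ i)"
        using upper_proj_carrier j by (auto simp: vec_eq_iff simp del: index_mult_mat_vec)
      also have "\<dots> \<longleftrightarrow> (\<forall>i<2 * n. (if i = j then 1 else 0) = (if n \<le> i then w $ i else 0))"
        using upper_proj_index[OF w] by auto
      also have "\<dots> \<longleftrightarrow> w $ j = 1 \<and> (\<forall>i. n \<le> i \<and> i < 2 * n \<and> i \<noteq> j \<longrightarrow> w $ i = 0)"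
        using j by (auto split: if_splits)
      finally show ?thesis .
    qed
    thus ?thesis unfolding hits_def by (auto simp: image_iff)
  qed
qed

lemma excess_vector:
  assumes W: "W \<in> bounded_flags" and l: "l \<in> {1..s}" and j: "n \<le> j" "j < n + d l" "\<not> hits W l j"
  obtains x where "x \<in> W l" "x \<in> coord_sub (2 * n) 0 n" "x \<notin> coord_sub (2 * n) 0 (d l - 1)"
proof -
  have jn: "j < 2 * n" using j d_le[OF l] by simp
  let ?P = "(\<lambda>w. upper_proj *\<^sub>v w) ` W l"
  have "unit_vec (2 * n) j \<in> coord_sub (2 * n) n (n + d l)" using j jn unfolding coord_sub_def by auto
  hence "?P \<subset> coord_sub (2 * n) n (n + d l)"
    using upper_proj_dims(2)[OF W l] upper_proj_dims(3)[OF W l j(1) jn] j(3) by blast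
  hence "vdim (2 * n) ?P < vdim (2 * n) (coord_sub (2 * n) n (n + d l) :: complex vec set)"
    by (rule vdim_strict_mono[OF lin_sub_image[OF upper_proj_carrier bounded_flagsD(4)[OF W l]] lin_sub_coord_sub])
  also have "vdim (2 * n) (coord_sub (2 * n) n (n + d l) :: complex vec set) = d l"
    by (subst vdim_coord_sub) (use d_le[OF l] in auto)
  finally have lt: "d l - 1 < vdim (2 * n) (W l \<inter> coord_sub (2 * n) 0 n)"
    using upper_proj_dims(1)[OF W l] d_ge[OF l] by linarith
  have "vdim (2 * n) (coord_sub (2 * n) 0 (d l - 1) :: complex vec set) = d l - 1"
    by (subst vdim_coord_sub) (use d_le[OF l] in auto)
  moreover have "vdim (2 * n) (coord_sub (2 * n) 0 (d l - 1) :: complex vec set) = d l - 1 \<Longrightarrow>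
    \<not> W l \<inter> coord_sub (2 * n) 0 n \<subseteq> coord_sub (2 * n) 0 (d l - 1)"
  proof (intro notI)
    assume eq: "vdim (2 * n) (coord_sub (2 * n) 0 (d l - 1) :: complex vec set) = d l - 1"
      and sub: "W l \<inter> coord_sub (2 * n) 0 n \<subseteq> coord_sub (2 * n) 0 (d l - 1)"
    have "vdim (2 * n) (W l \<inter> coord_sub (2 * n) 0 n) \<le> vdim (2 * n) (coord_sub (2 * n) 0 (d l - 1) :: complex vec set)"
      by (rule vdim_mono[OF lin_sub_Int[OF bounded_flagsD(4)[OF W l] lin_sub_coord_sub] lin_sub_coord_sub sub])
    thus False using lt eq by simp
  qed
  ultimately show ?thesis using that by blast
qed

lemma no_excess:
  assumes W: "W \<in> bounded_flags" and l: "l \<in> {1..s}" and h: "\<And>j. n \<le> j \<Longrightarrow> j < n + d l \<Longrightarrow> hits W l j"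
  shows "W l \<inter> coord_sub (2 * n) 0 n \<subseteq> coord_sub (2 * n) 0 (d l - 1)"
proof -
  let ?P = "(\<lambda>w. upper_proj *\<^sub>v w) ` W l"
  have dn: "n + d l \<le> 2 * n" using d_le[OF l] by simp
  have "coord_sub (2 * n) n (n + d l) \<subseteq> ?P"
  proof (rule coord_sub_least[OF lin_sub_image[OF upper_proj_carrier bounded_flagsD(4)[OF W l]] _ dn])
    fix j assume "n \<le> j" "j < n + d l"
    thus "unit_vec (2 * n) j \<in> ?P" using upper_proj_dims(3)[OF W l, of j] h dn by simp
  qed
  hence "?P = coord_sub (2 * n) n (n + d l)" using upper_proj_dims(2)[OF W l] by blast
  hence "vdim (2 * n) ?P = d l" by (simp only: ) (subst vdim_coord_sub, use d_le[OF l] in auto)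
  hence le: "vdim (2 * n) (W l \<inter> coord_sub (2 * n) 0 n) \<le> d l - 1" using upper_proj_dims(1)[OF W l] by linarith
  have "vdim (2 * n) (coord_sub (2 * n) 0 (d l - 1) :: complex vec set) = d l - 1"
    by (subst vdim_coord_sub) (use d_le[OF l] in auto)
  moreover have "coord_sub (2 * n) 0 (d l - 1) \<subseteq> W l \<inter> coord_sub (2 * n) 0 n"
  proof -
    have "d l - 1 \<le> n" using d_le[OF l] by simp
    thus ?thesis using bounded_flagsD(2)[OF W l] coord_sub_mono[of 0 0 "d l - 1" n "2 * n"] by blast
  qed
  ultimately have "coord_sub (2 * n) 0 (d l - 1) = W l \<inter> coord_sub (2 * n) 0 n"
    using le by (intro lin_sub_eqI[OF lin_sub_coord_sub lin_sub_Int[OF bounded_flagsD(4)[OF W l] lin_sub_coord_sub]]) auto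
  thus ?thesis by simp
qed

text \<open>Column \<open>j \<ge> n\<close> of the matrix is a vector hitting \<open>j\<close>, taken from the smallest space of the flag that
  can contain one; it then lies in all the larger ones.\<close>

lemma generic_in_orbit:
  assumes W: "W \<in> bounded_flags" and h: "\<And>l j. l \<in> {1..s} \<Longrightarrow> n \<le> j \<Longrightarrow> j < n + d l \<Longrightarrow> hits W l j"
  shows "W \<in> orbit"
proof -
  have Wf: "W \<in> flags_SL n d s" using W unfolding bounded_flags_def by simp
  \<comment> \<open>The smallest space in which position j can be hit.\<close>
  define lm where "lm = (\<lambda>j. LEAST l. l \<in> {1..s} \<and> j < n + d l)"
  have lm: "lm j \<in> {1..s} \<and> j < n + d (lm j)" "lm j \<le> l" if "l \<in> {1..s}" "j < n + d l" for j l
    using LeastI[of "\<lambda>l. l \<in> {1..s} \<and> j < n + d l" l] Least_le[of "\<lambda>l. l \<in> {1..s} \<and> j < n + d l" l] that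
    unfolding lm_def by auto
  define good where "good = (\<lambda>j. n \<le> j \<and> (\<exists>l\<in>{1..s}. j < n + d l))"
  have "\<forall>j. \<exists>w. good j \<longrightarrow> w \<in> W (lm j) \<and> w $ j = 1 \<and> (\<forall>i. n \<le> i \<and> i < 2 * n \<and> i \<noteq> j \<longrightarrow> w $ i = 0)"
  proof
    fix j
    show "\<exists>w. good j \<longrightarrow> w \<in> W (lm j) \<and> w $ j = 1 \<and> (\<forall>i. n \<le> i \<and> i < 2 * n \<and> i \<noteq> j \<longrightarrow> w $ i = 0)"
    proof (cases "good j")
      case True
      then obtain l where "n \<le> j" "l \<in> {1..s}" "j < n + d l" unfolding good_def by blast
      hence "hits W (lm j) j" using h[of "lm j" j] lm(1)[of l j] by blast
      thus ?thesis unfolding hits_def by blast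
    qed simp
  qed
  then obtain y where y: "\<And>j. good j \<Longrightarrow> y j \<in> W (lm j) \<and> y j $ j = 1 \<and> (\<forall>i. n \<le> i \<and> i < 2 * n \<and> i \<noteq> j \<longrightarrow> y j $ i = 0)"
    by metis
  define A where "A = mat (2 * n) (2 * n) (\<lambda>(i,j). if good j then y j $ i else if i = j then 1 else 0)"
  have Ac: "A \<in> carrier_mat (2 * n) (2 * n)" unfolding A_def by simp
  have ut: "upper_triangular A"
  proof (rule upper_triangularI)
    fix j i assume "j < i" "i < dim_row A"
    hence ij: "j < i" "i < 2 * n" unfolding A_def by auto
    have "y j $ i = 0" if "good j" using y[OF that] ij that unfolding good_def by auto
    thus "A $$ (i,j) = 0" using ij unfolding A_def by auto
  qed
  have "A $$ (i,i) = 1" if "i < 2 * n" for i using y[of i] that unfolding A_def by auto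
  hence "diag_mat A = map (\<lambda>_. 1) [0..<2 * n]" unfolding diag_mat_def using Ac by auto
  hence "det A = 1" using det_upper_triangular[OF ut Ac] by (simp add: map_replicate_const)
  hence AB: "A \<in> borel_SL n" unfolding borel_SL_def SL_def using Ac ut by simp
  have "act_W s A (coord_flag n d s (sigma n d s)) = W"
  proof (rule act_W_coord_flag[OF bounded_flagsD(1)[OF W]])
    show "A \<in> SL (2 * n)" using AB unfolding borel_SL_def by simp
    fix l i assume l: "l \<in> {1..s}" and i: "i < d l - 1 \<or> n \<le> i \<and> i < n + d l"
    show "col A i \<in> W l"
    proof (cases "n \<le> i")
      case True
      hence i': "i < n + d l" using i d_le[OF l] by auto
      hence g: "good i" using True l unfolding good_def by blast
      have i2: "i < 2 * n" using i' d_le[OF l] by simp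
      have yW: "y i \<in> W l" using y[OF g] flag_mono[OF Wf _ l lm(2)[OF l i']] lm(1)[OF l i'] by blast
      have "col A i = y i"
        using bounded_flagsD(6)[OF W l yW] g i2 unfolding A_def by (intro eq_vecI) auto
      thus ?thesis using yW by simp
    next
      case False
      hence i': "i < d l - 1" using i by simp
      have "\<not> good i" using False unfolding good_def by simp
      moreover have i2: "i < 2 * n" using i' d_le[OF l] by simp
      ultimately have "col A i = unit_vec (2 * n) i" unfolding A_def by (intro eq_vecI) auto
      moreover have "unit_vec (2 * n) i \<in> coord_sub (2 * n) 0 (d l - 1)"
        using i' i2 unfolding coord_sub_def by auto
      ultimately show ?thesis using bounded_flagsD(2)[OF W l] by auto
    qed
  qed
  thus ?thesis unfolding orbit_def using AB by blast
qed

section \<open>Degeneration to a generic flag\<close>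

text \<open>The data of the transvection.  Among all missed positions \<open>b\<close> is the smallest, and \<open>q\<close> is the last
  space that misses it, so a vector \<open>y\<close> hitting \<open>b\<close> is available in all spaces after \<open>q\<close>.  Spaces too
  small to contain \<open>y\<close> hit every position they can, so they contain no superfluous vector, and
  \<open>\<xi>\<close> may be chosen to vanish on them.\<close>

lemma degenerate:
  assumes W: "W \<in> bounded_flags" and bad: "l0 \<in> {1..s}" "n \<le> j0" "j0 < n + d l0" "\<not> hits W l0 j0"
  obtains q \<xi> y where "q \<in> {1..s}" "\<xi> \<in> carrier_vec (2 * n)" "y \<in> carrier_vec (2 * n)" "\<xi> \<bullet> y = 0"
    "\<forall>l\<in>{1..s}. q < l \<longrightarrow> y \<in> W l"
    "\<forall>v\<in>coord_sub (2 * n) 0 (d q - 1). \<xi> \<bullet> v = 0"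
    "\<forall>l\<in>{1..s}. l \<le> q \<longrightarrow> y \<in> coord_sub (2 * n) 0 (n + d l) \<or> (\<forall>v\<in>W l. \<xi> \<bullet> v = 0)"
    "\<forall>v\<in>W q. \<forall>t. v + t \<cdot>\<^sub>v y \<in> coord_sub (2 * n) 0 n \<longrightarrow> t = 0"
    "\<exists>x\<in>W q \<inter> coord_sub (2 * n) 0 n. \<xi> \<bullet> x \<noteq> 0"
proof -
  have Wf: "W \<in> flags_SL n d s" using W unfolding bounded_flags_def by simp
  \<comment> \<open>Minimality of b is what makes the small spaces generic.\<close>
  define b where "b = (LEAST j. n \<le> j \<and> (\<exists>l\<in>{1..s}. j < n + d l \<and> \<not> hits W l j))"
  have "n \<le> b \<and> (\<exists>l\<in>{1..s}. b < n + d l \<and> \<not> hits W l b)"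
    unfolding b_def by (rule LeastI[of _ j0]) (use bad in blast)
  then obtain l1 where b: "n \<le> b" and l1: "l1 \<in> {1..s}" "b < n + d l1" "\<not> hits W l1 b" by blast
  have bmin: "hits W l j" if "n \<le> j" "j < b" "l \<in> {1..s}" "j < n + d l" for j l
    using not_less_Least[of j "\<lambda>j. n \<le> j \<and> (\<exists>l\<in>{1..s}. j < n + d l \<and> \<not> hits W l j)"] that
    unfolding b_def by blast
  have b2: "b < 2 * n" using l1(2) d_le[OF l1(1)] by simp
  define Q where "Q = {l\<in>{1..s}. \<not> hits W l b}"
  have Q: "finite Q" "l1 \<in> Q" unfolding Q_def using l1 by auto
  define q where "q = Max Q"
  have "q \<in> Q" unfolding q_def using Max_in[OF Q(1)] Q(2) by blast
  hence q: "q \<in> {1..s}" "\<not> hits W q b" unfolding Q_def by auto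
  have qmax: "hits W l b" if "l \<in> {1..s}" "q < l" for l
    using Max_ge[OF Q(1), of l] that unfolding q_def Q_def by fastforce
  have "l1 \<le> q" unfolding q_def using Max_ge[OF Q(1) Q(2)] .
  hence bq: "b < n + d q" using d_mono[OF l1(1) q(1)] l1(2) by simp
  obtain x where x: "x \<in> W q" "x \<in> coord_sub (2 * n) 0 n" "x \<notin> coord_sub (2 * n) 0 (d q - 1)"
    using excess_vector[OF W q(1) b bq q(2)] .
  obtain y where y: "y \<in> carrier_vec (2 * n)" "y $ b = 1" "\<And>i. n \<le> i \<Longrightarrow> i < 2 * n \<Longrightarrow> i \<noteq> b \<Longrightarrow> y $ i = 0"
    "\<And>l. l \<in> {1..s} \<Longrightarrow> q < l \<Longrightarrow> y \<in> W l"
  proof (cases "q = s")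
    case True
    show ?thesis by (rule that[of "unit_vec (2 * n) b"]) (use b2 True in auto)
  next
    case False
    hence q1: "q + 1 \<in> {1..s}" using q(1) by auto
    have "hits W (q + 1) b" using qmax[OF q1] by simp
    then obtain y where y: "y \<in> W (q + 1)" "y $ b = 1" "\<forall>i. n \<le> i \<and> i < 2 * n \<and> i \<noteq> b \<longrightarrow> y $ i = 0"
      unfolding hits_def by blast
    show ?thesis
    proof (rule that[of y])
      show "y \<in> carrier_vec (2 * n)" using bounded_flagsD(6)[OF W q1 y(1)] .
      show "y \<in> W l" if "l \<in> {1..s}" "q < l" for l using flag_mono[OF Wf q1 that(1)] that(2) y(1) by auto
    qed (use y in auto)
  qed
  \<comment> \<open>Otherwise a multiple of v would hit b.\<close>
  have no_y: "t = 0" if v: "v \<in> W q" and z: "v + t \<cdot>\<^sub>v y \<in> coord_sub (2 * n) 0 n" for v t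
  proof (rule ccontr)
    assume t: "t \<noteq> 0"
    have vc: "v \<in> carrier_vec (2 * n)" using bounded_flagsD(6)[OF W q(1) v] .
    have e: "v $ i + t * y $ i = 0" if "n \<le> i" "i < 2 * n" for i
      using coord_subD(3)[OF z that(2,1)] vc y(1) that by simp
    define w where "w = (- 1 / t) \<cdot>\<^sub>v v"
    have "w \<in> W q" unfolding w_def using lin_subD(4)[OF bounded_flagsD(4)[OF W q(1)] v] .
    moreover have "w $ b = 1"
    proof -
      have "v $ b = - t" using e[OF b b2] y(2) by (simp add: eq_neg_iff_add_eq_0)
      thus ?thesis unfolding w_def using vc b2 t by simp
    qed
    moreover have "w $ i = 0" if "n \<le> i" "i < 2 * n" "i \<noteq> b" for i
      using e[OF that(1,2)] y(3)[OF that] vc that unfolding w_def by simp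
    ultimately show False using q(2) unfolding hits_def by blast
  qed
  \<comment> \<open>The largest space of the flag that is too small to contain y, or zero.\<close>
  define A where "A = {0\<^sub>v (2 * n)} \<union> {v. \<exists>l\<in>{1..s}. n + d l \<le> b \<and> v \<in> W l}"
  have A: "lin_sub (2 * n) A \<and> A \<subseteq> W q \<and> A \<inter> coord_sub (2 * n) 0 n \<subseteq> coord_sub (2 * n) 0 (d q - 1)"
  proof (cases "\<exists>l\<in>{1..s}. n + d l \<le> b")
    case False
    hence "A = {0\<^sub>v (2 * n)}" unfolding A_def by auto
    moreover have "lin_sub (2 * n) {0\<^sub>v (2 * n) :: complex vec}" by (rule lin_subI) (auto intro!: eq_vecI)
    moreover have "0\<^sub>v (2 * n) \<in> coord_sub (2 * n) 0 (d q - 1)" using lin_subD(2)[OF lin_sub_coord_sub] .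
    ultimately show ?thesis using lin_subD(2)[OF bounded_flagsD(4)[OF W q(1)]] by auto
  next
    case True
    define R where "R = {l\<in>{1..s}. n + d l \<le> b}"
    have R: "finite R" "R \<noteq> {}" unfolding R_def using True by auto
    define p where "p = Max R"
    have "p \<in> R" unfolding p_def using Max_in[OF R] .
    hence p: "p \<in> {1..s}" "n + d p \<le> b" unfolding R_def by auto
    have pmax: "l \<le> p" if "l \<in> {1..s}" "n + d l \<le> b" for l
      unfolding p_def using Max_ge[OF R(1), of l] that unfolding R_def by simp
    have Ap: "A = W p"
    proof (intro equalityI subsetI)
      fix v assume "v \<in> A"
      thus "v \<in> W p" unfolding A_def
        using lin_subD(2)[OF bounded_flagsD(4)[OF W p(1)]] flag_mono[OF Wf _ p(1) pmax] by blast
    qed (use p A_def in blast)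
    have "p < q"
    proof (rule ccontr)
      assume "\<not> p < q"
      hence "d q \<le> d p" using d_mono[OF q(1) p(1)] by simp
      thus False using p(2) bq by simp
    qed
    hence "d p - 1 \<le> d q - 1" "p \<le> q" using d_less[OF p(1) q(1)] by auto
    moreover have "W p \<inter> coord_sub (2 * n) 0 n \<subseteq> coord_sub (2 * n) 0 (d p - 1)"
      by (rule no_excess[OF W p(1)]) (use bmin p in auto)
    ultimately show ?thesis unfolding Ap
      using bounded_flagsD(4)[OF W p(1)] flag_mono[OF Wf p(1) q(1)] coord_sub_mono[of 0 0 "d p - 1" "d q - 1" "2 * n"] by blast
  qed
  \<comment> \<open>Everything on which the functional has to vanish.\<close>
  define S where "S = {a + c | a c. a \<in> {a + e | a e. a \<in> A \<and> e \<in> coord_sub (2 * n) 0 (d q - 1)} \<and> c \<in> range (\<lambda>c. c \<cdot>\<^sub>v y)}"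
  have S: "lin_sub (2 * n) S" unfolding S_def
    using lin_sub_sum[OF lin_sub_sum[OF conjunct1[OF A] lin_sub_coord_sub] lin_sub_line[OF y(1)]] .
  note Z = lin_subD(2)[OF lin_sub_coord_sub[of "2 * n" 0 "d q - 1"]]
  have Ac: "a \<in> carrier_vec (2 * n)" if "a \<in> A" for a using lin_subD(5)[OF conjunct1[OF A] that] .
  have y0: "0\<^sub>v (2 * n) = 0 \<cdot>\<^sub>v y" using y(1) by (intro eq_vecI) auto
  have SI: "a + e + c \<cdot>\<^sub>v y \<in> S" if "a \<in> A" "e \<in> coord_sub (2 * n) 0 (d q - 1)" for a e c
    unfolding S_def using that by blast
  have AS: "a \<in> S" if "a \<in> A" for a
  proof -
    have "a = a + 0\<^sub>v (2 * n) + 0 \<cdot>\<^sub>v y" unfolding y0[symmetric] using Ac[OF that] by simp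
    thus ?thesis using SI[OF that Z, of 0] by simp
  qed
  have A0: "0\<^sub>v (2 * n) \<in> A" using lin_subD(2)[OF conjunct1[OF A]] .
  have ES: "e \<in> S" if "e \<in> coord_sub (2 * n) 0 (d q - 1)" for e
  proof -
    have "e = 0\<^sub>v (2 * n) + e + 0 \<cdot>\<^sub>v y" unfolding y0[symmetric] using coord_subD(1)[OF that] by simp
    thus ?thesis using SI[OF A0 that, of 0] by simp
  qed
  have yS: "y \<in> S"
  proof -
    have "y = 0\<^sub>v (2 * n) + 0\<^sub>v (2 * n) + 1 \<cdot>\<^sub>v y" using y(1) by simp
    thus ?thesis using SI[OF A0 Z, of 1] by simp
  qed
  have dq: "d q - 1 \<le> n" using d_le[OF q(1)] by simp
  have Eq: "coord_sub (2 * n) 0 (d q - 1) \<subseteq> coord_sub (2 * n) 0 n" using coord_sub_mono[of 0 0 "d q - 1" n "2 * n"] dq by blast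
  have "x \<notin> S"
  proof
    assume "x \<in> S"
    then obtain a e c where x': "x = a + e + c \<cdot>\<^sub>v y" and a: "a \<in> A" and e: "e \<in> coord_sub (2 * n) 0 (d q - 1)"
      unfolding S_def by blast
    have ae: "a + e \<in> W q" using lin_subD(3)[OF bounded_flagsD(4)[OF W q(1)]] a A e bounded_flagsD(2)[OF W q(1)] by blast
    have "c = 0" using no_y[OF ae, of c] x(2) x' by simp
    hence xae: "x = a + e" unfolding x' \<open>c = 0\<close> y0[symmetric] using Ac[OF a] coord_subD(1)[OF e] by simp
    have "a = x - e" unfolding xae using Ac[OF a] coord_subD(1)[OF e] by (intro eq_vecI) auto
    hence "a \<in> coord_sub (2 * n) 0 n" using lin_sub_diff[OF lin_sub_coord_sub x(2)] e Eq by blast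
    hence "a \<in> coord_sub (2 * n) 0 (d q - 1)" using A a by blast
    hence "x \<in> coord_sub (2 * n) 0 (d q - 1)" unfolding xae using lin_subD(3)[OF lin_sub_coord_sub] e by blast
    thus False using x(3) by simp
  qed
  then obtain \<xi> where \<xi>: "\<xi> \<in> carrier_vec (2 * n)" "\<xi> \<bullet> x = 1" "\<And>u. u \<in> S \<Longrightarrow> \<xi> \<bullet> u = 0"
    using lin_sub_separate[OF S coord_subD(1)[OF x(2)]] by blast
  show ?thesis
  proof (rule that[OF q(1) \<xi>(1) y(1)])
    show "\<xi> \<bullet> y = 0" using \<xi>(3) yS .
    show "\<forall>l\<in>{1..s}. q < l \<longrightarrow> y \<in> W l" using y(4) by blast
    show "\<forall>v\<in>coord_sub (2 * n) 0 (d q - 1). \<xi> \<bullet> v = 0" using \<xi>(3) ES by blast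
    have "y \<in> coord_sub (2 * n) 0 (n + d l) \<or> (\<forall>v\<in>W l. \<xi> \<bullet> v = 0)" if l: "l \<in> {1..s}" "l \<le> q" for l
    proof (cases "n + d l \<le> b")
      case True
      hence "W l \<subseteq> A" unfolding A_def using l(1) by blast
      thus ?thesis using \<xi>(3) AS by blast
    next
      case False
      have "y $ i = 0" if "i < 2 * n" "n + d l \<le> i" for i using y(3)[of i] that False by auto
      thus ?thesis using y(1) unfolding coord_sub_def by auto
    qed
    thus "\<forall>l\<in>{1..s}. l \<le> q \<longrightarrow> y \<in> coord_sub (2 * n) 0 (n + d l) \<or> (\<forall>v\<in>W l. \<xi> \<bullet> v = 0)" by blast
    show "\<forall>v\<in>W q. \<forall>t. v + t \<cdot>\<^sub>v y \<in> coord_sub (2 * n) 0 n \<longrightarrow> t = 0" using no_y by blast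
    show "\<exists>x\<in>W q \<inter> coord_sub (2 * n) 0 n. \<xi> \<bullet> x \<noteq> 0" using x \<xi>(2) by (intro bexI[of _ x]) auto
  qed
qed

text \<open>Induction on \<open>excess\<close>, along the curve of transvections through \<open>W\<close>.\<close>

lemma bounded_flags_subset_closed:
  assumes C: "closedin (zariski (2 * n) dW s) C" and orb: "orbit \<inter> bounded_flags \<subseteq> C"
  shows "W \<in> bounded_flags \<Longrightarrow> W \<in> C"
proof (induction "excess W" arbitrary: W rule: less_induct)
  case less
  note W = less.prems
  have Wf: "W \<in> flags_SL n d s" using W unfolding bounded_flags_def by simp
  show ?case
  proof (cases "\<exists>l\<in>{1..s}. \<exists>j. n \<le> j \<and> j < n + d l \<and> \<not> hits W l j")
    case False
    hence "W \<in> orbit" using generic_in_orbit[OF W] by blast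
    thus ?thesis using orb W by blast
  next
    case True
    then obtain l0 j0 where bad: "l0 \<in> {1..s}" "n \<le> j0" "j0 < n + d l0" "\<not> hits W l0 j0" by blast
    obtain q \<xi> y where q: "q \<in> {1..s}" and \<xi>: "\<xi> \<in> carrier_vec (2 * n)" and y: "y \<in> carrier_vec (2 * n)" "\<xi> \<bullet> y = 0"
      and yW': "\<forall>l\<in>{1..s}. q < l \<longrightarrow> y \<in> W l"
      and kill': "\<forall>v\<in>coord_sub (2 * n) 0 (d q - 1). \<xi> \<bullet> v = 0"
      and bd': "\<forall>l\<in>{1..s}. l \<le> q \<longrightarrow> y \<in> coord_sub (2 * n) 0 (n + d l) \<or> (\<forall>v\<in>W l. \<xi> \<bullet> v = 0)"
      and no_y': "\<forall>v\<in>W q. \<forall>t. v + t \<cdot>\<^sub>v y \<in> coord_sub (2 * n) 0 n \<longrightarrow> t = 0"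
      and ex: "\<exists>x\<in>W q \<inter> coord_sub (2 * n) 0 n. \<xi> \<bullet> x \<noteq> 0"
      using degenerate[OF W bad] .
    have yW: "y \<in> W l" if "l \<in> {1..s}" "q < l" for l using yW' that by blast
    have kill: "\<xi> \<bullet> v = 0" if "v \<in> coord_sub (2 * n) 0 (d q - 1)" for v using kill' that by blast
    have bd: "y \<in> coord_sub (2 * n) 0 (n + d l) \<or> (\<forall>v\<in>W l. \<xi> \<bullet> v = 0)" if "l \<in> {1..s}" "l \<le> q" for l
      using bd' that by blast
    have no_y: "t = 0" if "v \<in> W q" "v + t \<cdot>\<^sub>v y \<in> coord_sub (2 * n) 0 n" for v t using no_y' that by blast
    define g where "g = transv (2 * n) \<xi> y"
    have gc: "g t \<in> carrier_mat (2 * n) (2 * n)" for t unfolding g_def by (rule transv_carrier)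
    have gm: "g t *\<^sub>v v = v + (t * (\<xi> \<bullet> v)) \<cdot>\<^sub>v y" if "v \<in> carrier_vec (2 * n)" for t v
      unfolding g_def by (rule transv_mult[OF that \<xi> y(1)])
    have gfix: "g t *\<^sub>v v = v" if "v \<in> carrier_vec (2 * n)" "\<xi> \<bullet> v = 0" for t v
      unfolding g_def by (rule transv_fix[OF that(1) \<xi> y(1) that(2)])
    define U where "U = (\<lambda>t. \<lambda>l\<in>{1..s}. if l \<le> q then (\<lambda>v. g t *\<^sub>v v) ` W l else W l)"
    have Ul: "U t l = (if l \<le> q then (\<lambda>v. g t *\<^sub>v v) ` W l else W l)" if "l \<in> {1..s}" for t l
      using that unfolding U_def by simp
    have W_c: "v \<in> carrier_vec (2 * n)" if "l \<in> {1..s}" "v \<in> W l" for l v using bounded_flagsD(6)[OF W that] .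
    have U0: "U 0 = W"
    proof (rule extensionalityI[of _ "{1..s}"])
      fix l assume l: "l \<in> {1..s}"
      have "g 0 *\<^sub>v v = v" if "v \<in> W l" for v
        unfolding g_def by (rule transv_zero[OF W_c[OF l that] \<xi> y(1)])
      thus "U 0 l = W l" unfolding Ul[OF l] by auto
    qed (use Gr_prod_ext[OF bounded_flagsD(1)[OF W]] in \<open>auto simp: U_def\<close>)
    have U_bounded: "U t \<in> bounded_flags" for t
    proof -
      have "U t \<in> Gr_prod (2 * n) dW s"
      proof (rule Gr_prodI)
        fix l assume l: "l \<in> {1..s}"
        have "(\<lambda>v. g t *\<^sub>v v) ` W l \<in> Gr (2 * n) (2 * d l - 1)"
          by (rule Gr_image[OF gc _ Gr_prodD[OF bounded_flagsD(1)[OF W] l]])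
            (use transv_inj[OF _ \<xi> y] in \<open>simp add: g_def\<close>)
        thus "U t l \<in> Gr (2 * n) (2 * d l - 1)"
          unfolding Ul[OF l] using Gr_prodD[OF bounded_flagsD(1)[OF W] l] by simp
      qed (simp add: U_def)
      moreover have "U t l \<subseteq> U t (l + 1)" if "l \<in> {1..<s}" for l
      proof -
        have l: "l \<in> {1..s}" "l + 1 \<in> {1..s}" using that by auto
        have sub: "W l \<subseteq> W (l + 1)" using flag_mono[OF Wf l] by simp
        consider "l + 1 \<le> q" | "l = q" | "q < l" by linarith
        thus ?thesis
        proof cases
          case 1
          thus ?thesis unfolding Ul[OF l(1)] Ul[OF l(2)] using sub by auto
        next
          case 2
          have "g t *\<^sub>v v \<in> W (l + 1)" if v: "v \<in> W l" for v
          proof -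
            have "y \<in> W (l + 1)" using yW[OF l(2)] 2 by simp
            thus ?thesis unfolding gm[OF W_c[OF l(1) v]]
              using lin_subD(3,4)[OF bounded_flagsD(4)[OF W l(2)]] v sub by blast
          qed
          thus ?thesis unfolding Ul[OF l(1)] Ul[OF l(2)] using 2 by auto
        next
          case 3
          thus ?thesis unfolding Ul[OF l(1)] Ul[OF l(2)] using sub by simp
        qed
      qed
      moreover have "coord_sub (2 * n) 0 (d l - 1) \<subseteq> U t l" if l: "l \<in> {1..s}" for l
      proof (cases "l \<le> q")
        case True
        have "d l - 1 \<le> d q - 1" using d_mono[OF l q True] by simp
        hence sub: "coord_sub (2 * n) 0 (d l - 1) \<subseteq> coord_sub (2 * n) 0 (d q - 1)"
          using coord_sub_mono[of 0 0 "d l - 1" "d q - 1" "2 * n"] by blast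
        show ?thesis
        proof
          fix v :: "complex vec" assume v: "v \<in> coord_sub (2 * n) 0 (d l - 1)"
          have "g t *\<^sub>v v = v" using gfix[OF coord_subD(1)[OF v]] kill v sub by blast
          moreover have "v \<in> W l" using bounded_flagsD(2)[OF W l] v by blast
          ultimately show "v \<in> U t l" unfolding Ul[OF l] using True by (metis imageI)
        qed
      next
        case False
        thus ?thesis unfolding Ul[OF l] using bounded_flagsD(2)[OF W l] by simp
      qed
      moreover have "U t l \<subseteq> coord_sub (2 * n) 0 (n + d l)" if l: "l \<in> {1..s}" for l
      proof (cases "l \<le> q")
        case True
        show ?thesis
        proof
          fix u assume "u \<in> U t l"
          then obtain v where v: "v \<in> W l" "u = g t *\<^sub>v v" unfolding Ul[OF l] using True by auto
          have vs: "v \<in> coord_sub (2 * n) 0 (n + d l)" using bounded_flagsD(3)[OF W l] v(1) by blast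
          from bd[OF l True] show "u \<in> coord_sub (2 * n) 0 (n + d l)"
          proof
            assume "y \<in> coord_sub (2 * n) 0 (n + d l)"
            thus ?thesis unfolding v(2) gm[OF W_c[OF l v(1)]] using lin_subD(3,4)[OF lin_sub_coord_sub] vs by blast
          next
            assume "\<forall>v\<in>W l. \<xi> \<bullet> v = 0"
            thus ?thesis unfolding v(2) using gfix[OF W_c[OF l v(1)]] v(1) vs by simp
          qed
        qed
      next
        case False
        thus ?thesis unfolding Ul[OF l] using bounded_flagsD(3)[OF W l] by simp
      qed
      ultimately show ?thesis unfolding bounded_flags_def flags_SL_def by blast
    qed
    \<comment> \<open>No new vector enters the intersection with the first n coordinates.\<close>
    have fixE: "v \<in> W l \<inter> coord_sub (2 * n) 0 n \<and> g t *\<^sub>v v = v \<and> \<xi> \<bullet> v = 0"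
      if "t \<noteq> 0" "l \<in> {1..s}" "l \<le> q" "v \<in> W l" "g t *\<^sub>v v \<in> coord_sub (2 * n) 0 n" for t l v
    proof -
      have "v \<in> W q" using flag_mono[OF Wf that(2) q that(3)] that(4) by blast
      moreover have "v + (t * (\<xi> \<bullet> v)) \<cdot>\<^sub>v y \<in> coord_sub (2 * n) 0 n" using that(5) gm[OF W_c[OF that(2,4)]] by simp
      ultimately have "t * (\<xi> \<bullet> v) = 0" using no_y by blast
      hence "\<xi> \<bullet> v = 0" using that(1) by simp
      thus ?thesis using gfix[OF W_c[OF that(2,4)]] that(4,5) by simp
    qed
    have U_excess: "excess (U t) < excess W" if t: "t \<noteq> 0" for t
      unfolding excess_def
    proof (rule sum_strict_mono_ex1)
      have lin: "lin_sub (2 * n) (V l \<inter> coord_sub (2 * n) 0 n)" if "V \<in> bounded_flags" "l \<in> {1..s}" for V l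
        using lin_sub_Int[OF bounded_flagsD(4)[OF that] lin_sub_coord_sub] .
      have sub: "U t l \<inter> coord_sub (2 * n) 0 n \<subseteq> W l \<inter> coord_sub (2 * n) 0 n" if l: "l \<in> {1..s}" for l
      proof (cases "l \<le> q")
        case True
        show ?thesis
        proof
          fix u assume "u \<in> U t l \<inter> coord_sub (2 * n) 0 n"
          then obtain v where "v \<in> W l" "u = g t *\<^sub>v v" "u \<in> coord_sub (2 * n) 0 n"
            unfolding Ul[OF l] using True by auto
          thus "u \<in> W l \<inter> coord_sub (2 * n) 0 n" using fixE[OF t l True, of v] by simp
        qed
      next
        case False
        thus ?thesis unfolding Ul[OF l] by simp
      qed
      show "\<forall>l\<in>{1..s}. vdim (2 * n) (U t l \<inter> coord_sub (2 * n) 0 n) \<le> vdim (2 * n) (W l \<inter> coord_sub (2 * n) 0 n)"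
        using vdim_mono[OF lin[OF U_bounded] lin[OF W] sub] by blast
      have "U t q \<inter> coord_sub (2 * n) 0 n \<subset> W q \<inter> coord_sub (2 * n) 0 n"
      proof -
        obtain x where x: "x \<in> W q \<inter> coord_sub (2 * n) 0 n" "\<xi> \<bullet> x \<noteq> 0" using ex by blast
        have "x \<notin> U t q"
        proof
          assume "x \<in> U t q"
          then obtain v where v: "v \<in> W q" "x = g t *\<^sub>v v" unfolding Ul[OF q] by auto
          have "g t *\<^sub>v v = v \<and> \<xi> \<bullet> v = 0" using fixE[OF t q _ v(1)] x(1) v(2) by simp
          thus False using x(2) v(2) by simp
        qed
        thus ?thesis using sub[OF q] x(1) by blast
      qed
      thus "\<exists>l\<in>{1..s}. vdim (2 * n) (U t l \<inter> coord_sub (2 * n) 0 n) < vdim (2 * n) (W l \<inter> coord_sub (2 * n) 0 n)"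
        using vdim_strict_mono[OF lin[OF U_bounded q] lin[OF W q]] q by blast
    qed simp
    have in_C: "U t \<in> C" if "t \<noteq> 0" for t using less.hyps[OF U_excess[OF that] U_bounded] .
    have "\<forall>l. \<exists>M. l \<in> {1..s} \<longrightarrow> frame (2 * n) (2 * d l - 1) M \<and> colsp M = W l"
      using Gr_frameE[OF Gr_prodD[OF bounded_flagsD(1)[OF W]]] by metis
    then obtain M0 where M0: "\<And>l. l \<in> {1..s} \<Longrightarrow> frame (2 * n) (2 * d l - 1) (M0 l) \<and> colsp (M0 l) = W l" by metis
    have M0c: "M0 l \<in> carrier_mat (2 * n) (2 * d l - 1)" if "l \<in> {1..s}" for l using M0[OF that] frame_carrier by blast
    define M where "M = (\<lambda>t l. if l \<le> q then g t * M0 l else M0 l)"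
    have "U 0 \<in> C"
    proof (rule limit_in_closed[OF C, where M = M])
      show "U 0 \<in> Gr_prod (2 * n) dW s" unfolding U0 using bounded_flagsD(1)[OF W] .
      show "M t l \<in> carrier_mat (2 * n) (2 * d l - 1)" if "l \<in> {1..s}" for t l
        unfolding M_def using gc M0c[OF that] by (cases "l \<le> q") (auto intro: mult_carrier_mat[OF gc])
      show "colsp (M t l) = U t l" if "l \<in> {1..s}" for t l
        unfolding M_def Ul[OF that] using image_colsp[OF gc M0c[OF that]] M0[OF that] by simp
      show "isCont (\<lambda>t. M t l $$ (i,j)) 0" if "l \<in> {1..s}" "i < 2 * n" "j < 2 * d l - 1" for l i j
      proof (cases "l \<le> q")
        case True
        have cj: "col (M0 l) j \<in> carrier_vec (2 * n)" using M0c[OF that(1)] that(3) by auto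
        have "M t l $$ (i,j) = col (M0 l) j $ i + t * (\<xi> \<bullet> col (M0 l) j) * y $ i" for t
        proof -
          have "M t l $$ (i,j) = (g t *\<^sub>v col (M0 l) j) $ i"
            unfolding M_def using True M0c[OF that(1)] gc[of t] that by simp
          thus ?thesis unfolding g_def transv_index[OF cj \<xi> y(1) that(2)] .
        qed
        thus ?thesis by (simp add: continuous_intros)
      next
        case False
        thus ?thesis unfolding M_def by simp
      qed
      show "U t \<in> C" if "t \<noteq> 0" for t using in_C that .
    qed
    thus ?thesis unfolding U0 .
  qed
qed

text \<open>The flags of \<open>bounded_flags_Sp\<close> contain \<open>E\<^bsub>d\<^sub>l-1\<^esub>\<close> automatically, so the density result for the
  special linear group applies to them.\<close>

lemma schubert_Sp_eq: "schubert_Sp n d s (sigma n d s) = bounded_flags_Sp"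
proof -
  let ?Z = "zariski (2 * n) dW s"
  have eq: "schubert n d s (sigma n d s) = flags_SL n d s \<inter> (?Z closure_of (flags_SL n d s \<inter> orbit))"
    unfolding schubert_def orbit_def by (rule closure_of_subtopology)
  have "?Z closure_of (flags_SL n d s \<inter> orbit) \<subseteq>
      {U \<in> Gr_prod (2 * n) dW s. \<forall>l\<in>{1..s}. U l \<subseteq> coord_sub (2 * n) 0 (n + d l)}"
    by (rule closure_of_minimal[OF _ closedin_bounded]) (use orbit_bounded flags_SL_Gr in blast)
  hence "schubert_Sp n d s (sigma n d s) \<subseteq> bounded_flags_Sp"
    unfolding schubert_Sp_def eq bounded_flags_Sp_def by blast
  moreover have "bounded_flags_Sp \<subseteq> schubert_Sp n d s (sigma n d s)"
  proof
    fix W assume W: "W \<in> bounded_flags_Sp"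
    hence Wf: "W \<in> flags_Sp n d s" "W \<in> flags_SL n d s" unfolding bounded_flags_Sp_def flags_Sp_def by auto
    have "W \<in> bounded_flags" unfolding bounded_flags_def using Wf(2) coord_sub_le_flag[OF W] W unfolding bounded_flags_Sp_def by blast
    moreover have "orbit \<inter> bounded_flags \<subseteq> ?Z closure_of (flags_SL n d s \<inter> orbit)"
    proof -
      have "flags_SL n d s \<inter> orbit \<subseteq> topspace ?Z" unfolding topspace_zariski using flags_SL_Gr by blast
      from closure_of_subset[OF this] show ?thesis unfolding bounded_flags_def by blast
    qed
    ultimately have "W \<in> ?Z closure_of (flags_SL n d s \<inter> orbit)"
      using bounded_flags_subset_closed[OF closedin_closure_of] by blast
    thus "W \<in> schubert_Sp n d s (sigma n d s)" unfolding schubert_Sp_def eq using Wf by blast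
  qed
  ultimately show ?thesis by blast
qed

section \<open>Coordinates of the embedding\<close>

definition unit_block :: "nat \<Rightarrow> complex mat" where
  "unit_block D = mat (2 * n) (D - 1) (\<lambda>(i,j). if i = j then 1 else 0)"

definition lift_mat :: "nat \<Rightarrow> complex mat \<Rightarrow> complex mat" where
  "lift_mat D M = mat (2 * n) (dim_col M) (\<lambda>(i,j). lift_vec D (col M j) $ i)"

text \<open>A basis of the preimage: the first \<open>D - 1\<close> basis vectors followed by lifts of the columns of \<open>M\<close>.\<close>

definition embed_mat :: "nat \<Rightarrow> complex mat \<Rightarrow> complex mat" where
  "embed_mat D M = hcat (unit_block D) (lift_mat D M)"

lemma embed_blocks:
  assumes "M \<in> carrier_mat (n + 1) D"
  shows "unit_block D \<in> carrier_mat (2 * n) (D - 1)" "lift_mat D M \<in> carrier_mat (2 * n) D"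
  using assms unfolding unit_block_def lift_mat_def by auto

lemma embed_mat_carrier:
  assumes "M \<in> carrier_mat (n + 1) D" "1 \<le> D"
  shows "embed_mat D M \<in> carrier_mat (2 * n) (2 * D - 1)"
proof -
  have "(D - 1) + D = 2 * D - 1" using assms(2) by simp
  thus ?thesis unfolding embed_mat_def using hcat_carrier[OF embed_blocks[OF assms(1)]] by simp
qed

lemma col_lift_mat:
  assumes "M \<in> carrier_mat (n + 1) D" "j < D"
  shows "col (lift_mat D M) j = lift_vec D (col M j)"
  using assms unfolding lift_mat_def lift_vec_def by (intro eq_vecI) auto

lemma quot_lift_mat:
  assumes M: "M \<in> carrier_mat (n + 1) D" and D: "1 \<le> D" "D \<le> n"
  shows "quot_mat D * lift_mat D M = M"
proof (rule eq_matI)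
  fix i j assume "i < dim_row M" "j < dim_col M"
  hence i: "i < n + 1" and j: "j < D" using M by auto
  have c: "col M j \<in> carrier_vec (n + 1)" using M j by auto
  have "(quot_mat D * lift_mat D M) $$ (i,j) = (quot_mat D *\<^sub>v col (lift_mat D M) j) $ i"
    using i j quot_mat_carrier[of D] embed_blocks(2)[OF M] by simp
  also have "\<dots> = col M j $ i" unfolding col_lift_mat[OF M j] quot_lift[OF c D] ..
  finally show "(quot_mat D * lift_mat D M) $$ (i,j) = M $$ (i,j)" using i j M by simp
qed (use M quot_mat_carrier[of D] embed_blocks(2)[OF M] in auto)

lemma col_unit_block: "j < D - 1 \<Longrightarrow> D \<le> n \<Longrightarrow> col (unit_block D) j = unit_vec (2 * n) j"
  unfolding unit_block_def unit_vec_def by (intro eq_vecI) auto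

lemma unit_block_colsp:
  assumes "D \<le> n"
  shows "colsp (unit_block D) \<subseteq> coord_sub (2 * n) 0 (D - 1)"
proof (rule colsp_subsetI[OF _ lin_sub_coord_sub])
  show "unit_block D \<in> carrier_mat (2 * n) (D - 1)" unfolding unit_block_def by simp
  fix j assume j: "j < D - 1"
  show "col (unit_block D) j \<in> coord_sub (2 * n) 0 (D - 1)"
    unfolding col_unit_block[OF j assms] coord_sub_def unit_vec_def using j by auto
qed

lemma colsp_embed_mat:
  assumes M: "frame (n + 1) D M" and D: "1 \<le> D" "D \<le> n"
  shows "colsp (embed_mat D M) = emb D (colsp M)"
proof -
  note Mc = frame_carrier[OF M]
  note bl = embed_blocks[OF Mc]
  have lM: "lin_sub (n + 1) (colsp M)" using lin_sub_colsp[OF Mc] .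
  have fr: "frame (2 * n) (D - 1 + D) (embed_mat D M)"
  proof (rule frame_if_inj)
    show "embed_mat D M \<in> carrier_mat (2 * n) (D - 1 + D)" unfolding embed_mat_def by (rule hcat_carrier[OF bl])
    fix z assume z: "z \<in> carrier_vec (D - 1 + D)" "embed_mat D M *\<^sub>v z = 0\<^sub>v (2 * n)"
    define x where "x = vec_first z (D - 1)"
    define y where "y = vec_last z D"
    have xy: "x \<in> carrier_vec (D - 1)" "y \<in> carrier_vec D" "z = x @\<^sub>v y"
      unfolding x_def y_def using z(1) by auto
    have sum0: "unit_block D *\<^sub>v x + lift_mat D M *\<^sub>v y = 0\<^sub>v (2 * n)"
      using z(2) hcat_mult_vec[OF bl xy(1,2)] unfolding xy(3) embed_mat_def by simp
    have cx: "unit_block D *\<^sub>v x \<in> carrier_vec (2 * n)" and cy: "lift_mat D M *\<^sub>v y \<in> carrier_vec (2 * n)"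
      using mult_mat_vec_carrier[OF bl(1) xy(1)] mult_mat_vec_carrier[OF bl(2) xy(2)] .
    have "x \<in> carrier_vec (dim_col (unit_block D))" using xy(1) bl(1) by simp
    hence "unit_block D *\<^sub>v x \<in> colsp (unit_block D)" unfolding colsp_def by (rule imageI)
    hence "unit_block D *\<^sub>v x \<in> coord_sub (2 * n) 0 (D - 1)" by (rule subsetD[OF unit_block_colsp[OF D(2)]])
    hence k: "quot_mat D *\<^sub>v (unit_block D *\<^sub>v x) = 0\<^sub>v (n + 1)" unfolding quot_kernel[OF D, symmetric] by simp
    have "quot_mat D *\<^sub>v (unit_block D *\<^sub>v x + lift_mat D M *\<^sub>v y) = M *\<^sub>v y"
      unfolding mult_add_distrib_mat_vec[OF quot_mat_carrier cx cy] k
        assoc_mult_mat_vec[OF quot_mat_carrier bl(2) xy(2), symmetric] quot_lift_mat[OF Mc D]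
      using mult_mat_vec_carrier[OF Mc xy(2)] by simp
    hence "M *\<^sub>v y = 0\<^sub>v (n + 1)" unfolding sum0 mult_mat_vec_zero[OF quot_mat_carrier] by simp
    hence y0: "y = 0\<^sub>v D" using frame_inj[OF M xy(2), of "0\<^sub>v D"] mult_mat_vec_zero[OF Mc] by simp
    have x0: "x = 0\<^sub>v (D - 1)"
    proof (rule eq_vecI)
      fix i assume "i < dim_vec (0\<^sub>v (D - 1) :: complex vec)"
      hence i: "i < D - 1" by simp
      hence i2: "i < 2 * n" using D by simp
      have "unit_block D *\<^sub>v x = 0\<^sub>v (2 * n)"
        using sum0 cx unfolding y0 mult_mat_vec_zero[OF bl(2)] by simp
      moreover have "(unit_block D *\<^sub>v x) $ i = 1 * x $ i"
        by (rule mult_mat_vec_single[OF bl(1) xy(1) i2 i]) (use i2 in \<open>auto simp: unit_block_def\<close>)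
      ultimately show "x $ i = 0\<^sub>v (D - 1) $ i" using i i2 by simp
    qed (use xy(1) in simp)
    show "z = 0\<^sub>v (D - 1 + D)" unfolding xy(3) x0 y0 by (intro eq_vecI) auto
  qed
  have "colsp (embed_mat D M) \<subseteq> emb D (colsp M)"
    unfolding embed_mat_def colsp_hcat[OF bl]
  proof
    fix w assume "w \<in> {u + v |u v. u \<in> colsp (unit_block D) \<and> v \<in> colsp (lift_mat D M)}"
    then obtain u v where uv: "w = u + v" "u \<in> colsp (unit_block D)" "v \<in> colsp (lift_mat D M)" by blast
    have "u \<in> emb D (colsp M)" using uv(2) unit_block_colsp[OF D(2)] coord_sub_le_emb[OF lM D] by blast
    moreover have "colsp (lift_mat D M) \<subseteq> emb D (colsp M)"
    proof (rule colsp_subsetI[OF bl(2) lin_sub_emb[OF lM]])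
      fix j assume j: "j < D"
      have c: "col M j \<in> carrier_vec (n + 1)" using Mc j by auto
      show "col (lift_mat D M) j \<in> emb D (colsp M)"
        unfolding col_lift_mat[OF Mc j] emb_def
        using lift_vec_coord_sub[OF D(1)] coord_sub_mono[of 0 "D - 1" "n + D" "n + D" "2 * n"]
          quot_lift[OF c D] col_in_colsp[OF Mc j] by auto
    qed
    ultimately show "w \<in> emb D (colsp M)" using lin_subD(3)[OF lin_sub_emb[OF lM]] uv by blast
  qed
  moreover have "vdim (2 * n) (emb D (colsp M)) = vdim (2 * n) (colsp (embed_mat D M))"
    unfolding vdim_emb[OF lM D] vdim_colsp[OF fr] vdim_colsp[OF M] by simp
  ultimately show ?thesis
    using lin_sub_eqI[OF lin_sub_colsp[OF frame_carrier[OF fr]] lin_sub_emb[OF lM]] by simp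
qed

text \<open>The coordinate of \<open>V\<close> that is read at coordinate \<open>i\<close> of \<open>W\<close>; \<open>src_coeff\<close> is the accompanying sign.\<close>

definition src :: "nat \<Rightarrow> nat" where "src i = (if i \<le> n then i else i - n - 1)"

definition src_coeff :: "nat \<Rightarrow> complex" where "src_coeff i = (if i \<le> n then eps i else 1)"

lemma lift_vec_src:
  assumes "1 \<le> D" "D \<le> n" "D - 1 \<le> i" "i < n + D"
  shows "lift_vec D u $ i = src_coeff i * u $ src i"
  using assms unfolding lift_vec_def src_def src_coeff_def by auto

lemma src_inj_on: "1 \<le> D \<Longrightarrow> inj_on src {D - 1..<n + D}"
  unfolding src_def by (rule inj_onI) (auto split: if_splits)

text \<open>The first \<open>D - 1\<close> rows of the selected block are unit vectors, and the lifts vanish there; so the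
  minor is that of the lower right block, whose rows are signed rows of \<open>M\<close>.\<close>

lemma minor_embed:
  assumes D: "1 \<le> D" "D \<le> n" and I: "{..<D - 1} \<subseteq> I" "I \<subseteq> {..<n + D}" "card I = 2 * D - 1"
  defines "J \<equiv> src ` (I - {..<D - 1})"
  shows "J \<subseteq> {..<n + 1}" "card J = D"
    "\<exists>\<kappa>\<noteq>0. \<forall>M\<in>carrier_mat (n + 1) D. det (submatrix (embed_mat D M) I UNIV) = \<kappa> * det (submatrix M J UNIV)"
proof -
  have fI: "finite I" using I(2) finite_subset by blast
  have sub: "I - {..<D - 1} \<subseteq> {D - 1..<n + D}" using I(2) by auto
  show J: "J \<subseteq> {..<n + 1}"
  proof
    fix y assume "y \<in> J"
    then obtain x where "x \<in> {D - 1..<n + D}" "y = src x" unfolding J_def using sub by blast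
    thus "y \<in> {..<n + 1}" using D unfolding src_def by auto
  qed
  have "card (I - {..<D - 1}) = D" using card_Diff_subset[of "{..<D - 1}" I] I D by simp
  thus cJ: "card J = D"
    unfolding J_def using card_image[OF inj_on_subset[OF src_inj_on[OF D(1)] sub]] by simp
  define r where "r = (\<lambda>i. src (pick I (D - 1 + i)))"
  have pl: "pick I i = i" if "i < D - 1" for i using pick_initial[OF I(1) that] .
  have pg: "D - 1 \<le> pick I i" if "D - 1 \<le> i" "i < 2 * D - 1" for i
    using le_pick[of i I] that I(3) by simp
  have pm: "pick I i \<in> I" if "i < 2 * D - 1" for i using pick_in_set_le[of i I] that I(3) by simp
  have shift: "pick I ` (\<lambda>i. D - 1 + i) ` {..<D} = I - {..<D - 1}"
  proof (intro equalityI subsetI)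
    fix x assume "x \<in> pick I ` (\<lambda>i. D - 1 + i) ` {..<D}"
    then obtain i where i: "i < D" "x = pick I (D - 1 + i)" by auto
    have "D - 1 \<le> D - 1 + i" "D - 1 + i < 2 * D - 1" using i(1) by auto
    thus "x \<in> I - {..<D - 1}" using pm[of "D - 1 + i"] pg[of "D - 1 + i"] unfolding i(2)
      by (simp only: Diff_iff lessThan_iff not_less simp_thms)
  next
    fix x assume x: "x \<in> I - {..<D - 1}"
    then obtain a where a: "a < 2 * D - 1" "x = pick I a"
      using pick_bij[OF fI] I(3) unfolding bij_betw_def by auto
    have "D - 1 \<le> a" using pl[of a] x a(2) by fastforce
    hence "x = pick I (D - 1 + (a - (D - 1)))" "a - (D - 1) < D" using a by auto
    thus "x \<in> pick I ` (\<lambda>i. D - 1 + i) ` {..<D}" by blast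
  qed
  have rJ: "r ` {..<D} = J" unfolding J_def shift[symmetric] r_def by (simp only: image_image)
  have rn: "r i < n + 1" if "i < D" for i using rJ J that by blast
  have rinj: "inj_on r {..<D}" using cJ rJ by (intro eq_card_imp_inj_on) auto
  obtain \<kappa> :: complex where \<kappa>: "\<kappa> \<noteq> 0"
    "\<And>M. M \<in> carrier_mat (n + 1) D \<Longrightarrow> det (rowmat M D r) = \<kappa> * det (submatrix M J UNIV)"
    using det_rowmat_minor[of D r "n + 1"] rn rinj unfolding rJ by blast
  define c where "c = (\<lambda>i. src_coeff (pick I (D - 1 + i)))"
  have "det (submatrix (embed_mat D M) I UNIV) = (\<Prod>i\<in>{0..<D}. c i) * \<kappa> * det (submatrix M J UNIV)"
    if M: "M \<in> carrier_mat (n + 1) D" for M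
  proof -
    define B where "B = mat D D (\<lambda>(i,j). c i * rowmat M D r $$ (i,j))"
    have em: "embed_mat D M $$ (i,j) = (if j < D - 1 then if i = j then 1 else 0 else lift_vec D (col M (j - (D - 1))) $ i)"
      if "i < 2 * n" "j < D - 1 + D" for i j
      using that M unfolding embed_mat_def hcat_def unit_block_def lift_mat_def by auto
    have I2: "I \<subseteq> {..<2 * n}" using I(2) D by auto
    have "submatrix (embed_mat D M) I UNIV = rowmat (embed_mat D M) (2 * D - 1) (pick I)"
      by (rule submatrix_rowmat[OF embed_mat_carrier[OF M D(1)] I2 I(3)])
    also have "\<dots> = four_block_mat (1\<^sub>m (D - 1)) (0\<^sub>m (D - 1) D) (0\<^sub>m D (D - 1)) B" (is "_ = ?F")
    proof (rule eq_matI)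
      fix i j assume "i < dim_row ?F" "j < dim_col ?F"
      hence ij: "i < D - 1 + D" "j < D - 1 + D" unfolding B_def by auto
      hence ij': "i < 2 * D - 1" "j < 2 * D - 1" using D by auto
      have pn: "pick I i < n + D" using pm[OF ij'(1)] I(2) by auto
      hence pn2: "pick I i < 2 * n" using D by simp
      have l: "rowmat (embed_mat D M) (2 * D - 1) (pick I) $$ (i,j) =
          (if j < D - 1 then if pick I i = j then 1 else 0 else lift_vec D (col M (j - (D - 1))) $ pick I i)"
        using em[OF pn2 ij(2)] ij' unfolding rowmat_def by simp
      show "rowmat (embed_mat D M) (2 * D - 1) (pick I) $$ (i,j) = ?F $$ (i,j)"
      proof (cases "i < D - 1")
        case True
        hence "lift_vec D u $ i = 0" for u unfolding lift_vec_def using D by auto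
        thus ?thesis unfolding l pl[OF True] using True ij unfolding B_def by (auto simp: index_mat_four_block)
      next
        case False
        hence g: "D - 1 \<le> pick I i" using pg ij' by simp
        have e: "lift_vec D u $ pick I i = c (i - (D - 1)) * u $ r (i - (D - 1))" for u
          unfolding lift_vec_src[OF D g pn] c_def r_def using False by simp
        have rr: "r (i - (D - 1)) < n + 1" using rn[of "i - (D - 1)"] ij False by simp
        show ?thesis unfolding l e using False ij g M rr unfolding B_def rowmat_def by (auto simp: index_mat_four_block)
      qed
    qed (use D in \<open>auto simp: B_def rowmat_def\<close>)
    also have "det ?F = det (1\<^sub>m (D - 1)) * det B"
      by (rule det_four_block_mat_upper_right_zero) (auto simp: B_def)
    also have "det B = (\<Prod>i\<in>{0..<D}. c i) * det (rowmat M D r)"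
      unfolding B_def by (rule det_scale_rows[OF rowmat_carrier])
    finally show ?thesis unfolding \<kappa>(2)[OF M] by simp
  qed
  moreover have "(\<Prod>i\<in>{0..<D}. c i) * \<kappa> \<noteq> 0" using \<kappa>(1) eps_sq(2) unfolding c_def src_coeff_def by auto
  ultimately show "\<exists>\<kappa>\<noteq>0. \<forall>M\<in>carrier_mat (n + 1) D. det (submatrix (embed_mat D M) I UNIV) = \<kappa> * det (submatrix M J UNIV)"
    by blast
qed

text \<open>For other index sets a row or a column of the selected block is zero.\<close>

lemma minor_embed_forward:
  assumes D: "1 \<le> D" "D \<le> n" and I: "I \<subseteq> {..<2 * n}" "card I = 2 * D - 1"
  shows "\<exists>c J. J \<subseteq> {..<n + 1} \<and> card J = D \<and> (\<forall>M\<in>carrier_mat (n + 1) D.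
    det (submatrix (embed_mat D M) I UNIV) = c * det (submatrix M J UNIV))"
proof (cases "{..<D - 1} \<subseteq> I \<and> I \<subseteq> {..<n + D}")
  case True
  thus ?thesis using minor_embed[OF D _ _ I(2)] by blast
next
  case False
  have "det (submatrix (embed_mat D M) I UNIV) = 0" if M: "M \<in> carrier_mat (n + 1) D" for M
  proof -
    note S = submatrix_rowmat[OF embed_mat_carrier[OF M D(1)] I]
    have em: "embed_mat D M $$ (i,j) = (if j < D - 1 then if i = j then 1 else 0 else lift_vec D (col M (j - (D - 1))) $ i)"
      if "i < 2 * n" "j < D - 1 + D" for i j
      using that M unfolding embed_mat_def hcat_def unit_block_def lift_mat_def by auto
    have pI: "pick I i \<in> I" "pick I i < 2 * n" if "i < 2 * D - 1" for i
      using pick_in_set_le[of i I] pick_lt[OF I(1), of i] that I(2) by auto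
    show ?thesis
    proof (cases "{..<D - 1} \<subseteq> I")
      case True
      then obtain x where x: "x \<in> I" "\<not> x < n + D" using False by blast
      hence x: "x \<in> I" "n + D \<le> x" by auto
      have fI: "finite I" using I(1) finite_subset by blast
      obtain a where a: "a < 2 * D - 1" "x = pick I a" using pick_bij[OF fI] x(1) I(2) unfolding bij_betw_def by auto
      have z: "lift_vec D u $ x = 0" for u using x(2) pI(2)[OF a(1)] D unfolding lift_vec_def a(2) by auto
      show ?thesis unfolding S
      proof (rule det_zero_row[OF rowmat_carrier a(1)])
        fix j assume j: "j < 2 * D - 1"
        hence "j < D - 1 + D" by simp
        from em[OF pI(2)[OF a(1)] this] show "rowmat (embed_mat D M) (2 * D - 1) (pick I) $$ (a,j) = 0"
          using a j x(2) z D unfolding rowmat_def by auto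
      qed
    next
      case False
      then obtain b where b: "b < D - 1" "b \<notin> I" by auto
      show ?thesis unfolding S
      proof (rule det_zero_col[OF rowmat_carrier])
        show "b < 2 * D - 1" using b by simp
        fix i assume i: "i < 2 * D - 1"
        have "b < D - 1 + D" using b by simp
        moreover have "pick I i \<noteq> b" using pI(1)[OF i] b(2) by auto
        ultimately show "rowmat (embed_mat D M) (2 * D - 1) (pick I) $$ (i,b) = 0"
          using em[OF pI(2)[OF i], of b] i b(1) unfolding rowmat_def by auto
      qed
    qed
  qed
  moreover have "{..<D} \<subseteq> {..<n + 1} \<and> card {..<D} = D" using D by auto
  ultimately show ?thesis by (intro exI[of _ 0] exI[of _ "{..<D}"]) auto
qed

lemma minor_embed_backward:
  assumes D: "1 \<le> D" "D \<le> n" and J: "J \<subseteq> {..<n + 1}" "card J = D"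
  shows "\<exists>c I. I \<subseteq> {..<2 * n} \<and> card I = 2 * D - 1 \<and> (\<forall>M\<in>carrier_mat (n + 1) D.
    det (submatrix M J UNIV) = c * det (submatrix (embed_mat D M) I UNIV))"
proof -
  define dst where "dst = (\<lambda>j. if D \<le> j + 1 then j else n + 1 + j)"
  have sd: "src (dst j) = j" if "j \<in> J" for j using that J(1) unfolding src_def dst_def by auto
  have di: "inj_on dst J" using sd by (metis inj_onI)
  have dr: "dst ` J \<subseteq> {D - 1..<n + D}" unfolding dst_def using J(1) D by auto
  define I where "I = {..<D - 1} \<union> dst ` J"
  have disj: "{..<D - 1} \<inter> dst ` J = {}" using dr by fastforce
  have fJ: "finite J" using J(1) finite_subset by blast
  have I: "{..<D - 1} \<subseteq> I" "I \<subseteq> {..<n + D}" "card I = 2 * D - 1"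
    unfolding I_def using dr D card_Un_disjoint[OF _ _ disj] fJ card_image[OF di] J(2) by auto
  have "I - {..<D - 1} = dst ` J" unfolding I_def using disj by blast
  hence "src ` (I - {..<D - 1}) = J" using sd by (auto simp: image_image)
  then obtain \<kappa> where \<kappa>: "\<kappa> \<noteq> 0" "\<forall>M\<in>carrier_mat (n + 1) D. det (submatrix (embed_mat D M) I UNIV) = \<kappa> * det (submatrix M J UNIV)"
    using minor_embed(3)[OF D I] by auto
  have "I \<subseteq> {..<2 * n}" using I(2) D by auto
  moreover have "\<forall>M\<in>carrier_mat (n + 1) D. det (submatrix M J UNIV) = (1 / \<kappa>) * det (submatrix (embed_mat D M) I UNIV)"
    using \<kappa> by simp
  ultimately show ?thesis using I(3) by blast
qed

lemma embed_pluecker: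
  assumes V: "V \<in> Gr_prod (n + 1) d s"
    and M: "\<And>l. l \<in> {1..s} \<Longrightarrow> frame (n + 1) (d l) (M l)" "\<And>l. l \<in> {1..s} \<Longrightarrow> colsp (M l) = V l"
  shows "pcoord (2 * n) dW s (\<lambda>l. embed_mat (d l) (M l)) \<in> pluecker (2 * n) dW s (zeta V)"
proof (rule plueckerI)
  fix l assume l: "l \<in> {1..s}"
  show "embed_mat (d l) (M l) \<in> carrier_mat (2 * n) (2 * d l - 1)"
    by (rule embed_mat_carrier[OF frame_carrier[OF M(1)[OF l]] d_ge[OF l]])
  show "colsp (embed_mat (d l) (M l)) = zeta V l"
    using colsp_embed_mat[OF M(1)[OF l] d_ge[OF l] d_le[OF l]] M(2)[OF l] l unfolding zeta_def by simp
qed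

lemma zeta_coords:
  obtains c J where "\<And>V x. V \<in> Gr_prod (n + 1) d s \<Longrightarrow> x \<in> pluecker (n + 1) d s V \<Longrightarrow>
    coord_subst c J x \<in> pluecker (2 * n) dW s (zeta V)"
proof -
  let ?ok = "\<lambda>l I. l \<in> {1..s} \<and> I \<subseteq> {..<2 * n} \<and> card I = 2 * d l - 1"
  have ex: "\<forall>l I. \<exists>c J. (?ok l I \<longrightarrow> J \<subseteq> {..<n + 1} \<and> card J = d l \<and> (\<forall>M\<in>carrier_mat (n + 1) (d l).
      det (submatrix (embed_mat (d l) M) I UNIV) = c * det (submatrix M J UNIV))) \<and> (\<not> ?ok l I \<longrightarrow> c = 0)"
  proof (intro allI)
    fix l I
    show "\<exists>c J. (?ok l I \<longrightarrow> J \<subseteq> {..<n + 1} \<and> card J = d l \<and> (\<forall>M\<in>carrier_mat (n + 1) (d l).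
      det (submatrix (embed_mat (d l) M) I UNIV) = c * det (submatrix M J UNIV))) \<and> (\<not> ?ok l I \<longrightarrow> c = 0)"
    proof (cases "?ok l I")
      case True
      thus ?thesis using minor_embed_forward[of "d l" I, OF d_ge d_le] by blast
    qed blast
  qed
  from choice2[OF ex] obtain c J where
    R: "\<forall>l I. (?ok l I \<longrightarrow> J l I \<subseteq> {..<n + 1} \<and> card (J l I) = d l \<and> (\<forall>M\<in>carrier_mat (n + 1) (d l).
      det (submatrix (embed_mat (d l) M) I UNIV) = c l I * det (submatrix M (J l I) UNIV))) \<and> (\<not> ?ok l I \<longrightarrow> c l I = 0)" .
  have cJ: "J l I \<subseteq> {..<n + 1} \<and> card (J l I) = d l \<and> (\<forall>M\<in>carrier_mat (n + 1) (d l).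
      det (submatrix (embed_mat (d l) M) I UNIV) = c l I * det (submatrix M (J l I) UNIV))" if "?ok l I" for l I
    using R that by blast
  have c0: "c l I = 0" if "\<not> ?ok l I" for l I using R that by blast
  show ?thesis
  proof (rule that[of c J])
    fix V x assume V: "V \<in> Gr_prod (n + 1) d s" and x: "x \<in> pluecker (n + 1) d s V"
    obtain M where M: "x = pcoord (n + 1) d s M" "\<And>l. l \<in> {1..s} \<Longrightarrow> frame (n + 1) (d l) (M l)"
      "\<And>l. l \<in> {1..s} \<Longrightarrow> colsp (M l) = V l" using plueckerE[OF V x] by blast
    have "coord_subst c J x = pcoord (2 * n) dW s (\<lambda>l. embed_mat (d l) (M l))"
    proof (intro ext)
      fix l I
      show "coord_subst c J x l I = pcoord (2 * n) dW s (\<lambda>l. embed_mat (d l) (M l)) l I"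
      proof (cases "?ok l I")
        case True
        thus ?thesis using cJ[OF True] frame_carrier[OF M(2)]
          unfolding coord_subst_def M(1) pcoord_def by simp
      next
        case False
        thus ?thesis using c0[OF False] unfolding coord_subst_def pcoord_def by auto
      qed
    qed
    thus "coord_subst c J x \<in> pluecker (2 * n) dW s (zeta V)" using embed_pluecker[OF V M(2,3)] by simp
  qed
qed

text \<open>A basis of \<open>W l\<close> need not be of the form \<open>embed_mat\<close>, but its coordinates are proportional to those
  of such a basis, and the factors are absorbed by \<open>pluecker_rescale\<close>.\<close>

lemma zeta_inverse_coords:
  obtains c I where "\<And>V x. V \<in> Gr_prod (n + 1) d s \<Longrightarrow> x \<in> pluecker (2 * n) dW s (zeta V) \<Longrightarrow>
    coord_subst c I x \<in> pluecker (n + 1) d s V"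
proof -
  let ?ok = "\<lambda>l J. l \<in> {1..s} \<and> J \<subseteq> {..<n + 1} \<and> card J = d l"
  have ex: "\<forall>l J. \<exists>c I. (?ok l J \<longrightarrow> I \<subseteq> {..<2 * n} \<and> card I = 2 * d l - 1 \<and> (\<forall>M\<in>carrier_mat (n + 1) (d l).
      det (submatrix M J UNIV) = c * det (submatrix (embed_mat (d l) M) I UNIV))) \<and> (\<not> ?ok l J \<longrightarrow> c = 0)"
  proof (intro allI)
    fix l J
    show "\<exists>c I. (?ok l J \<longrightarrow> I \<subseteq> {..<2 * n} \<and> card I = 2 * d l - 1 \<and> (\<forall>M\<in>carrier_mat (n + 1) (d l).
      det (submatrix M J UNIV) = c * det (submatrix (embed_mat (d l) M) I UNIV))) \<and> (\<not> ?ok l J \<longrightarrow> c = 0)"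
    proof (cases "?ok l J")
      case True
      thus ?thesis using minor_embed_backward[of "d l" J, OF d_ge d_le] by blast
    qed blast
  qed
  from choice2[OF ex] obtain c I where
    R: "\<forall>l J. (?ok l J \<longrightarrow> I l J \<subseteq> {..<2 * n} \<and> card (I l J) = 2 * d l - 1 \<and> (\<forall>M\<in>carrier_mat (n + 1) (d l).
      det (submatrix M J UNIV) = c l J * det (submatrix (embed_mat (d l) M) (I l J) UNIV))) \<and> (\<not> ?ok l J \<longrightarrow> c l J = 0)" .
  have cI: "I l J \<subseteq> {..<2 * n} \<and> card (I l J) = 2 * d l - 1 \<and> (\<forall>M\<in>carrier_mat (n + 1) (d l).
      det (submatrix M J UNIV) = c l J * det (submatrix (embed_mat (d l) M) (I l J) UNIV))" if "?ok l J" for l J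
    using R that by blast
  have c0: "c l J = 0" if "\<not> ?ok l J" for l J using R that by blast
  show ?thesis
  proof (rule that[of c I])
    fix V x assume V: "V \<in> Gr_prod (n + 1) d s" and x: "x \<in> pluecker (2 * n) dW s (zeta V)"
    obtain z where z: "z \<in> pluecker (n + 1) d s V" using pluecker_nonempty[OF V] .
    obtain M where M: "z = pcoord (n + 1) d s M" "\<And>l. l \<in> {1..s} \<Longrightarrow> frame (n + 1) (d l) (M l)"
      "\<And>l. l \<in> {1..s} \<Longrightarrow> colsp (M l) = V l" using plueckerE[OF V z] by blast
    obtain a where a: "\<And>l. a l \<noteq> (0::complex)"
      "\<And>l I. x l I = a l * pcoord (2 * n) dW s (\<lambda>l. embed_mat (d l) (M l)) l I"
      using pluecker_unique[OF zeta_Gr_prod[OF V] embed_pluecker[OF V M(2,3)] x] by blast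
    have "coord_subst c I x = (\<lambda>l J. a l * z l J)"
    proof (intro ext)
      fix l J
      show "coord_subst c I x l J = a l * z l J"
      proof (cases "?ok l J")
        case True
        thus ?thesis using cI[OF True] frame_carrier[OF M(2)]
          unfolding coord_subst_def a(2) M(1) pcoord_def by simp
      next
        case False
        thus ?thesis using c0[OF False] unfolding coord_subst_def M(1) pcoord_def by auto
      qed
    qed
    thus "coord_subst c I x \<in> pluecker (n + 1) d s V" using pluecker_rescale[OF V z a(1) d_ge] by simp
  qed
qed

section \<open>The isomorphism of varieties\<close>

lemma SpFl_deg_subset: "SpFl_deg m d s \<subseteq> Gr_prod (n + 1) d s"
  using SpFl_deg_iff by blast

lemma bounded_flags_Sp_subset: "bounded_flags_Sp \<subseteq> Gr_prod (2 * n) dW s"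
  using flags_Sp_Gr unfolding bounded_flags_Sp_def by blast

text \<open>Closedness is inherited from the symplectic flags, since \<open>zeta\<close> is continuous on the whole product
  of Grassmannians.\<close>

lemma closedin_SpFl_deg: "closedin (zariski (n + 1) d s) (SpFl_deg m d s)"
proof -
  obtain c J where cJ: "\<And>V x. V \<in> Gr_prod (n + 1) d s \<Longrightarrow> x \<in> pluecker (n + 1) d s V \<Longrightarrow>
    coord_subst c J x \<in> pluecker (2 * n) dW s (zeta V)" using zeta_coords by blast
  have mor: "morphism (n + 1) d s (Gr_prod (n + 1) d s) (2 * n) dW s (Gr_prod (2 * n) dW s) zeta"
    by (rule morphism_coord_subst[OF subset_refl subset_refl _ cJ]) (use zeta_Gr_prod in blast)+
  have top: "subtopology (zariski N e s) (Gr_prod N e s) = zariski N e s" for N e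
    using subtopology_topspace[of "zariski N e s"] unfolding topspace_zariski .
  have cont: "continuous_map (zariski (n + 1) d s) (zariski (2 * n) dW s) zeta"
    using mor[unfolded morphism_def top] by (rule conjunct1)
  have "SpFl_deg m d s = {V \<in> topspace (zariski (n + 1) d s). zeta V \<in> flags_Sp n d s}"
    unfolding topspace_zariski using SpFl_deg_iff by blast
  thus ?thesis using closedin_continuous_map_preimage[OF cont closedin_flags_Sp] by simp
qed

lemma closedin_bounded_flags_Sp: "closedin (zariski (2 * n) dW s) bounded_flags_Sp"
proof -
  have "bounded_flags_Sp = flags_Sp n d s \<inter> {U \<in> Gr_prod (2 * n) dW s. \<forall>l\<in>{1..s}. U l \<subseteq> coord_sub (2 * n) 0 (n + d l)}"
    unfolding bounded_flags_Sp_def using flags_Sp_Gr by blast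
  thus ?thesis using closedin_Int[OF closedin_flags_Sp closedin_bounded] by simp
qed

lemma zeta_iso: "variety_iso (n + 1) d s (SpFl_deg m d s) (2 * n) dW s bounded_flags_Sp zeta"
proof -
  note bij = bij_betw_zeta
  have im: "zeta ` SpFl_deg m d s = bounded_flags_Sp" using bij unfolding bij_betw_def by blast
  have "morphism (n + 1) d s (SpFl_deg m d s) (2 * n) dW s bounded_flags_Sp zeta"
  proof -
    obtain c J where cJ: "\<And>V x. V \<in> Gr_prod (n + 1) d s \<Longrightarrow> x \<in> pluecker (n + 1) d s V \<Longrightarrow>
      coord_subst c J x \<in> pluecker (2 * n) dW s (zeta V)" using zeta_coords by blast
    show ?thesis
      by (rule morphism_coord_subst[OF SpFl_deg_subset bounded_flags_Sp_subset _ cJ])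
        (use im SpFl_deg_subset in blast)+
  qed
  moreover have "morphism (2 * n) dW s bounded_flags_Sp (n + 1) d s (SpFl_deg m d s) (inv_into (SpFl_deg m d s) zeta)"
  proof -
    obtain c I where cI: "\<And>V x. V \<in> Gr_prod (n + 1) d s \<Longrightarrow> x \<in> pluecker (2 * n) dW s (zeta V) \<Longrightarrow>
      coord_subst c I x \<in> pluecker (n + 1) d s V" using zeta_inverse_coords by blast
    have inv: "inv_into (SpFl_deg m d s) zeta p \<in> SpFl_deg m d s" "zeta (inv_into (SpFl_deg m d s) zeta p) = p"
      if "p \<in> bounded_flags_Sp" for p
      using that inv_into_into[of p zeta "SpFl_deg m d s"] f_inv_into_f[of p zeta "SpFl_deg m d s"] im by auto
    show ?thesis
    proof (rule morphism_coord_subst[OF bounded_flags_Sp_subset SpFl_deg_subset])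
      show "inv_into (SpFl_deg m d s) zeta ` bounded_flags_Sp \<subseteq> SpFl_deg m d s" using inv by blast
      fix p x assume p: "p \<in> bounded_flags_Sp" and x: "x \<in> pluecker (2 * n) dW s p"
      show "coord_subst c I x \<in> pluecker (n + 1) d s (inv_into (SpFl_deg m d s) zeta p)"
        using cI[of "inv_into (SpFl_deg m d s) zeta p" x] inv[OF p] x SpFl_deg_subset by auto
    qed
  qed
  ultimately show ?thesis
    unfolding variety_iso_def projective_variety_def
    using closedin_SpFl_deg closedin_bounded_flags_Sp bij by blast
qed

section \<open>The torus\<close>

text \<open>The fixed-point equation says \<open>t G t\<^sup>T = G\<close> for the Gram matrix \<open>G\<close>; the relation between the
  entries is its \<open>(i, 2n - 1 - i)\<close> entry.\<close>

lemma torus_SpD: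
  assumes t: "t \<in> torus_Sp n"
  shows "t \<in> carrier_mat (2 * n) (2 * n)" "\<And>i j. i < 2 * n \<Longrightarrow> j < 2 * n \<Longrightarrow> i \<noteq> j \<Longrightarrow> t $$ (i,j) = 0"
    "\<And>i. i < 2 * n \<Longrightarrow> t $$ (i,i) * t $$ (2 * n - 1 - i, 2 * n - 1 - i) = 1"
proof -
  show tc: "t \<in> carrier_mat (2 * n) (2 * n)" using t unfolding torus_Sp_def torus_SL_def SL_def by simp
  show diag: "\<And>i j. i < 2 * n \<Longrightarrow> j < 2 * n \<Longrightarrow> i \<noteq> j \<Longrightarrow> t $$ (i,j) = 0"
    using t tc unfolding torus_Sp_def torus_SL_def diagonal_mat_def by auto
  have dt: "det t = 1" and inv: "SL_involution n t = t"
    using t unfolding torus_Sp_def torus_SL_def SL_def Sp_def by auto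
  have invertible: "\<exists>B. mat_inverse A = Some B \<and> A * B = 1\<^sub>m k \<and> B * A = 1\<^sub>m k \<and> B \<in> carrier_mat k k"
    if A: "A \<in> carrier_mat k k" "det A \<noteq> 0" for A :: "complex mat" and k
  proof (cases "mat_inverse A")
    case None
    have "A \<notin> Units (ring_mat TYPE(complex) k ())" by (rule mat_inverse(1)[OF A(1) None])
    moreover have "A \<in> Units (ring_mat TYPE(complex) k ())" by (rule det_non_zero_imp_unit[OF A])
    ultimately show ?thesis by (rule notE)
  next
    case (Some B)
    thus ?thesis using mat_inverse(2)[OF A(1) Some] by blast
  qed
  have tT: "transpose_mat t \<in> carrier_mat (2 * n) (2 * n)" "det (transpose_mat t) \<noteq> 0"
    using tc det_transpose[OF tc] dt by auto
  obtain B where B: "mat_inverse (transpose_mat t) = Some B" "B * transpose_mat t = 1\<^sub>m (2 * n)"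
    "B \<in> carrier_mat (2 * n) (2 * n)" using invertible[OF tT] by blast
  have "det (gram_W n) \<noteq> 0" using det_0_iff_vec_prod_zero[OF gram_W_carrier] gram_W_inj by blast
  then obtain H where H: "mat_inverse (gram_W n) = Some H" "H * gram_W n = 1\<^sub>m (2 * n)"
    "H \<in> carrier_mat (2 * n) (2 * n)" using invertible[OF gram_W_carrier] by blast
  define G where "G = gram_W n"
  have G: "G \<in> carrier_mat (2 * n) (2 * n)" unfolding G_def by (rule gram_W_carrier)
  have e: "G * B * H = t" using inv unfolding SL_involution_def B(1) H(1) G_def by simp
  have GB: "G * B \<in> carrier_mat (2 * n) (2 * n)" using G B(3) by simp
  have "t * G = G * B"
    unfolding e[symmetric] assoc_mult_mat[OF GB H(3) G] using H(2) right_mult_one_mat[OF GB] unfolding G_def by simp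
  hence tG: "t * G * transpose_mat t = G"
    using assoc_mult_mat[OF G B(3) tT(1)] B(2) right_mult_one_mat[OF G] by simp
  fix i assume i: "i < 2 * n"
  define i' where "i' = 2 * n - 1 - i"
  have i': "i' < 2 * n" "2 * n - 1 - i' = i" unfolding i'_def using i by auto
  define c :: complex where "c = (if i < n then 1 else -1)"
  have single: "(A *\<^sub>v w) $ a = A $$ (a,a) * w $ a" if "A \<in> carrier_mat (2 * n) (2 * n)"
    "\<And>i j. i < 2 * n \<Longrightarrow> j < 2 * n \<Longrightarrow> i \<noteq> j \<Longrightarrow> A $$ (i,j) = 0" "w \<in> carrier_vec (2 * n)" "a < 2 * n" for A :: "complex mat" and w a
    by (rule mult_mat_vec_single[OF that(1,3,4,4)]) (use that in auto)
  have u: "unit_vec (2 * n) i' \<in> carrier_vec (2 * n)" by simp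
  have g: "(G *\<^sub>v w) $ i = c * w $ i'" if "w \<in> carrier_vec (2 * n)" for w
    unfolding G_def c_def i'_def using gram_W_index[OF that i] .
  have tu: "transpose_mat t *\<^sub>v unit_vec (2 * n) i' \<in> carrier_vec (2 * n)"
    by (rule mult_mat_vec_carrier[OF tT(1) u])
  have "(G *\<^sub>v unit_vec (2 * n) i') $ i = ((t * G * transpose_mat t) *\<^sub>v unit_vec (2 * n) i') $ i" unfolding tG ..
  also have "(t * G * transpose_mat t) *\<^sub>v unit_vec (2 * n) i' = t *\<^sub>v (G *\<^sub>v (transpose_mat t *\<^sub>v unit_vec (2 * n) i'))"
    unfolding assoc_mult_mat_vec[OF mult_carrier_mat[OF tc G] tT(1) u] assoc_mult_mat_vec[OF tc G tu] ..
  also have "\<dots> $ i = t $$ (i,i) * (G *\<^sub>v (transpose_mat t *\<^sub>v unit_vec (2 * n) i')) $ i"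
    by (rule single[OF tc diag mult_mat_vec_carrier[OF G tu] i])
  also have "(G *\<^sub>v (transpose_mat t *\<^sub>v unit_vec (2 * n) i')) $ i = c * (transpose_mat t *\<^sub>v unit_vec (2 * n) i') $ i'"
    by (rule g[OF tu])
  also have "(transpose_mat t *\<^sub>v unit_vec (2 * n) i') $ i' = transpose_mat t $$ (i',i') * unit_vec (2 * n) i' $ i'"
    by (rule single[OF tT(1) _ u i'(1)]) (use tc diag in auto)
  also have "(G *\<^sub>v unit_vec (2 * n) i') $ i = c * unit_vec (2 * n) i' $ i'" by (rule g[OF u])
  finally have "c = t $$ (i,i) * (c * t $$ (i',i'))" using i'(1) tc by simp
  moreover have "c \<noteq> 0" unfolding c_def by simp
  ultimately show "t $$ (i,i) * t $$ (2 * n - 1 - i, 2 * n - 1 - i) = 1" unfolding i'_def by (simp add: mult.left_commute)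
qed

lemma torus_act_index:
  assumes t: "t \<in> torus_Sp n" and w: "w \<in> carrier_vec (2 * n)" and i: "i < 2 * n"
  shows "(t *\<^sub>v w) $ i = t $$ (i,i) * w $ i"
  by (rule mult_mat_vec_single[OF torus_SpD(1)[OF t] w i i]) (use torus_SpD(2)[OF t] i in auto)

lemma torus_nonzero: "t \<in> torus_Sp n \<Longrightarrow> i < 2 * n \<Longrightarrow> t $$ (i,i) \<noteq> 0"
  using torus_SpD(3) by (metis mult_zero_left zero_neq_one)

lemma torus_V_carrier: "torus_V n D t \<in> carrier_mat (n + 1) (n + 1)"
  unfolding torus_V_def by simp

lemma torus_V_index:
  assumes v: "v \<in> carrier_vec (n + 1)" and j: "j < n + 1"
  shows "(torus_V n D t *\<^sub>v v) $ j = (if D \<le> j + 1 then t $$ (j,j) else t $$ (n + 1 + j, n + 1 + j)) * v $ j"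
  by (rule mult_mat_vec_single[OF torus_V_carrier v j j]) (use j in \<open>auto simp: torus_V_def\<close>)

lemma torus_inj:
  assumes t: "t \<in> torus_Sp n" and w: "w \<in> carrier_vec (2 * n)" "t *\<^sub>v w = 0\<^sub>v (2 * n)"
  shows "w = 0\<^sub>v (2 * n)"
proof (rule eq_vecI)
  fix i assume "i < dim_vec (0\<^sub>v (2 * n) :: complex vec)"
  hence i: "i < 2 * n" by simp
  have "t $$ (i,i) * w $ i = 0" using torus_act_index[OF t w(1) i] w(2) i by simp
  thus "w $ i = 0\<^sub>v (2 * n) $ i" using torus_nonzero[OF t i] i by simp
qed (use w in simp)

lemma torus_V_inj:
  assumes t: "t \<in> torus_Sp n" and D: "D \<le> n" and v: "v \<in> carrier_vec (n + 1)" "torus_V n D t *\<^sub>v v = 0\<^sub>v (n + 1)"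
  shows "v = 0\<^sub>v (n + 1)"
proof (rule eq_vecI)
  fix j assume "j < dim_vec (0\<^sub>v (n + 1) :: complex vec)"
  hence j: "j < n + 1" by simp
  have "(if D \<le> j + 1 then t $$ (j,j) else t $$ (n + 1 + j, n + 1 + j)) \<noteq> 0"
    using torus_nonzero[OF t, of j] torus_nonzero[OF t, of "n + 1 + j"] j D n_pos(1) by auto
  moreover have "(if D \<le> j + 1 then t $$ (j,j) else t $$ (n + 1 + j, n + 1 + j)) * v $ j = 0"
    using torus_V_index[OF v(1) j, of D t] v(2) j by simp
  ultimately show "v $ j = 0\<^sub>v (n + 1) $ j" using j by (simp only: mult_eq_0_iff) simp
qed (use v in simp)

lemma quot_torus:
  assumes t: "t \<in> torus_Sp n" and D: "D \<le> n" and w: "w \<in> carrier_vec (2 * n)"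
  shows "quot_mat D *\<^sub>v (t *\<^sub>v w) = torus_V n D t *\<^sub>v (quot_mat D *\<^sub>v w)"
proof (rule eq_vecI)
  show "dim_vec (quot_mat D *\<^sub>v (t *\<^sub>v w)) = dim_vec (torus_V n D t *\<^sub>v (quot_mat D *\<^sub>v w))"
    using quot_mat_carrier[of D] torus_V_carrier[of D t] by simp
  fix j assume "j < dim_vec (torus_V n D t *\<^sub>v (quot_mat D *\<^sub>v w))"
  hence j: "j < n + 1" using torus_V_carrier[of D t] by simp
  have j2: "j < 2 * n" using j n_pos by simp
  have j3: "n + 1 + j < 2 * n" if "\<not> D \<le> j + 1" using that D by simp
  show "(quot_mat D *\<^sub>v (t *\<^sub>v w)) $ j = (torus_V n D t *\<^sub>v (quot_mat D *\<^sub>v w)) $ j"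
    unfolding quot_mat_index[OF mult_mat_vec_carrier[OF torus_SpD(1)[OF t] w] j D]
      torus_V_index[OF mult_mat_vec_carrier[OF quot_mat_carrier w] j] quot_mat_index[OF w j D]
    using torus_act_index[OF t w j2] torus_act_index[OF t w j3] by auto
qed

lemma emb_torus:
  assumes t: "t \<in> torus_Sp n" and D: "1 \<le> D" "D \<le> n" and U: "U \<in> Gr (n + 1) D"
  shows "(\<lambda>v. torus_V n D t *\<^sub>v v) ` U \<in> Gr (n + 1) D"
    "emb D ((\<lambda>v. torus_V n D t *\<^sub>v v) ` U) = (\<lambda>w. t *\<^sub>v w) ` emb D U"
proof -
  show TU: "(\<lambda>v. torus_V n D t *\<^sub>v v) ` U \<in> Gr (n + 1) D"
    by (rule Gr_image[OF torus_V_carrier torus_V_inj[OF t D(2)] U])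
  have tE: "(\<lambda>w. t *\<^sub>v w) ` emb D U \<in> Gr (2 * n) (2 * D - 1)"
    by (rule Gr_image[OF torus_SpD(1)[OF t] torus_inj[OF t] emb_Gr[OF U D]])
  have sub: "(\<lambda>w. t *\<^sub>v w) ` emb D U \<subseteq> emb D ((\<lambda>v. torus_V n D t *\<^sub>v v) ` U)"
  proof
    fix x assume "x \<in> (\<lambda>w. t *\<^sub>v w) ` emb D U"
    then obtain w where w: "w \<in> coord_sub (2 * n) 0 (n + D)" "quot_mat D *\<^sub>v w \<in> U" "x = t *\<^sub>v w"
      unfolding emb_def by auto
    note wc = coord_subD[OF w(1)]
    have "x \<in> coord_sub (2 * n) 0 (n + D)"
      using mult_mat_vec_carrier[OF torus_SpD(1)[OF t] wc(1)] torus_act_index[OF t wc(1)] wc(3)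
      unfolding w(3) coord_sub_def by auto
    moreover have "quot_mat D *\<^sub>v x \<in> (\<lambda>v. torus_V n D t *\<^sub>v v) ` U"
      unfolding w(3) quot_torus[OF t D(2) wc(1)] using w(2) by blast
    ultimately show "x \<in> emb D ((\<lambda>v. torus_V n D t *\<^sub>v v) ` U)" unfolding emb_def by simp
  qed
  have "(\<lambda>w. t *\<^sub>v w) ` emb D U = emb D ((\<lambda>v. torus_V n D t *\<^sub>v v) ` U)"
    using vdim_Gr[OF tE] vdim_Gr[OF emb_Gr[OF TU D]]
    by (intro lin_sub_eqI[OF lin_sub_Gr[OF tE] lin_sub_Gr[OF emb_Gr[OF TU D]] sub]) simp
  thus "emb D ((\<lambda>v. torus_V n D t *\<^sub>v v) ` U) = (\<lambda>w. t *\<^sub>v w) ` emb D U" by simp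
qed

lemma zeta_equivariant:
  assumes t: "t \<in> torus_Sp n" and V: "V \<in> Gr_prod (n + 1) d s"
  shows "act_V n d s t V \<in> Gr_prod (n + 1) d s" "zeta (act_V n d s t V) = act_W s t (zeta V)"
proof -
  have l: "act_V n d s t V l = (\<lambda>v. torus_V n (d l) t *\<^sub>v v) ` V l" if "l \<in> {1..s}" for l
    using that unfolding act_V_def by simp
  show "act_V n d s t V \<in> Gr_prod (n + 1) d s"
  proof (rule Gr_prodI)
    show "act_V n d s t V \<in> extensional {1..s}" unfolding act_V_def by simp
    show "act_V n d s t V k \<in> Gr (n + 1) (d k)" if k: "k \<in> {1..s}" for k
      unfolding l[OF k] using emb_torus(1)[OF t d_ge[OF k] d_le[OF k] Gr_prodD[OF V k]] .
  qed
  show "zeta (act_V n d s t V) = act_W s t (zeta V)"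
  proof (rule extensionalityI[of _ "{1..s}"])
    show "zeta (act_V n d s t V) \<in> extensional {1..s}" unfolding zeta_def by simp
    show "act_W s t (zeta V) \<in> extensional {1..s}" unfolding act_W_def by simp
    show "zeta (act_V n d s t V) k = act_W s t (zeta V) k" if k: "k \<in> {1..s}" for k
      using emb_torus(2)[OF t d_ge[OF k] d_le[OF k] Gr_prodD[OF V k]] k unfolding zeta_def act_W_def l[OF k, symmetric]
      by (simp add: l[OF k])
  qed
qed

lemma torus_form:
  assumes t: "t \<in> torus_Sp n" and u: "u \<in> carrier_vec (2 * n)" and v: "v \<in> carrier_vec (2 * n)"
  shows "(t *\<^sub>v u) \<bullet> (gram_W n *\<^sub>v (t *\<^sub>v v)) = u \<bullet> (gram_W n *\<^sub>v v)"
proof -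
  note tv = mult_mat_vec_carrier[OF torus_SpD(1)[OF t] v]
  have "(t *\<^sub>v u) \<bullet> (gram_W n *\<^sub>v (t *\<^sub>v v)) = (\<Sum>i\<in>{0..<2 * n}. (t *\<^sub>v u) $ i * (gram_W n *\<^sub>v (t *\<^sub>v v)) $ i)"
    using gram_W_carrier unfolding scalar_prod_def by simp
  also have "\<dots> = (\<Sum>i\<in>{0..<2 * n}. u $ i * (gram_W n *\<^sub>v v) $ i)"
  proof (rule sum.cong[OF refl])
    fix i assume "i \<in> {0..<2 * n}"
    hence i: "i < 2 * n" "2 * n - 1 - i < 2 * n" by auto
    show "(t *\<^sub>v u) $ i * (gram_W n *\<^sub>v (t *\<^sub>v v)) $ i = u $ i * (gram_W n *\<^sub>v v) $ i"
      unfolding gram_W_index[OF tv i(1)] gram_W_index[OF v i(1)] torus_act_index[OF t u i(1)] torus_act_index[OF t v i(2)]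
      using torus_SpD(3)[OF t i(1)] by (simp add: algebra_simps)
  qed
  also have "\<dots> = u \<bullet> (gram_W n *\<^sub>v v)" using gram_W_carrier unfolding scalar_prod_def by simp
  finally show ?thesis .
qed

lemma torus_flags_Sp:
  assumes t: "t \<in> torus_Sp n" and W: "W \<in> flags_Sp n d s"
  shows "act_W s t W \<in> flags_Sp n d s"
proof -
  note WG = flags_Sp_Gr[OF W]
  have l: "act_W s t W k = (\<lambda>w. t *\<^sub>v w) ` W k" if "k \<in> {1..s}" for k using that unfolding act_W_def by simp
  have G: "act_W s t W \<in> Gr_prod (2 * n) dW s"
  proof (rule Gr_prodI)
    show "act_W s t W \<in> extensional {1..s}" unfolding act_W_def by simp
    show "act_W s t W k \<in> Gr (2 * n) (2 * d k - 1)" if k: "k \<in> {1..s}" for k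
      unfolding l[OF k] by (rule Gr_image[OF torus_SpD(1)[OF t] torus_inj[OF t] Gr_prodD[OF WG k]])
  qed
  have "u \<bullet> (gram_W n *\<^sub>v v) = 0"
    if k: "k \<in> {1..s}" "k' = s + 1 - k \<or> k' = s - k \<and> k < s" and uv: "u \<in> act_W s t W k" "v \<in> act_W s t W k'" for k k' u v
  proof -
    have k': "k' \<in> {1..s}" using k by auto
    obtain u0 v0 where u0: "u0 \<in> W k" "u = t *\<^sub>v u0" and v0: "v0 \<in> W k'" "v = t *\<^sub>v v0"
      using uv unfolding l[OF k(1)] l[OF k'] by auto
    have c: "u0 \<in> carrier_vec (2 * n)" "v0 \<in> carrier_vec (2 * n)"
      using lin_subD(5)[OF lin_sub_Gr[OF Gr_prodD[OF WG k(1)]] u0(1)]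
        lin_subD(5)[OF lin_sub_Gr[OF Gr_prodD[OF WG k']] v0(1)] by auto
    have "u0 \<bullet> (gram_W n *\<^sub>v v0) = 0" using W k u0(1) v0(1) unfolding flags_Sp_eq_isotropic by blast
    thus ?thesis unfolding u0(2) v0(2) torus_form[OF t c] .
  qed
  thus ?thesis unfolding flags_Sp_eq_isotropic using G by blast
qed

lemma torus_SpFl_deg:
  assumes t: "t \<in> torus_Sp n" and V: "V \<in> SpFl_deg m d s"
  shows "act_V n d s t V \<in> SpFl_deg m d s" "zeta (act_V n d s t V) = act_W s t (zeta V)"
proof -
  have VG: "V \<in> Gr_prod (n + 1) d s" "zeta V \<in> flags_Sp n d s" using V SpFl_deg_iff by auto
  show "zeta (act_V n d s t V) = act_W s t (zeta V)" by (rule zeta_equivariant(2)[OF t VG(1)])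
  thus "act_V n d s t V \<in> SpFl_deg m d s"
    unfolding SpFl_deg_iff using zeta_equivariant(1)[OF t VG(1)] torus_flags_Sp[OF t VG(2)] by simp
qed

end

theorem theorem4p2:
  fixes m n s :: nat and d :: "nat \<Rightarrow> nat"
  assumes "1 \<le> m" and "n = 2 * m - 1" and "1 \<le> s"
    and "strict_mono_on {1..s} d"
    and "\<forall>i\<in>{1..s}. 1 \<le> d i \<and> d i \<le> 2 * m"
    and "(\<lambda>k. 2 * m - k) ` d ` {1..s} = d ` {1..s}"
    and "d 0 = 0" and "d (s + 1) = n + 1"
  shows "sigma n d s permutes {1..2 * n} \<and>
    (\<exists>\<zeta>. variety_iso (n + 1) d s (SpFl_deg m d s)
            (2 * n) (\<lambda>l. 2 * d l - 1) s (schubert_Sp n d s (sigma n d s)) \<zeta> \<and>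
         (\<forall>t\<in>torus_Sp n. \<forall>p\<in>SpFl_deg m d s.
            act_V n d s t p \<in> SpFl_deg m d s \<and>
            \<zeta> (act_V n d s t p) = act_W s t (\<zeta> p)))"
proof -
  interpret symplectic_type m n s d
    by unfold_locales (fact assms)+
  show ?thesis
  proof (intro conjI exI[of _ zeta] ballI)
    show "sigma n d s permutes {1..2 * n}" by (rule sigma_permutes)
    show "variety_iso (n + 1) d s (SpFl_deg m d s)
        (2 * n) (\<lambda>l. 2 * d l - 1) s (schubert_Sp n d s (sigma n d s)) zeta"
      unfolding schubert_Sp_eq by (rule zeta_iso)
    fix t p assume "t \<in> torus_Sp n" "p \<in> SpFl_deg m d s"
    thus "act_V n d s t p \<in> SpFl_deg m d s" "zeta (act_V n d s t p) = act_W s t (zeta p)"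
      by (rule torus_SpFl_deg)+
  qed
qed

end
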